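(* Let $a,b,c\in\mathbb R$ satisfy $a,b>-1$, $0<c-a-b-2<1$ and $c\ge\max\{a+2,b+2\}$. Then the following hold. (a) Suppose $b+1\neq 3+a+b-c$ and $-a\neq c-a-b-2$. Then $T_{a,b,c}$ and $S_{a,b,c}$ map $L^p(\mathbb D)$ boundedly into $L^{q,\infty}(\mathbb D)$ for all $1\le p,q\le\infty$ with $\frac1q=\frac1p+c-a-b-2$. (b) Suppose $-a=c-a-b-2$ and $b+1\ne 3+a+b-c$. Then: (1) $T_{a,b,c}$ and $S_{a,b,c}$ map $L^p(\mathbb D)$ boundedly into $L^{q,\infty}(\mathbb D)$ for all $1\le p,q\le\infty$ with $\frac1q=\frac1p+c-a-b-2$ and $p\ne\infty$, while at $(p,q)=\left(\infty,\frac{1}{c-a-b-2}\right)$ both $T_{a,b,c}$ and $S_{a,b,c}$ are unbounded from $L^\infty(\mathbb D)$ to $L^{\frac{1}{c-a-b-2},\infty}(\mathbb D)$. (2) The restricted weak-type estimate at $(p,q)=\left(\infty,\frac{1}{c-a-b-2}\right)$ also fails for both $T_{a,b,c}$ and $S_{a,b,c}$. (c) Suppose $b+1=3+a+b-c$ and $-a\ne c-a-b-2$. Then: (1) $T_{a,b,c}$ and $S_{a,b,c}$ map $L^p(\mathbb D)$ boundedly into $L^{q,\infty}(\mathbb D)$ for all $1\le p,q\le\infty$ with $\frac1q=\frac1p+c-a-b-2$ and $q\neq1$, while at $(p,q)=\left(\frac{1}{3+a+b-c},1\right)$ both $T_{a,b,c}$ and $S_{a,b,c}$ are unbounded from $L^{\frac{1}{3+a+b-c}}(\mathbb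 D)$ to $L^{1,\infty}(\mathbb D)$. (2) $T_{a,b,c}$ and $S_{a,b,c}$ map $L^{\frac{1}{3+a+b-c},1}(\mathbb D)$ boundedly into $L^{1,\infty}(\mathbb D)$. (d) Suppose $b+1=3+a+b-c$ and $-a=c-a-b-2$. Then: (1) $T_{a,b,c}$ and $S_{a,b,c}$ map $L^p(\mathbb D)$ boundedly into $L^{q,\infty}(\mathbb D)$ for all $1\le p,q\le\infty$ with $\frac1q=\frac1p+c-a-b-2$, $p\neq\infty$ and $q\ne1$, while at $(p,q)=\left(\infty,\frac{1}{c-a-b-2}\right)$ and $(p,q)=\left(\frac{1}{3+a+b-c},1\right)$ both $T_{a,b,c}$ and $S_{a,b,c}$ fail to be of weak type. (2) $T_{a,b,c}$ and $S_{a,b,c}$ map $L^{\frac{1}{3+a+b-c},1}(\mathbb D)$ boundedly into $L^{1,\infty}(\mathbb D)$, while both fail to satisfy a restricted weak-type estimate at $(p,q)=\left(\infty,\frac{1}{c-a-b-2}\right)$.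
   Context: $\mathbb D$ is the open unit disc in $\mathbb C$, $dA$ is normalized area measure on $\mathbb D$, and $|E|$ is the $dA$-measure of $E\subseteq\mathbb D$. For $a,b,c\in\mathbb R$, $$T_{a,b,c}f(z):=(1-|z|^2)^a\int_{\mathbb D}\frac{(1-|w|^2)^b}{(1-z\overline w)^c}f(w)\,dA(w),\qquad S_{a,b,c}f(z):=(1-|z|^2)^a\int_{\mathbb D}\frac{(1-|w|^2)^b}{|1-z\overline w|^c}f(w)\,dA(w),$$ with the principal branch of the power. $L^p(\mathbb D)=L^p(\mathbb D,dA)$. For $1\le q<\infty$, $\|f\|_{L^{q,\infty}}=\sup_{\lambda>0}\lambda|\{|f|>\lambda\}|^{1/q}$, and $L^{\infty,\infty}=L^\infty$. For $1\le p<\infty$, $\|f\|_{L^{p,1}}=p\int_0^\infty|\{|f|>\lambda\}|^{1/p}\,d\lambda$. An operator $\mathcal T$ maps $X$ boundedly into $Y$ if for every $f\in X$ the defining integral converges absolutely for a.e. $z$ and $\|\mathcal Tf\|_Y\le C\|f\|_X$ with $C$ independent of $f$; otherwise it is unbounded from $X$ to $Y$. $\mathcal T$ is of weak type at $(p,q)$ if it is bounded from $L^p(\mathbb D)$ to $L^{q,\infty}(\mathbb D)$. The restricted weak-type estimate at $(p,q)$ means, for $p<\infty$, boundedness from $L^{p,1}(\mathbb D)$ to $L^{q,\infty}(\mathbb D)$, and, for $p=\infty$, that $\|\mathcal T\mathbf 1_E\|_{L^{q,\infty}}\le C$ for all measurable $E\subseteq\mathbb D$. *)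

theory Defs
  imports "HOL-Probability.Probability"
begin

definition dA :: "complex measure" where
  "dA = scale_measure (ennreal (1 / pi)) (lebesgue_on (ball 0 1))"

text \<open>
  Powers of extended nonnegative reals, used for exponents \<open>s > 0\<close> only.
\<close>

definition ennreal_powr :: "ennreal \<Rightarrow> real \<Rightarrow> ennreal" where
  "ennreal_powr x s = (if x = \<top> then \<top> else ennreal (enn2real x powr s))"

definition distribution :: "(complex \<Rightarrow> complex) \<Rightarrow> real \<Rightarrow> ennreal" where
  "distribution f t = emeasure dA {z \<in> space dA. t < cmod (f z)}"

text \<open>
  The (quasi-)norms below take values in \<open>[0,\<infinity>]\<close>; the space is the set of measurable
  functions of finite norm. Exponents are extended nonnegative reals, intended for
  \<open>1 \<le> p\<close> and \<open>1 \<le> q\<close>; in this type \<open>1 / \<infinity> = 0\<close>.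
\<close>

definition Lp_norm :: "ennreal \<Rightarrow> (complex \<Rightarrow> complex) \<Rightarrow> ennreal" where
  "Lp_norm p f =
     (if p = \<infinity> then esssup dA (\<lambda>z. ennreal (cmod (f z)))
      else ennreal_powr (\<integral>\<^sup>+ z. ennreal (cmod (f z) powr enn2real p) \<partial>dA) (1 / enn2real p))"

definition weak_norm :: "ennreal \<Rightarrow> (complex \<Rightarrow> complex) \<Rightarrow> ennreal" where
  "weak_norm q f =
     (if q = \<infinity> then Lp_norm \<infinity> f
      else (SUP t\<in>{0<..}. ennreal t * ennreal_powr (distribution f t) (1 / enn2real q)))"

text \<open>The Lorentz norm of \<open>L\<^sup>p\<^sup>,\<^sup>1\<close>, for finite \<open>p\<close>.\<close>

definition lorentz1_norm :: "ennreal \<Rightarrow> (complex \<Rightarrow> complex) \<Rightarrow> ennreal" where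
  "lorentz1_norm p f =
     p * (\<integral>\<^sup>+ t\<in>{0<..}. ennreal_powr (distribution f t) (1 / enn2real p) \<partial>lborel)"

text \<open>
  An operator is a pair of an outer weight \<open>u\<close> and a kernel \<open>k\<close>, and sends \<open>f\<close> to
  \<open>u z * (\<integral> k z w * f w dA w)\<close>. Keeping the kernel makes it possible to speak of the absolute
  convergence of the defining integral (the library integral is \<open>0\<close> when it diverges).
\<close>

type_synonym disc_op = "(complex \<Rightarrow> real) \<times> (complex \<Rightarrow> complex \<Rightarrow> complex)"

definition apply_op :: "disc_op \<Rightarrow> (complex \<Rightarrow> complex) \<Rightarrow> complex \<Rightarrow> complex" where
  "apply_op \<T> f z = complex_of_real (fst \<T> z) * (\<integral>w. snd \<T> z w * f w \<partial>dA)"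

definition converges_ae :: "disc_op \<Rightarrow> (complex \<Rightarrow> complex) \<Rightarrow> bool" where
  "converges_ae \<T> f \<longleftrightarrow> (AE z in dA. integrable dA (\<lambda>w. snd \<T> z w * f w))"

definition T_op :: "real \<Rightarrow> real \<Rightarrow> real \<Rightarrow> disc_op" where
  "T_op a b c =
     (\<lambda>z. (1 - (cmod z)\<^sup>2) powr a,
      \<lambda>z w. complex_of_real ((1 - (cmod w)\<^sup>2) powr b) / (1 - z * cnj w) powr complex_of_real c)"

definition S_op :: "real \<Rightarrow> real \<Rightarrow> real \<Rightarrow> disc_op" where
  "S_op a b c =
     (\<lambda>z. (1 - (cmod z)\<^sup>2) powr a,
      \<lambda>z w. complex_of_real ((1 - (cmod w)\<^sup>2) powr b / cmod (1 - z * cnj w) powr c))"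

text \<open>
  Membership of \<open>\<T> f\<close> in the target space includes measurability. It is stated explicitly because
  the library assigns measure \<open>0\<close> to non-measurable sets.
\<close>

definition maps_boundedly ::
  "disc_op \<Rightarrow> ((complex \<Rightarrow> complex) \<Rightarrow> ennreal) \<Rightarrow> ((complex \<Rightarrow> complex) \<Rightarrow> ennreal) \<Rightarrow> bool" where
  "maps_boundedly \<T> X Y \<longleftrightarrow>
     (\<exists>C::real. \<forall>f \<in> borel_measurable dA. X f < \<infinity> \<longrightarrow>
        converges_ae \<T> f \<and> apply_op \<T> f \<in> borel_measurable dA \<and>
        Y (apply_op \<T> f) \<le> ennreal C * X f)"

definition weak_type :: "disc_op \<Rightarrow> ennreal \<Rightarrow> ennreal \<Rightarrow> bool" where
  "weak_type \<T> p q \<longleftrightarrow> maps_boundedly \<T> (Lp_norm p) (weak_norm q)"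

definition restricted_weak_type :: "disc_op \<Rightarrow> ennreal \<Rightarrow> ennreal \<Rightarrow> bool" where
  "restricted_weak_type \<T> p q \<longleftrightarrow>
     (if p = \<infinity> then
        (\<exists>C::real. \<forall>E \<in> sets dA.
           converges_ae \<T> (indicator E) \<and> apply_op \<T> (indicator E) \<in> borel_measurable dA \<and>
           weak_norm q (apply_op \<T> (indicator E)) \<le> ennreal C)
      else maps_boundedly \<T> (lorentz1_norm p) (weak_norm q))"

end

theory Submission
  imports Defs "HOL-Complex_Analysis.Complex_Analysis"
begin

text \<open>
  Put \<open>s = c - a - b - 2\<close>, \<open>x = 1 - |z|\<^sup>2\<close> and \<open>y = 1 - |w|\<^sup>2\<close>; the hypotheses say \<open>a, b \<ge> -s\<close>.

  Positive results. Weak-type bounds follow from bounds of \<open>\<integral>\<^sub>F S f\<close> over sets \<open>F\<close> of measure at most \<open>2m\<close>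
  contained in \<open>x \<ge> m\<close>. There \<open>x\<^sup>-\<^sup>s \<le> m\<^sup>-\<^sup>s\<close>, so that for \<open>1 < p < \<infinity>\<close> the Schur test for the Forelli-Rudin operator
  with parameters \<open>a + s, b, a + b + 2 + s\<close> suffices; for \<open>p = \<infinity>\<close> the Forelli-Rudin estimate itself does.
  At the endpoint \<open>b = -s\<close>, \<open>q = 1\<close> one tests on indicators of sets \<open>E\<close> and applies Young's inequality
  with exponents below and above \<open>1 / (1 - s)\<close> on \<open>y > |E|\<close> and \<open>y \<le> |E|\<close>.

  Negative results. If \<open>b = -s\<close>, the integral of \<open>y powr (s - 1) / (1 - ln y)\<close>, a function in
  \<open>L\<^sup>1\<^sup>/\<^sup>(\<^sup>1\<^sup>-\<^sup>s\<^sup>)\<close>, diverges absolutely for every \<open>z\<close>. If \<open>a = -s\<close>, a restricted estimate for \<open>T\<close> at \<open>p = \<infinity>\<close> would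
  bound the means of the Bergman-type projection of every indicator over thin annuli at the boundary; pairing
  with a Riesz product with frequencies \<open>4\<^sup>k\<close> contradicts this. Since \<open>|T 1\<^sub>E| \<le> S 1\<^sub>E\<close>, it fails for \<open>S\<close> as well.
\<close>

section \<open>Area measure on the disc\<close>

text \<open>The factor \<open>m powr - s\<close> lost on F is what 1/q = 1/p + s permits: the target
  is m^(1 - 1/q) = m^(1 - 1/p) m^(-s), and the remaining operator has the critical homogeneity c = a
  + b + 2 with a + s in place of a. Discarding the strip x < m costs at most half of a level set of
  measure 2m; unlike testing by duality, this survives at q = 1, where the target is not normable.

  For T with a = - s the obvious candidates reveal nothing: by the mean value property T 1 is a
  constant multiple of x^(-s), which lies in weak L^(1/s). Failure needs phases rotating at many
  scales at once, whereas the hypothesis speaks of indicators only. Hence the transpose of T is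
  applied to one bounded function g on an annulus: indicators control the L^1 norm of the image, and
  the image is tested against unimodular phases on disjoint annuli. The Riesz product is a bounded g
  with N coefficients of order 1 / sqrt N at once, whose contributions add up to order sqrt
  N.\<close>

lemma measurable_Complex [measurable]:
  "(\<lambda>p. Complex (fst p) (snd p)) \<in> borel_measurable (borel \<Otimes>\<^sub>M borel)"
  unfolding borel_prod by (intro borel_measurable_continuous_onI continuous_intros)

text \<open>Lebesgue measure is determined by its values on open boxes, and a complex box pulls back
  to a rectangle. This gives Fubini in real coordinates, on which the rotation invariance and the
  angular estimate rest.\<close>

lemma lborel_complex: "lborel = distr (lborel \<Otimes>\<^sub>M lborel) borel (\<lambda>p. Complex (fst p) (snd p))"
proof (rule lborel_eqI)
  fix l u :: complex
  assume le: "\<And>b. b \<in> Basis \<Longrightarrow> l \<bullet> b \<le> u \<bullet> b"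
  have le': "Re l \<le> Re u" "Im l \<le> Im u"
    using le[of 1] le[of \<i>] by (auto simp: Basis_complex_def inner_complex_def)
  have "(\<lambda>p. Complex (fst p) (snd p)) -` box l u \<inter> space (lborel \<Otimes>\<^sub>M lborel)
      = {Re l<..<Re u} \<times> {Im l<..<Im u}"
    by (auto simp: box_def Basis_complex_def inner_complex_def space_pair_measure)
  then show "emeasure (distr (lborel \<Otimes>\<^sub>M lborel) borel (\<lambda>p. Complex (fst p) (snd p))) (box l u)
      = ennreal (\<Prod>b\<in>Basis. (u - l) \<bullet> b)"
    using le' by (subst emeasure_distr)
      (auto simp: lborel.emeasure_pair_measure_Times Basis_complex_def inner_complex_def ennreal_mult)
qed auto

lemma nn_integral_lborel_complex:
  assumes [measurable]: "F \<in> borel_measurable borel"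
  shows "(\<integral>\<^sup>+z. F z \<partial>lborel) = (\<integral>\<^sup>+x. \<integral>\<^sup>+y. F (Complex x y) \<partial>lborel \<partial>lborel)"
  by (subst lborel_complex, subst nn_integral_distr)
     (auto simp: lborel_pair.nn_integral_fst[symmetric] lborel.nn_integral_fst[symmetric])

text \<open>With the imaginary part fixed, the shear is a translation of the real line, so Fubini
  and translation invariance in one variable suffice.\<close>

lemma nn_integral_shear_Re:
  assumes [measurable]: "F \<in> borel_measurable borel"
  shows "(\<integral>\<^sup>+z. F (Complex (Re z + t * Im z) (Im z)) \<partial>lborel) = (\<integral>\<^sup>+z. F z \<partial>lborel)"
proof -
  have [measurable]: "(\<lambda>z. Complex (Re z + t * Im z) (Im z)) \<in> borel_measurable borel"
    by (intro borel_measurable_continuous_onI continuous_intros)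
  have [measurable]: "(\<lambda>p. Complex (fst p + t * snd p) (snd p)) \<in> borel_measurable (borel \<Otimes>\<^sub>M borel)"
    unfolding borel_prod by (intro borel_measurable_continuous_onI continuous_intros)
  have "(\<integral>\<^sup>+z. F (Complex (Re z + t * Im z) (Im z)) \<partial>lborel)
      = (\<integral>\<^sup>+x. \<integral>\<^sup>+y. F (Complex (x + t * y) y) \<partial>lborel \<partial>lborel)"
    by (subst nn_integral_lborel_complex) auto
  also have "\<dots> = (\<integral>\<^sup>+y. \<integral>\<^sup>+x. F (Complex (x + t * y) y) \<partial>lborel \<partial>lborel)"
    by (rule lborel_pair.Fubini'[symmetric]) (simp add: split_beta')
  also have "\<dots> = (\<integral>\<^sup>+y. \<integral>\<^sup>+x. F (Complex x y) \<partial>lborel \<partial>lborel)"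
  proof (rule nn_integral_cong)
    fix y :: real
    have [measurable]: "(\<lambda>x. Complex x y) \<in> borel_measurable borel"
      by (intro borel_measurable_continuous_onI continuous_intros)
    show "(\<integral>\<^sup>+x. F (Complex (x + t * y) y) \<partial>lborel) = (\<integral>\<^sup>+x. F (Complex x y) \<partial>lborel)"
      using nn_integral_real_affine[of "\<lambda>x. F (Complex x y)" 1 "t * y"] by (simp add: add.commute)
  qed
  also have "\<dots> = (\<integral>\<^sup>+x. \<integral>\<^sup>+y. F (Complex x y) \<partial>lborel \<partial>lborel)"
    by (rule lborel_pair.Fubini') (simp add: split_beta')
  also have "\<dots> = (\<integral>\<^sup>+z. F z \<partial>lborel)"
    by (rule nn_integral_lborel_complex[symmetric]) auto
  finally show ?thesis .
qed

lemma nn_integral_shear_Im: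
  assumes [measurable]: "F \<in> borel_measurable borel"
  shows "(\<integral>\<^sup>+z. F (Complex (Re z) (Im z + t * Re z)) \<partial>lborel) = (\<integral>\<^sup>+z. F z \<partial>lborel)"
proof -
  have [measurable]: "(\<lambda>z. Complex (Re z) (Im z + t * Re z)) \<in> borel_measurable borel"
    by (intro borel_measurable_continuous_onI continuous_intros)
  have "(\<integral>\<^sup>+z. F (Complex (Re z) (Im z + t * Re z)) \<partial>lborel)
      = (\<integral>\<^sup>+x. \<integral>\<^sup>+y. F (Complex x (y + t * x)) \<partial>lborel \<partial>lborel)"
    by (subst nn_integral_lborel_complex) auto
  also have "\<dots> = (\<integral>\<^sup>+x. \<integral>\<^sup>+y. F (Complex x y) \<partial>lborel \<partial>lborel)"
  proof (rule nn_integral_cong)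
    fix x :: real
    have [measurable]: "(\<lambda>y. Complex x y) \<in> borel_measurable borel"
      by (intro borel_measurable_continuous_onI continuous_intros)
    show "(\<integral>\<^sup>+y. F (Complex x (y + t * x)) \<partial>lborel) = (\<integral>\<^sup>+y. F (Complex x y) \<partial>lborel)"
      using nn_integral_real_affine[of "\<lambda>y. F (Complex x y)" 1 "t * x"] by (simp add: add.commute)
  qed
  also have "\<dots> = (\<integral>\<^sup>+z. F z \<partial>lborel)"
    by (rule nn_integral_lborel_complex[symmetric]) auto
  finally show ?thesis .
qed

text \<open>A rotation by an angle outside \<open>\<pi>\<int>\<close> is a product of three shears.\<close>

lemma nn_integral_rotate_lborel:
  assumes [measurable]: "F \<in> borel_measurable borel" and u: "cmod u = 1"
  shows "(\<integral>\<^sup>+z. F (u * z) \<partial>lborel) = (\<integral>\<^sup>+z. F z \<partial>lborel)"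
proof -
  have main: "(\<integral>\<^sup>+z. G (v * z) \<partial>lborel) = (\<integral>\<^sup>+z. G z \<partial>lborel)"
    if [measurable]: "G \<in> borel_measurable borel" and v: "cmod v = 1" "Im v \<noteq> 0"
    for G :: "complex \<Rightarrow> ennreal" and v
  proof -
    \<comment> \<open>For \<open>v = cis \<theta>\<close> this is
      \<open>- tan (\<theta> / 2)\<close>: shearing the real part by \<open>t\<close>, the imaginary
      part by \<open>Im v\<close> and the real part by \<open>t\<close> again is multiplication by
      \<open>v\<close>.\<close>
    define t where "t = (Re v - 1) / Im v"
    have "(Re v)\<^sup>2 + (Im v)\<^sup>2 = 1"
      using v(1) by (simp add: cmod_def)
    then have t: "t * Im v = Re v - 1" "t * (1 + Re v) = - Im v"
      using v(2) by (auto simp: t_def field_simps power2_eq_square)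
    define H where "H z = G (Complex (Re z + t * Im z) (Im z))" for z
    have [measurable]: "(\<lambda>z. Complex (Re z + t * Im z) (Im z)) \<in> borel_measurable borel"
      by (intro borel_measurable_continuous_onI continuous_intros)
    have [measurable]: "(\<lambda>z. Complex (Re z) (Im z + Im v * Re z)) \<in> borel_measurable borel"
      by (intro borel_measurable_continuous_onI continuous_intros)
    have [measurable]: "H \<in> borel_measurable borel"
      unfolding H_def by measurable
    define H' where "H' z = H (Complex (Re z) (Im z + Im v * Re z))" for z
    have [measurable]: "H' \<in> borel_measurable borel"
      unfolding H'_def by measurable
    have "Complex (Re z + t * Im z + t * (Im z + Im v * (Re z + t * Im z))) (Im z + Im v * (Re z + t * Im z))
        = v * z" for z
    proof (rule complex_eqI)
      have "Im z + Im v * (Re z + t * Im z) = Im v * Re z + (1 + t * Im v) * Im z"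
        by (simp add: algebra_simps)
      also have "\<dots> = Im (v * z)"
        by (simp add: t(1) algebra_simps)
      finally have im: "Im z + Im v * (Re z + t * Im z) = Im (v * z)" .
      then show "Im (Complex (Re z + t * Im z + t * (Im z + Im v * (Re z + t * Im z))) (Im z + Im v * (Re z + t * Im z)))
        = Im (v * z)" by simp
      have "Re z + t * Im z + t * Im (v * z) = (1 + t * Im v) * Re z + (t * (1 + Re v)) * Im z"
        by (simp add: algebra_simps)
      also have "\<dots> = Re (v * z)"
        by (simp only: t) (simp add: algebra_simps)
      finally show "Re (Complex (Re z + t * Im z + t * (Im z + Im v * (Re z + t * Im z))) (Im z + Im v * (Re z + t * Im z)))
        = Re (v * z)" using im by simp
    qed
    then have "(\<integral>\<^sup>+z. G (v * z) \<partial>lborel) = (\<integral>\<^sup>+z. H' (Complex (Re z + t * Im z) (Im z)) \<partial>lborel)"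
      by (simp add: H'_def H_def)
    also have "\<dots> = (\<integral>\<^sup>+z. G z \<partial>lborel)"
      by (simp add: nn_integral_shear_Re) (simp add: H'_def nn_integral_shear_Im, simp add: H_def nn_integral_shear_Re)
    finally show ?thesis .
  qed
  show ?thesis
  proof (cases "Im u = 0")
    case False
    with main[of F u] u show ?thesis by simp
  next
    case True
    \<comment> \<open>Here \<open>u\<close> is 1 or -1. It factors as \<open>v * \<i>\<close>, and
      both factors have nonzero imaginary part.\<close>
    define v where "v = u * (- \<i>)"
    have v: "cmod v = 1" "Im v \<noteq> 0"
      using u True by (auto simp: v_def norm_mult cmod_def)
    have "(\<integral>\<^sup>+z. F (u * z) \<partial>lborel) = (\<integral>\<^sup>+z. F (v * (\<i> * z)) \<partial>lborel)"
      by (simp add: v_def mult.assoc)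
    also have "\<dots> = (\<integral>\<^sup>+z. F (v * z) \<partial>lborel)"
      by (rule main[of "\<lambda>z. F (v * z)" \<i>]) auto
    also have "\<dots> = (\<integral>\<^sup>+z. F z \<partial>lborel)"
      by (rule main) (use v in auto)
    finally show ?thesis .
  qed
qed

section \<open>Integration against \<open>dA\<close>: rotation invariance and total mass one\<close>

lemma ball_measurable [measurable]: "ball (a::complex) r \<in> sets borel"
  by simp

lemma space_dA [simp]: "space dA = ball 0 1"
  by (simp add: dA_def space_scale_measure)

lemma sets_dA: "sets dA = sets (lebesgue_on (ball 0 1))"
  by (simp add: dA_def)

lemma measurable_dA_cong: "measurable dA N = measurable (lebesgue_on (ball 0 1)) N"
  by (intro measurable_cong_sets sets_dA refl)

lemma id_measurable_dA [measurable]: "(\<lambda>z. z) \<in> borel_measurable dA"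
  unfolding measurable_dA_cong by (intro measurable_restrict_space1) (simp add: measurable_completion)

lemma measurable_dA_I: "f \<in> measurable borel N \<Longrightarrow> f \<in> measurable dA N"
  using measurable_compose[OF id_measurable_dA] by simp

lemma nn_integral_dA_lborel:
  assumes [measurable]: "F \<in> borel_measurable borel"
  shows "(\<integral>\<^sup>+z. F z \<partial>dA) = ennreal (1 / pi) * (\<integral>\<^sup>+z. F z * indicator (ball 0 1) z \<partial>lborel)"
proof -
  have "(\<integral>\<^sup>+z. F z \<partial>dA) = ennreal (1 / pi) * (\<integral>\<^sup>+z. F z \<partial>lebesgue_on (ball 0 1))"
    unfolding dA_def
    by (rule nn_integral_scale_measure, intro measurable_restrict_space1) (simp add: measurable_completion)
  also have "(\<integral>\<^sup>+z. F z \<partial>lebesgue_on (ball 0 1)) = (\<integral>\<^sup>+z. F z * indicator (ball 0 1) z \<partial>lebesgue)"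
    by (rule nn_integral_restrict_space) auto
  also have "\<dots> = (\<integral>\<^sup>+z. F z * indicator (ball 0 1) z \<partial>lborel)"
    by (rule nn_integral_completion)
  finally show ?thesis .
qed

lemma nn_integral_dA_rotate:
  assumes [measurable]: "F \<in> borel_measurable borel" and u: "cmod u = 1"
  shows "(\<integral>\<^sup>+z. F (u * z) \<partial>dA) = (\<integral>\<^sup>+z. F z \<partial>dA)"
proof -
  have "indicator (ball 0 1) z = (indicator (ball 0 1) (u * z) :: ennreal)" for z
    using u by (auto simp: indicator_def norm_mult)
  then have "(\<integral>\<^sup>+z. F (u * z) * indicator (ball 0 1) z \<partial>lborel)
      = (\<integral>\<^sup>+z. (\<lambda>z. F z * indicator (ball 0 1) z) (u * z) \<partial>lborel)"
    by simp
  also have "\<dots> = (\<integral>\<^sup>+z. F z * indicator (ball 0 1) z \<partial>lborel)"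
    by (rule nn_integral_rotate_lborel[OF _ u]) simp
  finally show ?thesis
    by (simp add: nn_integral_dA_lborel)
qed

lemma emeasure_dA_ball:
  assumes "0 \<le> r" "r \<le> 1"
  shows "emeasure dA (ball 0 r) = ennreal (r\<^sup>2)"
proof -
  have *: "indicator (ball 0 r) z * indicator (ball 0 1) z = (indicator (ball 0 r) z :: ennreal)" for z :: complex
    using assms by (auto simp: indicator_def)
  have "emeasure dA (ball 0 r) = (\<integral>\<^sup>+z. indicator (ball 0 r) z \<partial>dA)"
    by (rule nn_integral_indicator[symmetric])
       (use assms in \<open>auto simp: sets_dA sets_restrict_space_iff\<close>)
  also have "\<dots> = ennreal (1 / pi) * emeasure lborel (ball (0::complex) r)"
    by (subst nn_integral_dA_lborel, simp, simp only: * , simp)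
  also have "\<dots> = ennreal (1 / pi) * ennreal (pi * r\<^sup>2)"
    using assms by (simp add: emeasure_ball unit_ball_vol_2)
  also have "\<dots> = ennreal (r\<^sup>2)"
    by (simp add: ennreal_mult[symmetric])
  finally show ?thesis .
qed

interpretation dA: prob_space dA
proof
  show "emeasure dA (space dA) = 1"
    using emeasure_dA_ball[of 1] by simp
qed

interpretation dA_pair: pair_sigma_finite dA dA ..

section \<open>Forelli-Rudin estimates\<close>

text \<open>Comparable to the distance from the boundary, but preferable to
  \<open>1 - cmod z\<close>: it is the weight in the operators, and under \<open>dA\<close> it is
  uniformly distributed on the unit interval.\<close>

abbreviation bdist :: "complex \<Rightarrow> real" where
  "bdist z \<equiv> 1 - (cmod z)\<^sup>2"

text \<open>A disc of radius r has normalized area r^2, so |z|^2 and therefore 1 - |z|^2 are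
  uniform. Radial integrals thus become integrals over the unit interval without a Jacobian.\<close>

lemma distr_dA_uniform: "distr dA borel bdist = uniform_measure lborel {0..1}"
proof (rule cdf_unique)
  let ?D = "distr dA borel bdist"
  have [measurable]: "bdist \<in> borel_measurable dA"
    by (rule measurable_dA_I) measurable
  show "real_distribution ?D"
    by (rule real_distribution.intro)
      (auto intro!: dA.prob_space_distr simp: real_distribution_axioms_def)
  show "real_distribution (uniform_measure lborel {0..1})"
    by (rule real_distribution.intro)
      (auto intro!: prob_space_uniform_measure simp: real_distribution_axioms_def)
  show "cdf ?D = cdf (uniform_measure lborel {0..1})"
  proof
    fix u :: real
    let ?L = "{w \<in> space dA. bdist w \<le> u}"
    have L: "cdf ?D u = measure dA ?L"
      unfolding cdf_def by (subst measure_distr) (auto simp: vimage_def Int_def conj_commute)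
    have R: "cdf (uniform_measure lborel {0..1}) u = measure lborel ({0..1} \<inter> {..u})"
      unfolding cdf_def by (subst measure_uniform_measure) auto
    have "measure dA ?L = measure lborel ({0..1} \<inter> {..u})"
    proof -
      consider "u < 0" | "0 \<le> u" "u \<le> 1" | "u > 1" by linarith
      then show ?thesis
      proof cases
        case 1
        then have "?L = {}"
          by (auto simp: not_le abs_square_less_1 intro: less_trans)
        moreover have "{0..1} \<inter> {..u} = {}" using 1 by auto
        ultimately show ?thesis by (simp only: measure_empty)
      next
        case 3
        then have "?L = space dA"
          by auto (smt (verit) zero_le_power2)
        moreover have "{0..1} \<inter> {..u} = {0..1}" using 3 by auto
        ultimately show ?thesis using dA.prob_space by (simp only:) simp
      next
        case 2
        let ?r = "sqrt (1 - u)"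
        have "?L = space dA - ball 0 ?r"
          using 2 by (auto simp: not_less real_sqrt_le_iff intro: real_le_lsqrt)
             (smt (verit) real_le_lsqrt norm_ge_zero real_sqrt_le_iff real_sqrt_abs sqrt_le_D)+
        moreover have "?r \<le> 1" using 2 by simp
        then have "ball 0 ?r \<in> sets dA"
          using subset_ball[of ?r 1 "0::complex"] by (simp add: sets_dA sets_restrict_space_iff)
        ultimately have "measure dA ?L = 1 - measure dA (ball 0 ?r)"
          by (simp only: dA.prob_compl)
        also have "measure dA (ball 0 ?r) = 1 - u"
          using emeasure_dA_ball[of ?r] 2 by (simp add: measure_def)
        also have "1 - (1 - u) = measure lborel ({0..1} \<inter> {..u})"
          using 2 by (simp add: Int_atMost min_def)
        finally show ?thesis .
      qed
    qed
    with L R show "cdf ?D u = cdf (uniform_measure lborel {0..1}) u"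
      by simp
  qed
qed

lemma nn_integral_dA_radial:
  assumes [measurable]: "\<phi> \<in> borel_measurable borel"
  shows "(\<integral>\<^sup>+w. \<phi> (bdist w) \<partial>dA) = (\<integral>\<^sup>+u. \<phi> u * indicator {0..1} u \<partial>lborel)"
proof -
  have [measurable]: "bdist \<in> borel_measurable dA"
    by (rule measurable_dA_I) measurable
  have "(\<integral>\<^sup>+w. \<phi> (bdist w) \<partial>dA) = (\<integral>\<^sup>+u. \<phi> u \<partial>distr dA borel bdist)"
    by (rule nn_integral_distr[symmetric]) auto
  also have "\<dots> = (\<integral>\<^sup>+u. \<phi> u * indicator {0..1} u \<partial>lborel)"
    unfolding distr_dA_uniform by (simp add: nn_integral_uniform_measure divide_ennreal_def)
  finally show ?thesis .
qed

section \<open>One-dimensional integrals and circular means of the kernel\<close>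

lemma nn_integral_powr_atLeast:
  assumes "d > 0" "\<sigma> > 1"
  shows "(\<integral>\<^sup>+y. ennreal ((d + y) powr - \<sigma>) * indicator {0..} y \<partial>lborel) = ennreal (d powr (1 - \<sigma>) / (\<sigma> - 1))"
proof -
  define F where "F y = - ((d + y) powr (1 - \<sigma>)) / (\<sigma> - 1)" for y
  have "(\<integral>\<^sup>+y. ennreal ((d + y) powr - \<sigma>) * indicator {0..} y \<partial>lborel) = ennreal (0 - F 0)"
  proof (rule nn_integral_FTC_atLeast)
    show "(F has_real_derivative (d + x) powr - \<sigma>) (at x)" if "0 \<le> x" for x
    proof -
      have "((\<lambda>y. (d + y) powr (1 - \<sigma>)) has_real_derivative (1 - \<sigma>) * (d + x) powr (1 - \<sigma> - 1) * 1) (at x)"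
        by (rule DERIV_chain2[OF has_real_derivative_powr]) (use assms that in \<open>auto intro!: derivative_eq_intros\<close>)
      then have "(F has_real_derivative - ((1 - \<sigma>) * (d + x) powr (1 - \<sigma> - 1) * 1) / (\<sigma> - 1)) (at x)"
        unfolding F_def by (intro DERIV_cdivide DERIV_minus)
      moreover have "- ((1 - \<sigma>) * (d + x) powr (1 - \<sigma> - 1) * 1) / (\<sigma> - 1) = (d + x) powr - \<sigma>"
        using assms by (simp add: field_simps)
      ultimately show ?thesis by simp
    qed
    show "(F \<longlongrightarrow> 0) at_top"
      unfolding F_def using assms by real_asymp
  qed (use assms in auto)
  then show ?thesis by (simp add: F_def)
qed

lemma nn_integral_powr_abs_le:
  assumes "d > 0" "\<sigma> > 1"
  shows "(\<integral>\<^sup>+y. ennreal ((d + \<bar>y\<bar>) powr - \<sigma>) \<partial>lborel) \<le> ennreal (2 * d powr (1 - \<sigma>) / (\<sigma> - 1))"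
proof -
  let ?f = "\<lambda>y. ennreal ((d + y) powr - \<sigma>) * indicator {0..} y"
  have "(\<integral>\<^sup>+y. ennreal ((d + \<bar>y\<bar>) powr - \<sigma>) \<partial>lborel) \<le> (\<integral>\<^sup>+y. ?f y + ?f (- y) \<partial>lborel)"
    by (intro nn_integral_mono) (auto simp: indicator_def)
  also have "\<dots> = (\<integral>\<^sup>+y. ?f y \<partial>lborel) + (\<integral>\<^sup>+y. ?f (- y) \<partial>lborel)"
    by (rule nn_integral_add) auto
  also have "(\<integral>\<^sup>+y. ?f (- y) \<partial>lborel) = (\<integral>\<^sup>+y. ?f y \<partial>lborel)"
    using nn_integral_real_affine[of ?f "-1" 0] by simp
  finally show ?thesis
    using assms by (simp add: nn_integral_powr_atLeast ennreal_plus[symmetric] del: ennreal_plus)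
qed

text \<open>With u = \<open>sgn \<zeta>\<close>, the number |1 - \<rho> u| dominates 1 - \<rho>, and
  it dominates |1 - u| up to an error 1 - \<rho>; finally |Im \<zeta>| \<le> |Im u| \<le> |1 - u|.
  Of the factor 3, one unit pays for 1 - \<rho> and two pay for |Im \<zeta>|.\<close>

lemma sgn_kernel_lower:
  assumes "0 \<le> \<rho>" "\<rho> < 1" "\<zeta> \<noteq> 0" "cmod \<zeta> < 1"
  shows "(1 - \<rho>) + \<bar>Im \<zeta>\<bar> \<le> 3 * cmod (1 - of_real \<rho> * sgn \<zeta>)"
proof -
  let ?u = "sgn \<zeta>"
  have u: "cmod ?u = 1" using assms by (simp add: norm_sgn)
  have 1: "1 - \<rho> \<le> cmod (1 - of_real \<rho> * ?u)"
    using norm_triangle_ineq2[of 1 "of_real \<rho> * ?u"] u assms by (simp add: norm_mult)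
  have "1 - ?u = (1 - of_real \<rho> * ?u) - of_real (1 - \<rho>) * ?u"
    by (simp add: algebra_simps)
  then have "cmod (1 - ?u) \<le> cmod (1 - of_real \<rho> * ?u) + cmod (of_real (1 - \<rho>) * ?u)"
    by (simp only: norm_triangle_ineq4)
  also have "cmod (of_real (1 - \<rho>) * ?u) = 1 - \<rho>"
    using u assms by (simp add: norm_mult del: of_real_diff)
  finally have "cmod (1 - ?u) \<le> cmod (1 - of_real \<rho> * ?u) + (1 - \<rho>)" .
  moreover have "\<bar>Im \<zeta>\<bar> \<le> cmod (1 - ?u)"
  proof -
    have "\<zeta> = of_real (cmod \<zeta>) * ?u"
      using assms by (simp add: sgn_eq)
    then have "Im \<zeta> = Im (of_real (cmod \<zeta>) * ?u)"
      by simp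
    then have "Im \<zeta> = cmod \<zeta> * Im ?u" by simp
    then have "\<bar>Im \<zeta>\<bar> = cmod \<zeta> * \<bar>Im ?u\<bar>" by (simp add: abs_mult)
    also have "\<dots> \<le> \<bar>Im ?u\<bar>" using assms by (intro mult_left_le_one_le) auto
    also have "\<dots> = \<bar>Im (1 - ?u)\<bar>" by simp
    also have "\<dots> \<le> cmod (1 - ?u)" by (rule abs_Im_le_cmod)
    finally show ?thesis .
  qed
  ultimately show ?thesis using 1 by linarith
qed

text \<open>The origin has to be excluded because \<open>sgn 0 = 0\<close> is not unimodular and
  does not define a rotation.\<close>

lemma AE_dA_nonzero: "AE z in dA. z \<noteq> 0"
proof -
  have "emeasure dA {0} = (\<integral>\<^sup>+z. indicator {0} z \<partial>dA)"
    by (rule nn_integral_indicator[symmetric]) (auto simp: sets_dA sets_restrict_space_iff)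
  also have "\<dots> = ennreal (1 / pi) * (\<integral>\<^sup>+z. indicator {0} z * indicator (ball (0::complex) 1) z \<partial>lborel)"
    by (rule nn_integral_dA_lborel) simp
  also have "\<dots> = ennreal (1 / pi) * (\<integral>\<^sup>+z. indicator {0::complex} z \<partial>lborel)"
    by (intro arg_cong2[where f = "(*)"] nn_integral_cong refl) (auto simp: indicator_def)
  also have "\<dots> = 0" by simp
  finally show ?thesis
    by (intro AE_I[of _ _ "{0}"]) (auto simp: sets_dA sets_restrict_space_iff)
qed

text \<open>By rotation invariance \<open>sgn \<zeta>\<close> is uniformly distributed on the
  circle, so this is a circular mean of the kernel. The angle is traded for the linear coordinate
  \<open>Im \<zeta>\<close>, in which Fubini applies.\<close>

lemma angular_integral_le:
  assumes "0 \<le> \<rho>" "\<rho> < 1" "\<sigma> > 1"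
  shows "(\<integral>\<^sup>+\<zeta>. ennreal (cmod (1 - of_real \<rho> * sgn \<zeta>) powr - \<sigma>) \<partial>dA)
       \<le> ennreal (3 powr \<sigma> * 4 / (\<sigma> - 1) * (1 - \<rho>) powr (1 - \<sigma>))"
proof -
  let ?d = "1 - \<rho>"
  let ?f = "\<lambda>\<zeta>. ennreal (cmod (1 - of_real \<rho> * sgn \<zeta>) powr - \<sigma>)"
  let ?h = "\<lambda>y. ennreal ((?d + \<bar>y\<bar>) powr - \<sigma>)" and ?g = "\<lambda>\<zeta>. ennreal ((?d + \<bar>Im \<zeta>\<bar>) powr - \<sigma>)"
  have "(\<integral>\<^sup>+\<zeta>. ?f \<zeta> \<partial>dA)
      \<le> (\<integral>\<^sup>+\<zeta>. ennreal (3 powr \<sigma>) * ?g \<zeta> \<partial>dA)"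
  proof (rule nn_integral_mono_AE, use AE_dA_nonzero AE_space in eventually_elim)
    fix \<zeta> assume z: "\<zeta> \<noteq> 0" "\<zeta> \<in> space dA"
    have "cmod (1 - of_real \<rho> * sgn \<zeta>) powr - \<sigma> \<le> ((?d + \<bar>Im \<zeta>\<bar>) / 3) powr - \<sigma>"
      using sgn_kernel_lower[of \<rho> \<zeta>] z assms by (intro powr_mono2') auto
    also have "\<dots> = 3 powr \<sigma> * (?d + \<bar>Im \<zeta>\<bar>) powr - \<sigma>"
      using assms by (simp add: powr_divide powr_minus field_simps)
    finally show "?f \<zeta>
       \<le> ennreal (3 powr \<sigma>) * ?g \<zeta>"
      by (simp add: ennreal_mult[symmetric])
  qed
  also have "\<dots> = ennreal (3 powr \<sigma>) * (\<integral>\<^sup>+\<zeta>. ?g \<zeta> \<partial>dA)"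
    by (rule nn_integral_cmult) (rule measurable_dA_I, measurable)
  also have "(\<integral>\<^sup>+\<zeta>. ?g \<zeta> \<partial>dA)
      = ennreal (1 / pi) * (\<integral>\<^sup>+\<zeta>. ?g \<zeta> * indicator (ball 0 1) \<zeta> \<partial>lborel)"
    by (rule nn_integral_dA_lborel) measurable
  \<comment> \<open>The disc is enlarged to the strip |Re \<zeta>| \<le> 1, on which the double
    integral factors; the width of the strip later gives a factor 2, and 1 / pi is estimated by
    1.\<close>
  also have "\<dots> \<le> 1 * (\<integral>\<^sup>+\<zeta>. ?g \<zeta> * indicator {-1..1} (Re \<zeta>) \<partial>lborel)"
  proof (rule mult_mono, goal_cases)
    case 1
    show "ennreal (1 / pi) \<le> 1"
      using pi_gt3 by (intro ennreal_le_1[THEN iffD2]) (simp add: field_simps)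
  next
    case 2
    show ?case
    proof (rule nn_integral_mono)
      fix \<zeta> :: complex
      have "\<bar>Re \<zeta>\<bar> \<le> cmod \<zeta>" by (rule abs_Re_le_cmod)
    then show "?g \<zeta> * indicator (ball 0 1) \<zeta>
        \<le> ?g \<zeta> * indicator {-1..1} (Re \<zeta>)"
      by (auto simp: indicator_def)
    qed
  qed auto
  also have "\<dots> = (\<integral>\<^sup>+x. \<integral>\<^sup>+y. ?h y * indicator {-1..1::real} x \<partial>lborel \<partial>lborel)"
    by (simp add: nn_integral_lborel_complex)
  also have "\<dots> = (\<integral>\<^sup>+x. (\<integral>\<^sup>+y. ?h y \<partial>lborel) * indicator {-1..1::real} x \<partial>lborel)"
    by (rule nn_integral_cong, rule nn_integral_multc) auto
  also have "\<dots> = (\<integral>\<^sup>+y. ?h y \<partial>lborel) * ennreal 2"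
    by (subst nn_integral_cmult) auto
  also have "\<dots> \<le> ennreal (2 * ?d powr (1 - \<sigma>) / (\<sigma> - 1)) * ennreal 2"
    using assms by (intro mult_right_mono nn_integral_powr_abs_le) auto
  finally have "(\<integral>\<^sup>+\<zeta>. ?f \<zeta> \<partial>dA)
     \<le> ennreal (3 powr \<sigma>) * (ennreal (2 * ?d powr (1 - \<sigma>) / (\<sigma> - 1)) * ennreal 2)"
    by (simp add: mult_left_mono)
  also have "\<dots> = ennreal (3 powr \<sigma> * 4 / (\<sigma> - 1) * (1 - \<rho>) powr (1 - \<sigma>))"
    using assms by (simp add: ennreal_mult[symmetric] del: ennreal_numeral)
  finally show ?thesis .
qed


text \<open>The factor \<open>3 powr \<sigma>\<close> comes from \<open>sgn_kernel_lower\<close>,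
  \<open>4 / (\<sigma> - 1)\<close> from two half-lines times the width 2 of a strip, and
  \<open>4 powr (\<sigma> - 1)\<close> from the 4 in \<open>one_minus_norm_lower\<close>.\<close>

definition angular_const :: "real \<Rightarrow> real" where
  "angular_const \<sigma> = 3 powr \<sigma> * 4 / (\<sigma> - 1) * 4 powr (\<sigma> - 1)"

lemma angular_const_pos: "\<sigma> > 1 \<Longrightarrow> angular_const \<sigma> > 0"
  by (simp add: angular_const_def)

lemma angular_integral_le':
  assumes "cmod v < 1" "\<sigma> > 1"
  shows "(\<integral>\<^sup>+\<zeta>. ennreal (cmod (1 - v * cnj (sgn \<zeta>)) powr - \<sigma>) \<partial>dA)
       \<le> ennreal (3 powr \<sigma> * 4 / (\<sigma> - 1) * (1 - cmod v) powr (1 - \<sigma>))"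
proof -
  \<comment> \<open>The phase of \<open>v\<close>; the value 1 at \<open>v = 0\<close> keeps it
    unimodular, which \<open>sgn\<close> alone would not.\<close>
  define e where "e = (if v = 0 then 1 else sgn v)"
  have e: "cmod e = 1" "v = of_real (cmod v) * e" "sgn (cnj e) = cnj e"
    by (auto simp: e_def norm_sgn sgn_eq norm_divide)
  have [measurable]: "sgn \<in> borel_measurable (borel :: complex measure)"
    unfolding sgn_div_norm by measurable
  have "cmod (1 - v * cnj (sgn \<zeta>)) = cmod (1 - of_real (cmod v) * sgn (cnj e * \<zeta>))" for \<zeta>
  proof -
    have "cmod (1 - v * cnj (sgn \<zeta>)) = cmod (cnj (1 - v * cnj (sgn \<zeta>)))"
      by (rule complex_mod_cnj[symmetric])
    also have "cnj (1 - v * cnj (sgn \<zeta>)) = 1 - cnj v * sgn \<zeta>" by simp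
    also have "cnj v = of_real (cmod v) * cnj e"
      by (subst e(2)) (simp only: complex_cnj_mult complex_cnj_complex_of_real)
    finally show ?thesis by (simp only: sgn_mult e(3) mult.assoc)
  qed
  then have "(\<integral>\<^sup>+\<zeta>. ennreal (cmod (1 - v * cnj (sgn \<zeta>)) powr - \<sigma>) \<partial>dA)
      = (\<integral>\<^sup>+\<zeta>. (\<lambda>\<zeta>. ennreal (cmod (1 - of_real (cmod v) * sgn \<zeta>) powr - \<sigma>)) (cnj e * \<zeta>) \<partial>dA)"
    by simp
  also have "\<dots> = (\<integral>\<^sup>+\<zeta>. ennreal (cmod (1 - of_real (cmod v) * sgn \<zeta>) powr - \<sigma>) \<partial>dA)"
    by (rule nn_integral_dA_rotate) (use e in auto)
  also have "\<dots> \<le> ennreal (3 powr \<sigma> * 4 / (\<sigma> - 1) * (1 - cmod v) powr (1 - \<sigma>))"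
    by (rule angular_integral_le) (use assms in auto)
  finally show ?thesis .
qed

text \<open>From 1 - t^2 \<le> 2 (1 - t), each of \<open>bdist z\<close> and \<open>bdist w\<close>
  is at most twice the right-hand side. Once the angle is averaged out, the kernel depends on |z||w|
  only, and this inequality returns it to the boundary distances.\<close>

lemma one_minus_norm_lower:
  assumes "cmod z < 1" "cmod w < 1"
  shows "((bdist z) + bdist w) / 4 \<le> 1 - cmod z * cmod w"
proof -
  have 1: "cmod z * cmod w \<le> cmod z" "cmod z * cmod w \<le> cmod w"
    using assms by (auto intro: mult_right_le_one_le mult_left_le_one_le less_imp_le)
  have "1 - t\<^sup>2 \<le> 2 * (1 - t)" if "0 \<le> t" for t :: real
    using zero_le_power2[of "1 - t"] by (simp add: power2_eq_square algebra_simps)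
  from this[of "cmod z"] this[of "cmod w"] 1 show ?thesis by simp
qed

text \<open>By rotation invariance the kernel may be averaged over the rotations \<open>w \<mapsto> sgn \<zeta> * w\<close>
  with \<open>\<zeta>\<close> uniform in the disc; this replaces polar coordinates.\<close>

lemma angular_kernel_integral_le:
  assumes "cmod z < 1" "\<sigma> > 1" and [measurable]: "\<phi> \<in> borel_measurable borel"
  shows "(\<integral>\<^sup>+w. \<phi> (bdist w) * ennreal (cmod (1 - z * cnj w) powr - \<sigma>) \<partial>dA)
     \<le> ennreal (angular_const \<sigma>) *
        (\<integral>\<^sup>+u. \<phi> u * ennreal ((bdist z + u) powr (1 - \<sigma>)) * indicator {0..1} u \<partial>lborel)"
proof -
  let ?F = "\<lambda>w. \<phi> (bdist w) * ennreal (cmod (1 - z * cnj w) powr - \<sigma>)"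
  let ?R = "\<lambda>\<zeta> w. \<phi> (bdist w) * ennreal (cmod (1 - z * cnj w * cnj (sgn \<zeta>)) powr - \<sigma>)"
  let ?H = "\<lambda>w. \<phi> (bdist w) * ennreal ((bdist z + bdist w) powr (1 - \<sigma>))"
  let ?K = "3 powr \<sigma> * 4 / (\<sigma> - 1)"
  have [measurable]: "sgn \<in> borel_measurable (borel :: complex measure)"
    unfolding sgn_div_norm by measurable
  have [measurable]: "cnj \<in> borel_measurable borel"
    by (intro borel_measurable_continuous_onI continuous_intros)
  have "(\<integral>\<^sup>+w. ?F w \<partial>dA) = (\<integral>\<^sup>+\<zeta>. (\<integral>\<^sup>+w. ?F w \<partial>dA) \<partial>dA)"
    using dA.emeasure_space_1 by simp
  also have "\<dots> = (\<integral>\<^sup>+\<zeta>. \<integral>\<^sup>+w. ?R \<zeta> w \<partial>dA \<partial>dA)"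
  proof (rule nn_integral_cong_AE, use AE_dA_nonzero in eventually_elim)
    fix \<zeta> :: complex assume "\<zeta> \<noteq> 0"
    then have u: "cmod (sgn \<zeta>) = 1" by (simp add: norm_sgn)
    have "(\<integral>\<^sup>+w. ?F w \<partial>dA) = (\<integral>\<^sup>+w. ?F (sgn \<zeta> * w) \<partial>dA)"
      by (rule nn_integral_dA_rotate[symmetric]) (use u in auto)
    then show "(\<integral>\<^sup>+w. ?F w \<partial>dA) = (\<integral>\<^sup>+w. ?R \<zeta> w \<partial>dA)"
      using u by (simp add: norm_mult mult_ac)
  qed
  also have "\<dots> = (\<integral>\<^sup>+w. \<integral>\<^sup>+\<zeta>. ?R \<zeta> w \<partial>dA \<partial>dA)"
    by (rule dA_pair.Fubini') measurable
  also have "\<dots> \<le> (\<integral>\<^sup>+w. ennreal (angular_const \<sigma>) * (?H w) \<partial>dA)"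
  proof (rule nn_integral_mono)
    fix w assume "w \<in> space dA"
    then have w: "cmod w < 1" by simp
    let ?v = "z * cnj w"
    have "cmod z * cmod w < 1 * 1"
      by (rule mult_strict_mono') (use w assms in auto)
    then have v: "cmod ?v < 1" "cmod ?v = cmod z * cmod w" by (auto simp: norm_mult)
    let ?X = "bdist z + (bdist w)"
    have X: "?X > 0" using w assms(1) abs_square_less_1[of "cmod w"] abs_square_less_1[of "cmod z"] by simp
    have "?K * (1 - cmod ?v) powr (1 - \<sigma>) \<le> ?K * (?X / 4) powr (1 - \<sigma>)"
      using one_minus_norm_lower[OF assms(1) w] X v assms by (intro mult_left_mono powr_mono2') auto
    also have "(?X / 4) powr (1 - \<sigma>) = 4 powr (\<sigma> - 1) * ?X powr (1 - \<sigma>)"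
      using X by (simp add: powr_divide powr_diff field_simps)
    finally have K: "?K * (1 - cmod ?v) powr (1 - \<sigma>) \<le> angular_const \<sigma> * ?X powr (1 - \<sigma>)"
      by (simp add: angular_const_def mult.assoc)
    have "(\<integral>\<^sup>+\<zeta>. \<phi> (bdist w) * ennreal (cmod (1 - ?v * cnj (sgn \<zeta>)) powr - \<sigma>) \<partial>dA)
       = \<phi> (bdist w) * (\<integral>\<^sup>+\<zeta>. ennreal (cmod (1 - ?v * cnj (sgn \<zeta>)) powr - \<sigma>) \<partial>dA)"
      by (rule nn_integral_cmult) measurable
    also have "\<dots> \<le> \<phi> (bdist w) * ennreal (?K * (1 - cmod ?v) powr (1 - \<sigma>))"
      by (intro mult_left_mono angular_integral_le') (use v assms in auto)
    also have "\<dots> \<le> \<phi> (bdist w) * ennreal (angular_const \<sigma> * ?X powr (1 - \<sigma>))"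
      using K by (intro mult_left_mono ennreal_leI) auto
    also have "\<dots> = ennreal (angular_const \<sigma>) * (\<phi> (bdist w) * ennreal (?X powr (1 - \<sigma>)))"
      using angular_const_pos[OF assms(2)] by (simp add: ennreal_mult mult_ac)
    finally show "(\<integral>\<^sup>+\<zeta>. \<phi> (bdist w) * ennreal (cmod (1 - ?v * cnj (sgn \<zeta>)) powr - \<sigma>) \<partial>dA)
      \<le> ennreal (angular_const \<sigma>) * (\<phi> (bdist w) * ennreal (?X powr (1 - \<sigma>)))" .
  qed
  also have "\<dots> = ennreal (angular_const \<sigma>) * (\<integral>\<^sup>+w. ?H w \<partial>dA)"
    by (rule nn_integral_cmult) measurable
  also have "(\<integral>\<^sup>+w. ?H w \<partial>dA)
     = (\<integral>\<^sup>+u. \<phi> u * ennreal ((bdist z + u) powr (1 - \<sigma>)) * indicator {0..1} u \<partial>lborel)"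
    by (rule nn_integral_dA_radial) measurable
  finally show ?thesis .
qed

section \<open>Radial integrals and the Forelli-Rudin estimate\<close>

lemma nn_integral_powr_Icc_0:
  assumes "\<beta> > -1" "x \<ge> 0"
  shows "(\<integral>\<^sup>+u. ennreal (u powr \<beta>) * indicator {0..x} u \<partial>lborel) = ennreal (x powr (\<beta> + 1) / (\<beta> + 1))"
proof -
  have "((\<lambda>u. u powr \<beta>) has_integral (x powr (\<beta> + 1) / (\<beta> + 1))) {0..x}"
    using has_integral_powr_from_0[OF assms] by simp
  then have "((\<lambda>u. if u \<in> {0..x} then u powr \<beta> else 0) has_integral (x powr (\<beta> + 1) / (\<beta> + 1))) UNIV"
    by (simp only: has_integral_restrict_UNIV)
  then have "(\<integral>\<^sup>+u. ennreal (if u \<in> {0..x} then u powr \<beta> else 0) \<partial>lborel) = ennreal (x powr (\<beta> + 1) / (\<beta> + 1))"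
    by (intro nn_integral_has_integral_lborel) auto
  moreover have "(\<integral>\<^sup>+u. ennreal (if u \<in> {0..x} then u powr \<beta> else 0) \<partial>lborel)
      = (\<integral>\<^sup>+u. ennreal (u powr \<beta>) * indicator {0..x} u \<partial>lborel)"
    by (intro nn_integral_cong) (auto simp: indicator_def)
  ultimately show ?thesis by simp
qed

lemma nn_integral_powr_atLeast':
  assumes "m > 0" "\<sigma> > 1"
  shows "(\<integral>\<^sup>+u. ennreal (u powr - \<sigma>) * indicator {m..} u \<partial>lborel) = ennreal (m powr (1 - \<sigma>) / (\<sigma> - 1))"
proof -
  have "(\<integral>\<^sup>+u. ennreal (u powr - \<sigma>) * indicator {m..} u \<partial>lborel)
     = (\<integral>\<^sup>+u. ennreal ((m + u) powr - \<sigma>) * indicator {m..} (m + u) \<partial>lborel)"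
    using nn_integral_real_affine[of "\<lambda>u. ennreal (u powr - \<sigma>) * indicator {m..} u" 1 m] by simp
  also have "\<dots> = (\<integral>\<^sup>+u. ennreal ((m + u) powr - \<sigma>) * indicator {0..} u \<partial>lborel)"
    by (intro nn_integral_cong) (auto simp: indicator_def)
  finally show ?thesis using nn_integral_powr_atLeast[OF assms] by simp
qed

text \<open>The integral is split at u = x. For u \<le> x the second factor is at most a power of x,
  and the power of u is integrated. For u > x, u and x + u agree up to a factor 2, so u^\<beta> is
  at most 2^|\<beta>| (x + u)^\<beta> for either sign of \<beta>, and a single decaying power
  remains.\<close>

lemma radial_integral_le:
  assumes "\<beta> > -1" "\<gamma> > 0" "x > 0"
  shows "(\<integral>\<^sup>+u. ennreal (u powr \<beta>) * ennreal ((x + u) powr (1 - (\<beta> + 2 + \<gamma>))) * indicator {0..1} u \<partial>lborel)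
     \<le> ennreal ((1 / (\<beta> + 1) + 2 powr \<bar>\<beta>\<bar> / \<gamma>) * x powr - \<gamma>)"
proof -
  let ?f = "\<lambda>u. ennreal (x powr (- 1 - \<beta> - \<gamma>)) * (ennreal (u powr \<beta>) * indicator {0..x} u)"
  let ?g = "\<lambda>u. ennreal (2 powr \<bar>\<beta>\<bar>) * (ennreal ((x + u) powr - (1 + \<gamma>)) * indicator {0..} u)"
  have "(\<integral>\<^sup>+u. ennreal (u powr \<beta>) * ennreal ((x + u) powr (1 - (\<beta> + 2 + \<gamma>))) * indicator {0..1} u \<partial>lborel)
     \<le> (\<integral>\<^sup>+u. ?f u + ?g u \<partial>lborel)"
  proof (rule nn_integral_mono)
    fix u :: real
    have eq: "1 - (\<beta> + 2 + \<gamma>) = - 1 - \<beta> - \<gamma>" by simp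
    show "ennreal (u powr \<beta>) * ennreal ((x + u) powr (1 - (\<beta> + 2 + \<gamma>))) * indicator {0..1} u \<le> ?f u + ?g u"
    proof (cases "0 \<le> u \<and> u \<le> 1")
      case True
      show ?thesis
      proof (cases "u \<le> x")
        case le: True
        have "(x + u) powr (- 1 - \<beta> - \<gamma>) \<le> x powr (- 1 - \<beta> - \<gamma>)"
          using True assms by (intro powr_mono2') auto
        then have "ennreal (u powr \<beta>) * ennreal ((x + u) powr (- 1 - \<beta> - \<gamma>)) \<le> ?f u"
          using True le by (simp add: ennreal_mult[symmetric] mult.commute mult_left_mono)
        then show ?thesis using True unfolding eq by (simp add: add_increasing2)
      next
        case gt: False
        have "u powr \<beta> = (u / (x + u)) powr \<beta> * (x + u) powr \<beta>"
          using gt assms by (simp add: powr_divide)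
        also have "(u / (x + u)) powr \<beta> \<le> 2 powr \<bar>\<beta>\<bar>"
        proof (cases "\<beta> \<ge> 0")
          case True
          have "(u / (x + u)) powr \<beta> \<le> 2 powr \<beta>"
            using True gt assms by (intro powr_mono2) (auto simp: field_simps)
          then show ?thesis using True by simp
        next
          case False
          have "(u / (x + u)) powr \<beta> \<le> (1 / 2) powr \<beta>"
            using False gt assms by (intro powr_mono2') (auto simp: field_simps)
          also have "\<dots> = 2 powr \<bar>\<beta>\<bar>" using False by (simp add: powr_divide powr_minus_divide)
          finally show ?thesis .
        qed
        finally have "u powr \<beta> * (x + u) powr (- 1 - \<beta> - \<gamma>)
            \<le> 2 powr \<bar>\<beta>\<bar> * (x + u) powr \<beta> * (x + u) powr (- 1 - \<beta> - \<gamma>)"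
          by (simp add: mult_right_mono)
        also have "\<dots> = 2 powr \<bar>\<beta>\<bar> * (x + u) powr - (1 + \<gamma>)"
          using gt assms by (simp add: mult.assoc powr_add[symmetric])
        finally have "ennreal (u powr \<beta>) * ennreal ((x + u) powr (- 1 - \<beta> - \<gamma>)) \<le> ?g u"
          using True by (simp add: ennreal_mult[symmetric])
        then show ?thesis using True unfolding eq by (simp add: add_increasing)
      qed
    qed auto
  qed
  also have "\<dots> = (\<integral>\<^sup>+u. ?f u \<partial>lborel) + (\<integral>\<^sup>+u. ?g u \<partial>lborel)"
    by (rule nn_integral_add) auto
  also have "(\<integral>\<^sup>+u. ?f u \<partial>lborel) = ennreal (x powr (- 1 - \<beta> - \<gamma>)) * ennreal (x powr (\<beta> + 1) / (\<beta> + 1))"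
    using assms by (simp add: nn_integral_cmult nn_integral_powr_Icc_0)
  also have "\<dots> = ennreal (1 / (\<beta> + 1) * x powr - \<gamma>)"
    using assms by (simp add: ennreal_mult[symmetric] powr_add[symmetric])
  also have "(\<integral>\<^sup>+u. ?g u \<partial>lborel) = ennreal (2 powr \<bar>\<beta>\<bar>) * ennreal (x powr (1 - (1 + \<gamma>)) / ((1 + \<gamma>) - 1))"
    using assms by (subst nn_integral_cmult, simp, subst nn_integral_powr_atLeast) auto
  also have "\<dots> = ennreal (2 powr \<bar>\<beta>\<bar> / \<gamma> * x powr - \<gamma>)"
    using assms by (simp add: ennreal_mult[symmetric])
  finally show ?thesis
    using assms by (simp add: ennreal_plus[symmetric] distrib_right del: ennreal_plus)
qed

definition FR_const :: "real \<Rightarrow> real \<Rightarrow> real" where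
  "FR_const \<beta> \<gamma> = angular_const (\<beta> + 2 + \<gamma>) * (1 / (\<beta> + 1) + 2 powr \<bar>\<beta>\<bar> / \<gamma>)"

lemma FR_const_pos: "\<beta> > -1 \<Longrightarrow> \<gamma> > 0 \<Longrightarrow> FR_const \<beta> \<gamma> > 0"
  by (simp add: FR_const_def angular_const_pos add_pos_pos)

lemma Forelli_Rudin:
  assumes "\<beta> > -1" "\<gamma> > 0" "cmod z < 1"
  shows "(\<integral>\<^sup>+w. ennreal ((bdist w) powr \<beta> * cmod (1 - z * cnj w) powr - (\<beta> + 2 + \<gamma>)) \<partial>dA)
     \<le> ennreal (FR_const \<beta> \<gamma> * (bdist z) powr - \<gamma>)"
proof -
  have x: "bdist z > 0" using assms by (simp add: abs_square_less_1)
  have "(\<integral>\<^sup>+w. ennreal ((bdist w) powr \<beta>) * ennreal (cmod (1 - z * cnj w) powr - (\<beta> + 2 + \<gamma>)) \<partial>dA)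
     \<le> ennreal (angular_const (\<beta> + 2 + \<gamma>)) *
        (\<integral>\<^sup>+u. ennreal (u powr \<beta>) * ennreal ((bdist z + u) powr (1 - (\<beta> + 2 + \<gamma>))) * indicator {0..1} u \<partial>lborel)"
    by (rule angular_kernel_integral_le[of z "\<beta> + 2 + \<gamma>" "\<lambda>u. ennreal (u powr \<beta>)"]) (use assms in auto)
  also have "\<dots> \<le> ennreal (angular_const (\<beta> + 2 + \<gamma>)) * ennreal ((1 / (\<beta> + 1) + 2 powr \<bar>\<beta>\<bar> / \<gamma>) * (bdist z) powr - \<gamma>)"
    by (rule mult_left_mono[OF radial_integral_le]) (use assms x in auto)
  also have "\<dots> = ennreal (FR_const \<beta> \<gamma> * (bdist z) powr - \<gamma>)"
    using angular_const_pos[of "\<beta> + 2 + \<gamma>"] assms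
    by (simp add: ennreal_mult[symmetric] FR_const_def mult.assoc)
  finally show ?thesis by (simp add: ennreal_mult)
qed

section \<open>Reduction to restricted integrals\<close>

lemma bdist_pos: "cmod z < 1 \<Longrightarrow> bdist z > 0"
  by (simp add: abs_square_less_1)

lemma bdist_le_1: "bdist z \<le> 1"
  by simp

lemma bdist_measurable [measurable]: "bdist \<in> borel_measurable dA"
  by (rule measurable_dA_I) measurable

lemma cnj_measurable [measurable]: "cnj \<in> borel_measurable borel"
  by (intro borel_measurable_continuous_onI continuous_intros)

lemma one_minus_mult_cnj_nonzero:
  assumes "cmod z < 1" "cmod w < 1"
  shows "1 - z * cnj w \<noteq> 0"
proof
  assume "1 - z * cnj w = 0"
  then have "cmod (z * cnj w) = 1" by simp
  moreover have "cmod z * cmod w < 1 * 1" by (rule mult_strict_mono') (use assms in auto)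
  ultimately show False by (simp add: norm_mult)
qed

lemma cmod_one_minus_swap: "cmod (1 - z * cnj w) = cmod (1 - w * cnj z)"
  using complex_mod_cnj[of "1 - z * cnj w"] by (simp add: mult.commute)

text \<open>The common modulus of the kernels of \<open>T\<close> and \<open>S\<close>, outer weight
  included, so that one positive integral dominates both operators.\<close>

definition kern :: "real \<Rightarrow> real \<Rightarrow> real \<Rightarrow> complex \<Rightarrow> complex \<Rightarrow> real" where
  "kern a b c z w = bdist z powr a * bdist w powr b * cmod (1 - z * cnj w) powr - c"

lemma kern_nonneg [simp]: "kern a b c z w \<ge> 0"
  by (simp add: kern_def)

lemma kern_measurable [measurable]:
  assumes [measurable]: "f \<in> borel_measurable M" "g \<in> borel_measurable M"
  shows "(\<lambda>x. kern a b c (f x) (g x)) \<in> borel_measurable M"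
  unfolding kern_def by measurable

text \<open>This is \<open>S\<close> applied to the modulus of f with values in [0, \<infinity>].
  Absolute convergence becomes finiteness, and Tonelli applies without integrability checks.\<close>

definition pos_op :: "real \<Rightarrow> real \<Rightarrow> real \<Rightarrow> (complex \<Rightarrow> complex) \<Rightarrow> complex \<Rightarrow> ennreal" where
  "pos_op a b c f z = (\<integral>\<^sup>+w. ennreal (kern a b c z w) * ennreal (cmod (f w)) \<partial>dA)"

lemma pos_op_measurable [measurable]:
  assumes [measurable]: "f \<in> borel_measurable dA"
  shows "pos_op a b c f \<in> borel_measurable dA"
  unfolding pos_op_def by measurable

lemma emeasure_bdist_less: "emeasure dA {z \<in> space dA. bdist z < m} \<le> ennreal m"
proof -
  have "emeasure dA {z \<in> space dA. bdist z < m} = (\<integral>\<^sup>+z. indicator {z \<in> space dA. bdist z < m} z \<partial>dA)"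
    by (rule nn_integral_indicator[symmetric]) measurable
  also have "\<dots> = (\<integral>\<^sup>+z. indicator {..<m} (bdist z) \<partial>dA)"
    by (rule nn_integral_cong) (auto simp: indicator_def)
  also have "\<dots> = (\<integral>\<^sup>+u. indicator {..<m} u * indicator {0..1} u \<partial>lborel)"
    by (rule nn_integral_dA_radial) measurable
  also have "\<dots> \<le> (\<integral>\<^sup>+u. indicator {0..m} u \<partial>lborel)"
    by (intro nn_integral_mono) (auto simp: indicator_def)
  also have "\<dots> \<le> ennreal m"
    by (cases "0 \<le> m") auto
  finally show ?thesis .
qed

lemma ennreal_powr_mono: "x \<le> y \<Longrightarrow> s \<ge> 0 \<Longrightarrow> ennreal_powr x s \<le> ennreal_powr y s"
  unfolding ennreal_powr_def
  by (auto simp: top_unique intro!: ennreal_leI powr_mono2 enn2real_mono simp: less_top)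

lemma ennreal_powr_ennreal: "x \<ge> 0 \<Longrightarrow> ennreal_powr (ennreal x) s = ennreal (x powr s)"
  by (simp add: ennreal_powr_def)

lemma ennreal_powr_0 [simp]: "ennreal_powr 0 s = 0"
  by (simp add: ennreal_powr_def)

locale test_set =
  fixes m :: real and F :: "complex set"
  assumes m: "m > 0" and F [measurable]: "F \<in> sets dA"
    and Fm: "emeasure dA F \<le> ennreal (2 * m)" and Fx: "\<forall>z\<in>F. m \<le> bdist z"

text \<open>To bound the measure \<open>2 * m\<close> of a level set it suffices to integrate over its part
  \<open>bdist z \<ge> m\<close>, since the rest has measure at most \<open>m\<close>.\<close>

lemma weak_bound_frame:
  assumes [measurable]: "g \<in> borel_measurable dA"
    and "\<theta> > 0" "B \<ge> 0" "t > 0"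
    and H: "\<And>m F. test_set m F \<Longrightarrow> (\<integral>\<^sup>+z\<in>F. g z \<partial>dA) \<le> ennreal (B * m powr (1 - \<theta>))"
  shows "ennreal t * ennreal_powr (emeasure dA {z \<in> space dA. ennreal t < g z}) \<theta> \<le> ennreal (2 powr \<theta> * B)"
proof -
  let ?L = "{z \<in> space dA. ennreal t < g z}"
  define \<mu> where "\<mu> = measure dA ?L"
  have \<mu>: "emeasure dA ?L = ennreal \<mu>" "\<mu> \<ge> 0"
    by (auto simp: \<mu>_def dA.emeasure_eq_measure)
  show ?thesis
  proof (cases "\<mu> = 0")
    case True
    then show ?thesis using \<mu> by (simp add: ennreal_powr_ennreal)
  next
    case False
    \<comment> \<open>Half of the level set: the strip \<open>?N\<close> has measure at most m, so
      at least m of the level set survives in \<open>F\<close>, while \<open>F\<close> still has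
      measure at most 2m.\<close>
    define m where "m = \<mu> / 2"
    have m: "m > 0" "\<mu> = 2 * m" using False \<mu> by (auto simp: m_def)
    let ?N = "{z \<in> space dA. bdist z < m}"
    define F where "F = ?L - ?N"
    have N: "?N \<in> sets dA" and L: "?L \<in> sets dA" by measurable
    have F: "F \<in> sets dA" unfolding F_def using N L by blast
    have "measure dA ?N \<le> m"
      using emeasure_bdist_less[of m] m by (simp add: dA.emeasure_eq_measure)
    moreover have "measure dA ?L \<le> measure dA F + measure dA ?N"
    proof -
      have "measure dA ?L \<le> measure dA (F \<union> ?N)"
      proof (rule dA.finite_measure_mono)
        show "F \<union> ?N \<in> sets dA" using F N by (rule sets.Un)
      qed (auto simp: F_def)
      also have "\<dots> \<le> measure dA F + measure dA ?N"
        by (rule measure_Un_le[OF F N])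
      finally show ?thesis .
    qed
    ultimately have mF: "m \<le> measure dA F" using m by (simp add: \<mu>_def)
    have "ennreal (t * m) \<le> ennreal t * emeasure dA F"
      using mF m assms(4) by (simp add: dA.emeasure_eq_measure ennreal_mult[symmetric])
    also have "\<dots> = (\<integral>\<^sup>+z. ennreal t * indicator F z \<partial>dA)"
      by (rule nn_integral_cmult_indicator[symmetric]) (rule F)
    also have "\<dots> \<le> (\<integral>\<^sup>+z. g z * indicator F z \<partial>dA)"
      by (intro nn_integral_mono) (auto simp: F_def indicator_def)
    also have "\<dots> \<le> ennreal (B * m powr (1 - \<theta>))"
    proof (rule H, rule test_set.intro[OF m(1) F])
      have "emeasure dA F \<le> emeasure dA ?L"
        by (rule emeasure_mono) (use L in \<open>auto simp: F_def\<close>)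
      then show "emeasure dA F \<le> ennreal (2 * m)" using \<mu> m by simp
      show "\<forall>z\<in>F. m \<le> bdist z" by (auto simp: F_def not_less)
    qed
    finally have "t * m \<le> B * m powr (1 - \<theta>)"
      using assms(3) by simp
    also have "\<dots> = B * (m / m powr \<theta>)"
      using m by (simp add: powr_diff)
    finally have "t * m powr \<theta> \<le> B"
      using m by (simp add: field_simps)
    then have "t * \<mu> powr \<theta> \<le> 2 powr \<theta> * B"
      using m by (simp add: powr_mult field_simps)
    then show ?thesis
      using \<mu> assms(3,4) by (simp add: ennreal_powr_ennreal ennreal_mult[symmetric])
  qed
qed

text \<open>The set where g is infinite lies in every level set, so t times a power of its measure
  is bounded for all t, and the measure vanishes. A weak bound on \<open>pos_op\<close> therefore
  already contains absolute convergence almost everywhere.\<close>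

lemma AE_finite_frame:
  assumes [measurable]: "g \<in> borel_measurable dA"
    and "\<theta> > 0" "B \<ge> 0"
    and H: "\<And>t. t > 0 \<Longrightarrow> ennreal t * ennreal_powr (emeasure dA {z \<in> space dA. ennreal t < g z}) \<theta> \<le> ennreal B"
  shows "AE z in dA. g z < \<infinity>"
proof -
  let ?N = "{z \<in> space dA. g z = \<infinity>}"
  have N [measurable]: "?N \<in> sets dA" by measurable
  have "measure dA ?N = 0"
  proof (rule ccontr)
    assume "measure dA ?N \<noteq> 0"
    then have pos: "measure dA ?N > 0" by (simp add: zero_less_measure_iff)
    define v where "v = measure dA ?N powr \<theta>"
    have v: "v > 0" using pos by (simp add: v_def)
    define t where "t = (B + 1) / v"
    have t: "t > 0" using v assms(3) by (simp add: t_def)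
    have "ennreal (t * v) = ennreal t * ennreal_powr (emeasure dA ?N) \<theta>"
      using t by (simp add: v_def dA.emeasure_eq_measure ennreal_powr_ennreal ennreal_mult)
    also have "\<dots> \<le> ennreal t * ennreal_powr (emeasure dA {z \<in> space dA. ennreal t < g z}) \<theta>"
    proof (intro mult_left_mono ennreal_powr_mono emeasure_mono)
      show "{z \<in> space dA. ennreal t < g z} \<in> sets dA" by measurable
    qed (use assms(2) in auto)
    also have "\<dots> \<le> ennreal B" by (rule H[OF t])
    finally have "t * v \<le> B" using assms(3) by simp
    then show False using v by (simp add: t_def)
  qed
  then have "emeasure dA ?N = 0" by (simp add: dA.emeasure_eq_measure)
  then show ?thesis
    using N by (intro AE_I[of _ _ ?N]) (auto simp: less_top[symmetric])
qed

text \<open>Write |f w| as the length of the interval of t with 0 < t < |f w| and exchange the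
  integrals. It serves both to pass from indicators to the Lorentz space and to integrate weak-type
  functions over sets.\<close>

lemma layer_cake:
  assumes [measurable]: "f \<in> borel_measurable dA" "G \<in> borel_measurable dA"
  shows "(\<integral>\<^sup>+w. G w * ennreal (cmod (f w)) \<partial>dA)
    = (\<integral>\<^sup>+t. (\<integral>\<^sup>+w. G w * indicator {w \<in> space dA. t < cmod (f w)} w \<partial>dA) * indicator {0<..} t \<partial>lborel)"
proof -
  let ?i = "\<lambda>t w. (if t < cmod (f w) then 1 else 0 :: ennreal)"
  have "(\<integral>\<^sup>+w. G w * ennreal (cmod (f w)) \<partial>dA) = (\<integral>\<^sup>+w. \<integral>\<^sup>+t. G w * (?i t w * indicator {0<..} t) \<partial>lborel \<partial>dA)"
  proof (rule nn_integral_cong)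
    fix w
    have "ennreal (cmod (f w)) = (\<integral>\<^sup>+t. indicator {0<..<cmod (f w)} t \<partial>lborel)" by simp
    also have "\<dots> = (\<integral>\<^sup>+t. ?i t w * indicator {0<..} t \<partial>lborel)"
      by (intro nn_integral_cong) (auto simp: indicator_def)
    finally show "G w * ennreal (cmod (f w)) = (\<integral>\<^sup>+t. G w * (?i t w * indicator {0<..} t) \<partial>lborel)"
      by (simp add: nn_integral_cmult)
  qed
  also have "\<dots> = (\<integral>\<^sup>+t. \<integral>\<^sup>+w. G w * (?i t w * indicator {0<..} t) \<partial>dA \<partial>lborel)"
    by (rule pair_sigma_finite.Fubini'[symmetric]) (unfold_locales, measurable)
  also have "\<dots> = (\<integral>\<^sup>+t. (\<integral>\<^sup>+w. G w * ?i t w \<partial>dA) * indicator {0<..} t \<partial>lborel)"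
    by (rule nn_integral_cong, subst nn_integral_multc[symmetric]) (measurable, simp add: mult_ac)
  also have "\<dots> = (\<integral>\<^sup>+t. (\<integral>\<^sup>+w. G w * indicator {w \<in> space dA. t < cmod (f w)} w \<partial>dA) * indicator {0<..} t \<partial>lborel)"
    by (intro nn_integral_cong arg_cong2[where f = "(*)"] refl) (auto simp: indicator_def)
  finally show ?thesis .
qed

lemma layer_cake_measurable:
  assumes [measurable]: "f \<in> borel_measurable dA" "G \<in> borel_measurable dA"
  shows "(\<lambda>t. \<integral>\<^sup>+w. G w * indicator {w \<in> space dA. t < cmod (f w)} w \<partial>dA) \<in> borel_measurable lborel"
proof -
  have "(\<integral>\<^sup>+w. G w * indicator {w \<in> space dA. t < cmod (f w)} w \<partial>dA) = (\<integral>\<^sup>+w. G w * (if t < cmod (f w) then 1 else 0) \<partial>dA)" for t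
    by (intro nn_integral_cong) (auto simp: indicator_def)
  then show ?thesis by simp
qed

text \<open>What \<open>T\<close> and \<open>S\<close> share: the outer weight and the modulus of
  the kernel inside the disc. All positive results and the divergence at q = 1 depend on nothing
  else; only the failure at p = \<infinity> looks at the phase of the kernel.\<close>

definition disc_kernel_op :: "real \<Rightarrow> real \<Rightarrow> real \<Rightarrow> disc_op \<Rightarrow> bool" where
  "disc_kernel_op a b c \<T> \<longleftrightarrow> fst \<T> = (\<lambda>z. bdist z powr a) \<and>
     (\<lambda>(z, w). snd \<T> z w) \<in> borel_measurable (borel \<Otimes>\<^sub>M borel) \<and>
     (\<forall>z w. cmod z < 1 \<longrightarrow> cmod w < 1 \<longrightarrow> cmod (snd \<T> z w) = bdist w powr b * cmod (1 - z * cnj w) powr - c)"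

lemma disc_kernel_op_S: "disc_kernel_op a b c (S_op a b c)"
  unfolding disc_kernel_op_def S_op_def
  by (auto simp: norm_divide powr_minus field_simps)

text \<open>With a real exponent the argument of z enters only as a phase.\<close>

lemma cmod_powr_of_real: "z \<noteq> 0 \<Longrightarrow> cmod (z powr of_real c) = cmod z powr c"
  by (simp add: powr_def)

lemma disc_kernel_op_T: "disc_kernel_op a b c (T_op a b c)"
  unfolding disc_kernel_op_def T_op_def
proof (intro conjI allI impI; simp only: fst_conv snd_conv)
  have [measurable]: "(\<lambda>z. z powr complex_of_real c) \<in> borel_measurable borel"
    unfolding powr_def by measurable
  show "(\<lambda>(z, w). complex_of_real (bdist w powr b) / (1 - z * cnj w) powr complex_of_real c)
      \<in> borel_measurable (borel \<Otimes>\<^sub>M borel)"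
    by measurable
  fix z w :: complex assume "cmod z < 1" "cmod w < 1"
  then show "cmod (complex_of_real (bdist w powr b) / (1 - z * cnj w) powr complex_of_real c) =
      bdist w powr b * cmod (1 - z * cnj w) powr - c"
    using one_minus_mult_cnj_nonzero[of z w]
    by (simp add: norm_divide cmod_powr_of_real powr_minus field_simps)
qed

context
  fixes a b c :: real and \<T> :: disc_op
  assumes op: "disc_kernel_op a b c \<T>"
begin

lemma op_measurable [measurable]:
  assumes [measurable]: "f \<in> borel_measurable M" "g \<in> borel_measurable M"
  shows "(\<lambda>x. snd \<T> (f x) (g x)) \<in> borel_measurable M"
proof -
  have [measurable]: "(\<lambda>(z, w). snd \<T> z w) \<in> borel_measurable (borel \<Otimes>\<^sub>M borel)"
    using op by (simp add: disc_kernel_op_def)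
  have "(\<lambda>x. (\<lambda>(z, w). snd \<T> z w) (f x, g x)) \<in> borel_measurable M"
    by measurable
  then show ?thesis by simp
qed

lemma apply_op_measurable [measurable]:
  assumes [measurable]: "f \<in> borel_measurable dA"
  shows "apply_op \<T> f \<in> borel_measurable dA"
proof -
  have *: "fst \<T> = (\<lambda>z. bdist z powr a)"
    using op by (simp add: disc_kernel_op_def)
  show ?thesis unfolding apply_op_def * by measurable
qed

lemma norm_op_integrand:
  assumes "cmod z < 1" "cmod w < 1"
  shows "ennreal (bdist z powr a) * ennreal (cmod (snd \<T> z w * f w)) = ennreal (kern a b c z w) * ennreal (cmod (f w))"
proof -
  have "bdist z powr a * cmod (snd \<T> z w * f w) = kern a b c z w * cmod (f w)"
    using op assms by (simp add: disc_kernel_op_def kern_def norm_mult mult_ac)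
  then show ?thesis by (simp add: ennreal_mult'[symmetric])
qed

lemma pos_op_eq:
  assumes [measurable]: "f \<in> borel_measurable dA" and z: "cmod z < 1"
  shows "pos_op a b c f z
    = ennreal (bdist z powr a) * (\<integral>\<^sup>+w. ennreal (cmod (snd \<T> z w * f w)) \<partial>dA)"
proof -
  have "pos_op a b c f z
     = (\<integral>\<^sup>+w. ennreal (bdist z powr a) * ennreal (cmod (snd \<T> z w * f w)) \<partial>dA)"
    unfolding pos_op_def using norm_op_integrand z by (intro nn_integral_cong) auto
  also have "\<dots> = ennreal (bdist z powr a) * (\<integral>\<^sup>+w. ennreal (cmod (snd \<T> z w * f w)) \<partial>dA)"
    by (rule nn_integral_cmult) measurable
  finally show ?thesis .
qed

lemma integrable_op_iff:
  assumes [measurable]: "f \<in> borel_measurable dA" and z: "cmod z < 1"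
  shows "integrable dA (\<lambda>w. snd \<T> z w * f w) \<longleftrightarrow> pos_op a b c f z < \<infinity>"
  unfolding pos_op_eq[OF assms] integrable_iff_bounded using bdist_pos[OF z]
  by (auto simp: ennreal_mult_less_top)

lemma converges_ae_iff:
  assumes "f \<in> borel_measurable dA"
  shows "converges_ae \<T> f \<longleftrightarrow> (AE z in dA. pos_op a b c f z < \<infinity>)"
  unfolding converges_ae_def
  by (rule AE_cong) (simp add: integrable_op_iff[OF assms])

lemma norm_apply_op_le:
  assumes [measurable]: "f \<in> borel_measurable dA" and z: "cmod z < 1"
  shows "ennreal (cmod (apply_op \<T> f z)) \<le> pos_op a b c f z"
proof -
  have "fst \<T> z = bdist z powr a" using op by (simp add: disc_kernel_op_def)
  then have "ennreal (cmod (apply_op \<T> f z)) = ennreal (bdist z powr a) * ennreal (cmod (\<integral>w. snd \<T> z w * f w \<partial>dA))"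
    by (simp add: apply_op_def norm_mult ennreal_mult)
  also have "ennreal (cmod (\<integral>w. snd \<T> z w * f w \<partial>dA)) \<le> (\<integral>\<^sup>+w. ennreal (cmod (snd \<T> z w * f w)) \<partial>dA)"
  \<comment> \<open>Where the integral diverges, its library value is 0 and the bound
    persists.\<close>
  proof (cases "integrable dA (\<lambda>w. snd \<T> z w * f w)")
    case True
    then show ?thesis by (rule integral_norm_bound_ennreal)
  qed (simp add: not_integrable_integral_eq)
  finally show ?thesis
    unfolding pos_op_eq[OF assms] by (simp add: mult_left_mono)
qed

text \<open>The single gateway to all positive results: weak boundedness, almost everywhere
  convergence and measurability follow from one estimate over test sets. The power m^(1 - 1/q) is
  the usual dual exponent of a weak norm, and at q = 1 the bound has to be uniform in m.\<close>

lemma maps_boundedlyI: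
  assumes q: "q > 0" and C: "C \<ge> 0"
    and H: "\<And>f m F. f \<in> borel_measurable dA \<Longrightarrow> X f < \<infinity> \<Longrightarrow> test_set m F \<Longrightarrow>
        (\<integral>\<^sup>+z\<in>F. pos_op a b c f z \<partial>dA) \<le> ennreal (C * m powr (1 - 1 / q)) * X f"
  shows "maps_boundedly \<T> X (weak_norm (ennreal q))"
  unfolding maps_boundedly_def
proof (intro exI[of _ "2 powr (1 / q) * C"] ballI impI)
  fix f assume f [measurable]: "f \<in> borel_measurable dA" and X: "X f < \<infinity>"
  define x where "x = enn2real (X f)"
  have x: "X f = ennreal x" "x \<ge> 0" using X by (auto simp: x_def less_top)
  let ?g = "pos_op a b c f"
  let ?w = "\<lambda>t. ennreal t * ennreal_powr (emeasure dA {z \<in> space dA. ennreal t < ?g z}) (1 / q)"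
  have bound: "?w t
      \<le> ennreal (2 powr (1 / q) * (C * x))" if "t > 0" for t
  proof (rule weak_bound_frame)
    fix m F assume "test_set m F"
    then have "(\<integral>\<^sup>+z\<in>F. ?g z \<partial>dA) \<le> ennreal (C * m powr (1 - 1 / q)) * X f"
      by (rule H[OF f X])
    also have "\<dots> = ennreal (C * x * m powr (1 - 1 / q))"
      using C x by (simp add: ennreal_mult[symmetric] mult_ac)
    finally show "(\<integral>\<^sup>+z. ?g z * indicator F z \<partial>dA) \<le> ennreal (C * x * m powr (1 - 1 / q))" .
  qed (use q C x that in auto)
  have "AE z in dA. ?g z < \<infinity>"
    by (rule AE_finite_frame[where \<theta> = "1 / q" and B = "2 powr (1 / q) * (C * x)"]) (use bound q C x in auto)
  then have "converges_ae \<T> f" by (simp add: converges_ae_iff)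
  moreover have "weak_norm (ennreal q) (apply_op \<T> f) \<le> ennreal (2 powr (1 / q) * C) * X f"
  proof -
    have "ennreal t * ennreal_powr (distribution (apply_op \<T> f) t) (1 / q) \<le> ennreal (2 powr (1 / q) * (C * x))"
      if "t > 0" for t
    proof -
      have "distribution (apply_op \<T> f) t \<le> emeasure dA {z \<in> space dA. ennreal t < ?g z}"
        unfolding distribution_def
      proof (rule emeasure_mono)
        show "{z \<in> space dA. t < cmod (apply_op \<T> f z)} \<subseteq> {z \<in> space dA. ennreal t < ?g z}"
        proof safe
          fix z assume z: "z \<in> space dA" "t < cmod (apply_op \<T> f z)"
          then have "ennreal t < ennreal (cmod (apply_op \<T> f z))"
            using that by (simp add: ennreal_less_iff)
          also have "\<dots> \<le> ?g z" by (rule norm_apply_op_le) (use z in auto)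
          finally show "ennreal t < ?g z" .
        qed
      qed measurable
      then have "ennreal t * ennreal_powr (distribution (apply_op \<T> f) t) (1 / q)
          \<le> ?w t"
        using q by (intro mult_left_mono ennreal_powr_mono) auto
      also have "\<dots> \<le> ennreal (2 powr (1 / q) * (C * x))" by (rule bound[OF that])
      finally show ?thesis .
    qed
    then have "weak_norm (ennreal q) (apply_op \<T> f) \<le> ennreal (2 powr (1 / q) * (C * x))"
      unfolding weak_norm_def using q by (auto intro!: SUP_least)
    also have "\<dots> = ennreal (2 powr (1 / q) * C) * X f"
      using x C by (simp add: ennreal_mult[symmetric] mult_ac)
    finally show ?thesis .
  qed
  ultimately show "converges_ae \<T> f \<and> apply_op \<T> f \<in> borel_measurable dA \<and>
      weak_norm (ennreal q) (apply_op \<T> f) \<le> ennreal (2 powr (1 / q) * C) * X f"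
    by simp
qed

end

section \<open>Weak-type bounds\<close>

lemma Forelli_Rudin':
  assumes "\<beta> > -1" "\<gamma> > 0" "cmod w < 1"
  shows "(\<integral>\<^sup>+z. ennreal (bdist z powr \<beta> * cmod (1 - z * cnj w) powr - (\<beta> + 2 + \<gamma>)) \<partial>dA)
     \<le> ennreal (FR_const \<beta> \<gamma> * bdist w powr - \<gamma>)"
  using Forelli_Rudin[OF assms] by (simp add: cmod_one_minus_swap)

text \<open>The scaled estimate below needs a strictly positive bound N for the norm; letting N
  decrease to the norm also covers functions of norm 0.\<close>

lemma ennreal_le_limit:
  assumes "\<And>N. N > x \<Longrightarrow> A \<le> ennreal (C * N)" "C \<ge> 0" "x \<ge> 0"
  shows "A \<le> ennreal (C * x)"
proof (rule ennreal_le_epsilon)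
  fix e :: real assume e: "e > 0"
  let ?N = "x + e / (C + 1)"
  have "A \<le> ennreal (C * ?N)" using assms e by simp
  also have "C * ?N \<le> C * x + e"
    using assms(2) e by (simp add: field_simps)
  then have "ennreal (C * ?N) \<le> ennreal (C * x) + ennreal e"
    using assms(2,3) e by (simp add: ennreal_plus[symmetric] ennreal_leI del: ennreal_plus)
  finally show "A \<le> ennreal (C * x) + ennreal e" .
qed

lemma Youngs_inequality':
  assumes "p > 1" "p' > 1" "1/p + 1/p' = 1" "(x::real) \<ge> 0" "y \<ge> 0"
  shows "x * y \<le> x powr p + y powr p'"
proof -
  have "x * y \<le> x powr p / p + y powr p' / p'" by (rule Youngs_inequality) (use assms in auto)
  also have "\<dots> \<le> x powr p / 1 + y powr p' / 1"
    using assms by (intro add_mono divide_left_mono) auto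
  finally show ?thesis by simp
qed

text \<open>Young's inequality with the weight \<open>r = (bdist w / bdist z) powr t\<close> is the Schur test.\<close>

lemma Schur_pointwise:
  assumes "p > 1" "p' > 1" "1/p + 1/p' = 1" "cmod z < 1" "cmod w < 1" "\<eta> > 0" "\<phi> \<ge> 0"
    "0 < m" "m \<le> bdist z" "s \<ge> 0"
  shows "kern a b (a + b + 2 + s) z w * \<phi> \<le> m powr - s *
    (\<eta> powr p * (\<phi> powr p * bdist w powr (b + t * p) * (bdist z powr (a + s - t * p) * cmod (1 - z * cnj w) powr - (a + b + 2 + s)))
     + \<eta> powr - p' * (bdist z powr (a + s + t * p') * (bdist w powr (b - t * p') * cmod (1 - z * cnj w) powr - (a + b + 2 + s))))"
proof -
  let ?x = "bdist z" and ?y = "bdist w"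
  have xy: "?x > 0" "?y > 0" using bdist_pos assms by auto
  define L where "L = cmod (1 - z * cnj w) powr - (a + b + 2 + s)"
  have L: "L \<ge> 0" by (simp add: L_def)
  define r where "r = (?y / ?x) powr t"
  have r: "r > 0" using xy by (simp add: r_def)
  have "\<phi> = (\<eta> * \<phi> * r) * (1 / (\<eta> * r))" using r assms by simp
  also have "\<dots> \<le> (\<eta> * \<phi> * r) powr p + (1 / (\<eta> * r)) powr p'"
    by (rule Youngs_inequality') (use assms r in auto)
  also have "(\<eta> * \<phi> * r) powr p = \<eta> powr p * \<phi> powr p * (?y powr (t * p) * ?x powr - (t * p))"
    using r assms xy by (simp add: powr_mult r_def powr_powr powr_divide powr_minus field_simps)
  also have "(1 / (\<eta> * r)) powr p' = \<eta> powr - p' * (?x powr (t * p') * ?y powr - (t * p'))"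
    using r assms xy by (simp add: powr_mult r_def powr_powr powr_divide powr_minus field_simps)
  finally have \<phi>: "\<phi> \<le> \<eta> powr p * \<phi> powr p * (?y powr (t * p) * ?x powr - (t * p)) + \<eta> powr - p' * (?x powr (t * p') * ?y powr - (t * p'))" .
  have "?x powr a = ?x powr - s * ?x powr (a + s)" using xy by (simp add: powr_add[symmetric])
  also have "\<dots> \<le> m powr - s * ?x powr (a + s)"
    using assms by (intro mult_right_mono powr_mono2') auto
  finally have xa: "?x powr a \<le> m powr - s * ?x powr (a + s)" .
  have "kern a b (a + b + 2 + s) z w * \<phi> = ?x powr a * (?y powr b * L * \<phi>)"
    by (simp add: kern_def L_def)
  also have "\<dots> \<le> (m powr - s * ?x powr (a + s)) * (?y powr b * L * \<phi>)"
    using xa L assms by (intro mult_right_mono) auto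
  also have "\<dots> = m powr - s * (?x powr (a + s) * ?y powr b * L) * \<phi>" by simp
  also have "\<dots> \<le> m powr - s * (?x powr (a + s) * ?y powr b * L) *
      (\<eta> powr p * \<phi> powr p * (?y powr (t * p) * ?x powr - (t * p)) + \<eta> powr - p' * (?x powr (t * p') * ?y powr - (t * p')))"
    using L by (intro mult_left_mono \<phi>) auto
  also have "\<dots> = m powr - s *
    (\<eta> powr p * (\<phi> powr p * (?y powr b * ?y powr (t * p)) * ((?x powr (a + s) * ?x powr - (t * p)) * L))
     + \<eta> powr - p' * ((?x powr (a + s) * ?x powr (t * p')) * ((?y powr b * ?y powr - (t * p')) * L)))"
    by (simp add: algebra_simps)
  also have "\<dots> = m powr - s *
    (\<eta> powr p * (\<phi> powr p * ?y powr (b + t * p) * (?x powr (a + s - t * p) * L))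
     + \<eta> powr - p' * (?x powr (a + s + t * p') * (?y powr (b - t * p') * L)))"
    by (simp add: powr_add[symmetric])
  finally show ?thesis unfolding L_def .
qed

text \<open>The four conditions are those of the two Forelli-Rudin integrals in the Schur test, with
  \<alpha> = a + s: weight exponents above -1 and positive excess. They are compatible when each
  lower bound for t lies below each upper bound. The delicate comparison, - b / p < (b + 1) / p', is
  equivalent to 1 / p < b + 1, which becomes an equality exactly when b = - s and q = 1.\<close>

lemma Schur_exponent:
  assumes "p > 1" "p' > 1" "1/p + 1/p' = (1::real)" "\<alpha> \<ge> 0" "1/p < b + 1"
  obtains t where "- \<alpha> < t * p'" "t * p' < b + 1" "- b < t * p" "t * p < \<alpha> + 1"
proof -
  have b: "b > -1" using assms by (smt (verit) divide_pos_pos)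
  let ?l = "max (- \<alpha> / p') (- b / p)" and ?u = "min ((b + 1) / p') ((\<alpha> + 1) / p)"
  have "?l < ?u"
  proof -
    have 1: "- \<alpha> / p' < (b + 1) / p'" using assms b by (intro divide_strict_right_mono) auto
    have 2: "- b / p < (\<alpha> + 1) / p" using assms b by (intro divide_strict_right_mono) auto
    have "- \<alpha> / p' \<le> 0" using assms by (simp add: field_simps)
    also have "0 < (\<alpha> + 1) / p" using assms by simp
    finally have 3: "- \<alpha> / p' < (\<alpha> + 1) / p" .
    have "- b < 1 / p'" using assms by linarith
    then have "- b * (1/p + 1/p') < 1 / p'" using assms by simp
    then have 4: "- b / p < (b + 1) / p'" by (simp add: distrib_left add_divide_distrib)
    show ?thesis using 1 2 3 4 by simp
  qed
  then obtain t where "?l < t" "t < ?u" using dense by blast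
  then show thesis using that[of t] assms by (simp add: field_simps)
qed

text \<open>Young's inequality stands in for Hoelder's: the pairing with the indicator of F splits
  into two double integrals, in each of which one variable is removed by a Forelli-Rudin estimate
  whose power of \<open>bdist\<close> cancels exactly. What is left is a multiple of the p-th power
  integral of f and of |F|.\<close>

lemma strong_bound_scaled:
  assumes p: "p > 1" "p' > 1" "1/p + 1/p' = 1" and s: "s \<ge> 0" "a + s \<ge> 0" "1/p < b + 1"
  obtains C where "C \<ge> 0"
    "\<And>f m F N. f \<in> borel_measurable dA \<Longrightarrow> test_set m F \<Longrightarrow> N > 0 \<Longrightarrow> (\<integral>\<^sup>+w. ennreal (cmod (f w) powr p) \<partial>dA) \<le> ennreal (N powr p) \<Longrightarrow>
      (\<integral>\<^sup>+z\<in>F. pos_op a b (a + b + 2 + s) f z \<partial>dA)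
        \<le> ennreal (C * m powr (1 - 1/p - s) * N)"
proof -
  obtain t where t: "- (a + s) < t * p'" "t * p' < b + 1" "- b < t * p" "t * p < (a + s) + 1"
    using Schur_exponent[of p p' "a + s" b] p s by blast
  define C1 where "C1 = FR_const (a + s - t * p) (b + t * p)"
  define C2 where "C2 = FR_const (b - t * p') (a + s + t * p')"
  have C: "C1 \<ge> 0" "C2 \<ge> 0"
    using FR_const_pos[of "a + s - t * p" "b + t * p"] FR_const_pos[of "b - t * p'" "a + s + t * p'"] t
    by (auto simp: C1_def C2_def less_imp_le)
  let ?c = "a + b + 2 + s"
  show ?thesis
  proof (rule that[of "C1 + 2 * C2"])
    show "C1 + 2 * C2 \<ge> 0" using C by simp
    fix f m F N
    assume f [measurable]: "f \<in> borel_measurable dA" and "test_set m F" and N: "N > 0"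
      and fN: "(\<integral>\<^sup>+w. ennreal (cmod (f w) powr p) \<partial>dA) \<le> ennreal (N powr p)"
    interpret test_set m F by fact
    \<comment> \<open>Solves \<open>\<eta> powr p * N powr p = \<eta> powr - p' * m\<close>, using p
      + p' = p p'. Both terms then equal \<open>m powr (1 - 1/p) * N\<close>, which restores
      homogeneity of degree one in N.\<close>
    define \<eta> where "\<eta> = (m * N powr - p) powr (1 / (p * p'))"
    have \<eta>: "\<eta> > 0" using m N by (simp add: \<eta>_def)
    have pp: "p' + p = p * p'" using p by (simp add: field_simps)
    have \<eta>p: "\<eta> powr p * N powr p = m powr (1 - 1/p) * N"
    proof -
      have "\<eta> powr p = (m * N powr - p) powr (1 / p')" using p by (simp add: \<eta>_def powr_powr)
      also have "\<dots> = m powr (1 / p') * N powr (- p / p')" using m N by (simp add: powr_mult powr_powr)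
      finally have "\<eta> powr p * N powr p = m powr (1 / p') * (N powr (- p / p') * N powr p)" by simp
      also have "N powr (- p / p') * N powr p = N powr (- p / p' + p)" by (rule powr_add[symmetric])
      finally have "\<eta> powr p * N powr p = m powr (1 / p') * N powr (- p / p' + p)" .
      moreover have "- p / p' + p = 1" using pp p by (simp add: field_simps)
      moreover have "1 / p' = 1 - 1 / p" using p by simp
      ultimately show ?thesis using N by simp
    qed
    have \<eta>p': "\<eta> powr - p' * m = m powr (1 - 1/p) * N"
    proof -
      have "\<eta> powr - p' = (m * N powr - p) powr (- 1 / p)" using p by (simp add: \<eta>_def powr_powr)
      also have "\<dots> = m powr (- 1 / p) * N" using m N p by (simp add: powr_mult powr_powr)
      finally have "\<eta> powr - p' * m = (m powr (- 1 / p) * m powr 1) * N" using m by simp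
      also have "m powr (- 1 / p) * m powr 1 = m powr (1 - 1/p)" by (simp only: powr_add[symmetric]) simp
      finally show ?thesis .
    qed
    let ?L = "\<lambda>z w. cmod (1 - z * cnj w) powr - ?c"
    let ?U = "\<lambda>z w. ennreal (bdist z powr (a + s - t * p) * ?L z w)"
    let ?V = "\<lambda>z w. ennreal (bdist w powr (b - t * p') * ?L z w)"
    let ?A = "\<lambda>w. ennreal (\<eta> powr p * cmod (f w) powr p * bdist w powr (b + t * p))"
    let ?B = "\<lambda>z. ennreal (\<eta> powr - p' * bdist z powr (a + s + t * p')) * indicator F z"
    let ?IA = "\<integral>\<^sup>+z. \<integral>\<^sup>+w. ?A w * ?U z w \<partial>dA \<partial>dA" and ?IB = "\<integral>\<^sup>+z. \<integral>\<^sup>+w. ?B z * ?V z w \<partial>dA \<partial>dA"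
    have pt: "ennreal (kern a b ?c z w) * ennreal (cmod (f w)) * indicator F z
        \<le> ennreal (m powr - s) * (?A w * ?U z w + ?B z * ?V z w)"
      if "z \<in> space dA" "w \<in> space dA" for z w
    proof (cases "z \<in> F")
      case True
      have "kern a b ?c z w * cmod (f w) \<le> m powr - s *
        (\<eta> powr p * (cmod (f w) powr p * bdist w powr (b + t * p) * (bdist z powr (a + s - t * p) * ?L z w))
     + \<eta> powr - p' * (bdist z powr (a + s + t * p') * (bdist w powr (b - t * p') * ?L z w)))"
        by (rule Schur_pointwise) (use p s that True Fx m \<eta> in auto)
      also have "\<dots> = m powr - s * (\<eta> powr p * cmod (f w) powr p * bdist w powr (b + t * p) * (bdist z powr (a + s - t * p) * ?L z w)
          + \<eta> powr - p' * bdist z powr (a + s + t * p') * (bdist w powr (b - t * p') * ?L z w))"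
        by (simp only: mult.assoc)
      finally show ?thesis using True
        by (simp add: ennreal_mult[symmetric] ennreal_plus[symmetric] del: ennreal_plus)
    qed simp
    have "(\<integral>\<^sup>+z\<in>F. pos_op a b ?c f z \<partial>dA)
       = (\<integral>\<^sup>+z. \<integral>\<^sup>+w. ennreal (kern a b ?c z w) * ennreal (cmod (f w)) * indicator F z \<partial>dA \<partial>dA)"
      unfolding pos_op_def by (rule nn_integral_cong, rule nn_integral_multc[symmetric]) measurable
    also have "\<dots> \<le> (\<integral>\<^sup>+z. \<integral>\<^sup>+w. ennreal (m powr - s) * (?A w * ?U z w + ?B z * ?V z w) \<partial>dA \<partial>dA)"
      by (rule nn_integral_mono, rule nn_integral_mono, rule pt) auto
    also have "\<dots> = ennreal (m powr - s) * (\<integral>\<^sup>+z. \<integral>\<^sup>+w. ?A w * ?U z w + ?B z * ?V z w \<partial>dA \<partial>dA)"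
      by (subst nn_integral_cmult[symmetric], measurable) (rule nn_integral_cong, rule nn_integral_cmult, measurable)
    also have "(\<integral>\<^sup>+z. \<integral>\<^sup>+w. ?A w * ?U z w + ?B z * ?V z w \<partial>dA \<partial>dA)
       = (\<integral>\<^sup>+z. (\<integral>\<^sup>+w. ?A w * ?U z w \<partial>dA) + (\<integral>\<^sup>+w. ?B z * ?V z w \<partial>dA) \<partial>dA)"
      by (rule nn_integral_cong, rule nn_integral_add) measurable
    also have "\<dots> = ?IA + ?IB"
      by (rule nn_integral_add) measurable
    also have "?IA \<le> ennreal (C1 * (m powr (1 - 1/p) * N))"
    proof -
      have "?IA = (\<integral>\<^sup>+w. \<integral>\<^sup>+z. ?A w * ?U z w \<partial>dA \<partial>dA)"
        by (rule dA_pair.Fubini') measurable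
      also have "\<dots> = (\<integral>\<^sup>+w. ?A w * (\<integral>\<^sup>+z. ?U z w \<partial>dA) \<partial>dA)"
        by (rule nn_integral_cong, rule nn_integral_cmult) measurable
      also have "\<dots> \<le> (\<integral>\<^sup>+w. ennreal (\<eta> powr p * C1) * ennreal (cmod (f w) powr p) \<partial>dA)"
      proof (rule nn_integral_mono)
        fix w assume "w \<in> space dA"
        then have w: "cmod w < 1" by simp
        have "(\<integral>\<^sup>+z. ?U z w \<partial>dA) \<le> ennreal (C1 * bdist w powr - (b + t * p))"
          using Forelli_Rudin'[of "a + s - t * p" "b + t * p" w] t w by (simp add: C1_def algebra_simps)
        then have "?A w * (\<integral>\<^sup>+z. ?U z w \<partial>dA) \<le> ?A w * ennreal (C1 * bdist w powr - (b + t * p))"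
          by (rule mult_left_mono) simp
        also have "\<dots> = ennreal (\<eta> powr p * cmod (f w) powr p * C1 * (bdist w powr (b + t * p) * bdist w powr - (b + t * p)))"
          using C by (simp add: ennreal_mult[symmetric] mult_ac)
        also have "bdist w powr (b + t * p) * bdist w powr - (b + t * p) = 1"
          using bdist_pos[OF w] by (simp only: powr_add[symmetric]) simp
        finally show "?A w * (\<integral>\<^sup>+z. ?U z w \<partial>dA) \<le> ennreal (\<eta> powr p * C1) * ennreal (cmod (f w) powr p)"
          using C by (simp add: ennreal_mult[symmetric] mult_ac)
      qed
      also have "\<dots> = ennreal (\<eta> powr p * C1) * (\<integral>\<^sup>+w. ennreal (cmod (f w) powr p) \<partial>dA)"
        by (rule nn_integral_cmult) measurable
      also have "\<dots> \<le> ennreal (\<eta> powr p * C1) * ennreal (N powr p)"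
        by (intro mult_left_mono fN) simp
      also have "\<dots> = ennreal (C1 * (\<eta> powr p * N powr p))"
        using C by (simp add: ennreal_mult[symmetric] mult_ac)
      finally show ?thesis unfolding \<eta>p .
    qed
    also have "?IB \<le> ennreal (2 * C2 * (m powr (1 - 1/p) * N))"
    proof -
      have "?IB = (\<integral>\<^sup>+z. ?B z * (\<integral>\<^sup>+w. ?V z w \<partial>dA) \<partial>dA)"
        by (rule nn_integral_cong, rule nn_integral_cmult) measurable
      also have "\<dots> \<le> (\<integral>\<^sup>+z. ennreal (\<eta> powr - p' * C2) * indicator F z \<partial>dA)"
      proof (rule nn_integral_mono)
        fix z assume "z \<in> space dA"
        then have z: "cmod z < 1" by simp
        have "(\<integral>\<^sup>+w. ?V z w \<partial>dA) \<le> ennreal (C2 * bdist z powr - (a + s + t * p'))"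
          using Forelli_Rudin[of "b - t * p'" "a + s + t * p'" z] t z by (simp add: C2_def algebra_simps)
        then have "?B z * (\<integral>\<^sup>+w. ?V z w \<partial>dA) \<le> ?B z * ennreal (C2 * bdist z powr - (a + s + t * p'))"
          by (rule mult_left_mono) simp
        also have "\<dots> = ennreal (\<eta> powr - p' * C2 * (bdist z powr (a + s + t * p') * bdist z powr - (a + s + t * p'))) * indicator F z"
          using C by (auto simp: ennreal_mult[symmetric] mult_ac indicator_def)
        also have "bdist z powr (a + s + t * p') * bdist z powr - (a + s + t * p') = 1"
          using bdist_pos[OF z] by (simp only: powr_add[symmetric]) simp
        finally show "?B z * (\<integral>\<^sup>+w. ?V z w \<partial>dA) \<le> ennreal (\<eta> powr - p' * C2) * indicator F z"
          by simp
      qed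
      also have "\<dots> = ennreal (\<eta> powr - p' * C2) * emeasure dA F"
        by (rule nn_integral_cmult_indicator) (rule F)
      also have "\<dots> \<le> ennreal (\<eta> powr - p' * C2) * ennreal (2 * m)"
        by (intro mult_left_mono Fm) simp
      also have "\<dots> = ennreal (2 * C2 * (\<eta> powr - p' * m))"
        using C m by (simp add: ennreal_mult[symmetric] mult_ac del: ennreal_numeral)
      finally show ?thesis unfolding \<eta>p' .
    qed
    finally have "(\<integral>\<^sup>+z\<in>F. pos_op a b ?c f z \<partial>dA)
       \<le> ennreal (m powr - s) * (ennreal (C1 * (m powr (1 - 1/p) * N)) + ennreal (2 * C2 * (m powr (1 - 1/p) * N)))"
      by (simp add: mult_left_mono add_mono)
    also have "\<dots> = ennreal ((C1 + 2 * C2) * (m powr - s * m powr (1 - 1/p)) * N)"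
      using C N by (simp add: ennreal_mult[symmetric] ennreal_plus[symmetric] algebra_simps del: ennreal_plus)
    also have "m powr - s * m powr (1 - 1/p) = m powr (1 - 1/p - s)"
      by (simp add: powr_add[symmetric])
    finally show "(\<integral>\<^sup>+z\<in>F. pos_op a b ?c f z \<partial>dA)
       \<le> ennreal ((C1 + 2 * C2) * m powr (1 - 1/p - s) * N)" .
  qed
qed

lemma weak_type_finite:
  assumes op: "disc_kernel_op a b (a + b + 2 + s) \<T>"
    and p: "p > 1" and q: "q > 0" "1/q = 1/p + s" and s: "s \<ge> 0" "a + s \<ge> 0" "1/p < b + 1"
  shows "maps_boundedly \<T> (Lp_norm (ennreal p)) (weak_norm (ennreal q))"
proof -
  let ?J = "\<lambda>f F. \<integral>\<^sup>+z\<in>F. pos_op a b (a + b + 2 + s) f z \<partial>dA"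
  define p' where "p' = p / (p - 1)"
  have p': "p' > 1" "1/p + 1/p' = 1" using p by (auto simp: p'_def field_simps)
  obtain C where C: "C \<ge> 0" and CH: "\<And>f m F N. f \<in> borel_measurable dA \<Longrightarrow> test_set m F \<Longrightarrow> N > 0 \<Longrightarrow> (\<integral>\<^sup>+w. ennreal (cmod (f w) powr p) \<partial>dA) \<le> ennreal (N powr p) \<Longrightarrow>
      ?J f F
        \<le> ennreal (C * m powr (1 - 1/p - s) * N)"
    using strong_bound_scaled[of p p' s a b] p p' s by blast
  show ?thesis
  proof (rule maps_boundedlyI[OF op q(1) C])
    fix f m F assume *: "f \<in> borel_measurable dA" "test_set m F"
      and fin: "Lp_norm (ennreal p) f < \<infinity>"
    let ?I = "\<integral>\<^sup>+w. ennreal (cmod (f w) powr p) \<partial>dA"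
    have L: "Lp_norm (ennreal p) f = ennreal_powr ?I (1/p)" using p by (simp add: Lp_norm_def)
    then have I: "?I = ennreal (enn2real ?I)" using fin by (auto simp: ennreal_powr_def less_top split: if_splits)
    define x where "x = enn2real ?I powr (1/p)"
    have x: "Lp_norm (ennreal p) f = ennreal x" "x \<ge> 0"
      unfolding L by (subst I) (auto simp: ennreal_powr_ennreal x_def)
    have "?J f F
       \<le> ennreal (C * m powr (1 - 1/p - s) * x)"
    proof (rule ennreal_le_limit)
      fix N assume N: "N > x"
      have "enn2real ?I = x powr p" using p by (simp add: x_def powr_powr)
      also have "\<dots> \<le> N powr p" using N x p by (intro powr_mono2) auto
      finally have "?I \<le> ennreal (N powr p)" by (subst I) (rule ennreal_leI)
      then show "?J f F
          \<le> ennreal (C * m powr (1 - 1/p - s) * N)"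
        using CH * N x by simp
    qed (use C x in auto)
    then show "?J f F
       \<le> ennreal (C * m powr (1 - 1 / q)) * Lp_norm (ennreal p) f"
      using x C q by (simp add: ennreal_mult algebra_simps)
  qed
qed

text \<open>Integrating the kernel in w gives a power with excess a + s, and the outer weight
  reduces it to x^(-s); hence \<open>pos_op f\<close> is at most a constant times m^(-s) on F. The
  strict inequality a + s > 0 is what the Forelli-Rudin estimate requires.\<close>

lemma weak_type_infinite:
  assumes op: "disc_kernel_op a b (a + b + 2 + s) \<T>" and s: "s > 0" "a + s > 0" "b > -1"
  shows "maps_boundedly \<T> (Lp_norm \<infinity>) (weak_norm (ennreal (1 / s)))"
proof -
  define C where "C = FR_const b (a + s)"
  have C: "C \<ge> 0" using FR_const_pos[of b "a + s"] s by (simp add: C_def less_imp_le)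
  show ?thesis
  proof (rule maps_boundedlyI[OF op, of _ "2 * C"])
    fix f m F assume f [measurable]: "f \<in> borel_measurable dA" and "test_set m F" and fin: "Lp_norm \<infinity> f < \<infinity>"
    interpret test_set m F by fact
    let ?c = "a + b + 2 + s"
    let ?X = "Lp_norm \<infinity> f"
    have le: "AE w in dA. ennreal (cmod (f w)) \<le> ?X"
      unfolding Lp_norm_def using esssup_AE[of "\<lambda>w. ennreal (cmod (f w))" dA] by simp
    have "pos_op a b ?c f z * indicator F z \<le> ennreal (C * m powr - s) * ?X * indicator F z"
      if "z \<in> space dA" for z
    proof (cases "z \<in> F")
      case True
      have z: "cmod z < 1" using that by simp
      have "pos_op a b ?c f z \<le> (\<integral>\<^sup>+w. ennreal (kern a b ?c z w) * ?X \<partial>dA)"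
        unfolding pos_op_def by (rule nn_integral_mono_AE, use le in eventually_elim) (simp add: mult_left_mono)
      also have "\<dots> = (\<integral>\<^sup>+w. ennreal (kern a b ?c z w) \<partial>dA) * ?X"
        by (rule nn_integral_multc) measurable
      also have "(\<integral>\<^sup>+w. ennreal (kern a b ?c z w) \<partial>dA)
         = ennreal (bdist z powr a) * (\<integral>\<^sup>+w. ennreal (bdist w powr b * cmod (1 - z * cnj w) powr - ?c) \<partial>dA)"
        unfolding kern_def mult.assoc by (subst nn_integral_cmult[symmetric], measurable) (simp add: ennreal_mult)
      also have "\<dots> \<le> ennreal (bdist z powr a) * ennreal (C * bdist z powr - (a + s))"
        using Forelli_Rudin[of b "a + s" z] s z by (intro mult_left_mono) (simp_all add: C_def algebra_simps)
      also have "\<dots> = ennreal (C * bdist z powr - s)"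
        using C bdist_pos[OF z] by (simp add: ennreal_mult[symmetric] mult.left_commute powr_add[symmetric])
      also have "\<dots> \<le> ennreal (C * m powr - s)"
        using C m Fx True s by (intro ennreal_leI mult_left_mono powr_mono2') auto
      finally show ?thesis using True by (simp add: mult_right_mono)
    qed simp
    then have "(\<integral>\<^sup>+z\<in>F. pos_op a b ?c f z \<partial>dA)
      \<le> (\<integral>\<^sup>+z. ennreal (C * m powr - s) * ?X * indicator F z \<partial>dA)"
      by (rule nn_integral_mono)
    also have "\<dots> = ennreal (C * m powr - s) * ?X * emeasure dA F"
      by (rule nn_integral_cmult_indicator) (rule F)
    also have "\<dots> \<le> ennreal (C * m powr - s) * ?X * ennreal (2 * m)"
      by (intro mult_left_mono Fm) simp
    also have "\<dots> = ennreal (C * m powr - s) * ennreal (2 * m) * ?X"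
      by (simp add: mult_ac)
    also have "ennreal (C * m powr - s) * ennreal (2 * m) = ennreal (2 * C * (m powr - s * m powr 1))"
      using C m by (simp add: ennreal_mult[symmetric] mult_ac del: ennreal_numeral)
    also have "m powr - s * m powr 1 = m powr (1 - 1 / (1 / s))"
      using s by (simp only: powr_add[symmetric]) simp
    finally show "(\<integral>\<^sup>+z\<in>F. pos_op a b ?c f z \<partial>dA)
       \<le> ennreal (2 * C * m powr (1 - 1 / (1 / s))) * ?X" .
  qed (use C s in auto)
qed

section \<open>The Lorentz endpoint\<close>

text \<open>After x^a is written as x^(a + 1) x^(-1), Young's inequality is applied to the product
  of x^(-1) and y^(-s), which separates the variables. In contrast to the Schur test, the exponent r
  is not tied to p and can be chosen according to the size of y.\<close>

lemma endpoint_pointwise: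
  assumes "r > 1" "r' > 1" "1/r + 1/r' = 1" "cmod z < 1" "cmod w < 1" "\<eta> > 0"
  shows "kern a (- s) (a + 2) z w \<le>
    \<eta> powr r * (bdist z powr (a + 1 - r) * cmod (1 - z * cnj w) powr - (a + 2))
     + \<eta> powr - r' * (bdist z powr (a + 1) * (bdist w powr - (s * r') * cmod (1 - z * cnj w) powr - (a + 2)))"
proof -
  let ?x = "bdist z" and ?y = "bdist w"
  have xy: "?x > 0" "?y > 0" using bdist_pos assms by auto
  define L where "L = cmod (1 - z * cnj w) powr - (a + 2)"
  have L: "L \<ge> 0" by (simp add: L_def)
  have "?x powr - 1 * ?y powr - s = (\<eta> * ?x powr - 1) * (?y powr - s / \<eta>)" using assms by simp
  also have "\<dots> \<le> (\<eta> * ?x powr - 1) powr r + (?y powr - s / \<eta>) powr r'"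
    by (rule Youngs_inequality') (use assms xy in auto)
  also have "(\<eta> * ?x powr - 1) powr r = \<eta> powr r * (?x powr - 1) powr r"
    by (rule powr_mult)
  also have "(?x powr - 1) powr r = ?x powr - r"
    using powr_powr[of ?x "- 1" r] by simp
  also have "(?y powr - s / \<eta>) powr r' = \<eta> powr - r' * ?y powr - (s * r')"
    using assms xy by (simp add: powr_divide powr_powr powr_minus_divide[of \<eta> r'])
  finally have *: "?x powr - 1 * ?y powr - s \<le> \<eta> powr r * ?x powr - r + \<eta> powr - r' * ?y powr - (s * r')" .
  have "?x powr a = ?x powr (a + 1) * ?x powr - 1" by (simp only: powr_add[symmetric]) simp
  then have "kern a (- s) (a + 2) z w = ?x powr (a + 1) * L * (?x powr - 1 * ?y powr - s)"
    by (simp add: kern_def L_def)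
  also have "\<dots> \<le> ?x powr (a + 1) * L * (\<eta> powr r * ?x powr - r + \<eta> powr - r' * ?y powr - (s * r'))"
    using L by (intro mult_left_mono *) auto
  also have "\<dots> = \<eta> powr r * ((?x powr (a + 1) * ?x powr - r) * L) + \<eta> powr - r' * (?x powr (a + 1) * (?y powr - (s * r') * L))"
    by (simp add: algebra_simps)
  also have "?x powr (a + 1) * ?x powr - r = ?x powr (a + 1 - r)" by (simp add: powr_add[symmetric])
  finally show ?thesis unfolding L_def .
qed

text \<open>The hypothesis on I says that I lies on that side of e where y^(-s r') is integrable;
  the integral is then of the order e^(1 - s r'). Both terms of Young's inequality come out as
  multiples of e^(1 - s), free of m, as q = 1 demands.\<close>

lemma (in test_set) endpoint_piece:
  assumes a: "a > -1" and r: "r > 1" "r' > 1" "1/r + 1/r' = 1"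
    and I [measurable]: "I \<in> sets borel" and \<kappa>: "\<kappa> \<ge> 0" and e: "e > 0"
    and HI: "(\<integral>\<^sup>+u. ennreal (u powr - (s * r')) * indicator I u * indicator {0..1} u \<partial>lborel) \<le> ennreal (\<kappa> * e powr (1 - s * r'))"
    and E [measurable]: "E \<in> sets dA" and Ee: "emeasure dA E = ennreal e"
  shows "(\<integral>\<^sup>+w. (\<integral>\<^sup>+z. ennreal (kern a (- s) (a + 2) z w) * indicator F z \<partial>dA) * (indicator E w * indicator I (bdist w)) \<partial>dA)
     \<le> ennreal (angular_const (a + 2) * (1 / (r - 1) + 2 * \<kappa>) * e powr (1 - s))" (is "?lhs \<le> _")
proof -
  define K where "K = angular_const (a + 2)"
  have K: "K > 0" using angular_const_pos[of "a + 2"] a by (simp add: K_def)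
  \<comment> \<open>Chosen so that m cancels in both terms:
    \<open>\<eta> powr r * m powr (1 - r)\<close> becomes \<open>e powr - s\<close>, and
    \<open>\<eta> powr - r' * m\<close> becomes \<open>e powr (s * (r' - 1))\<close>.\<close>
  define \<eta> where "\<eta> = e powr (- s / r) * m powr (1 / r')"
  have \<eta>: "\<eta> > 0" using m e by (simp add: \<eta>_def)
  have rr: "r' + r = r * r'" using r by (simp add: field_simps)
  then have rr1: "r / r' = r - 1" "r' / r = r' - 1" using r by (simp_all add: field_simps)
  have \<eta>r: "\<eta> powr r * m powr (1 - r) = e powr - s"
  proof -
    have "\<eta> powr r = e powr - s * m powr (r / r')" using m e r by (simp add: \<eta>_def powr_mult powr_powr)
    then have "\<eta> powr r * m powr (1 - r) = e powr - s * (m powr (r / r') * m powr (1 - r))" by simp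
    also have "m powr (r / r') * m powr (1 - r) = 1"
      unfolding rr1 using m by (simp only: powr_add[symmetric]) simp
    finally show ?thesis by simp
  qed
  have \<eta>r': "\<eta> powr - r' * m = e powr (s * (r' - 1))"
  proof -
    have "\<eta> powr - r' = e powr (s * (r' / r)) * m powr - 1" using m e r by (simp add: \<eta>_def powr_mult powr_powr)
    then show ?thesis unfolding rr1 using m by (simp add: powr_minus)
  qed
  let ?L = "\<lambda>z w. cmod (1 - z * cnj w) powr - (a + 2)"
  \<comment> \<open>In this term F is relaxed to \<open>bdist z \<ge> m\<close>, which keeps the
    singular power of \<open>bdist z\<close> away from 0. The other term retains
    \<open>indicator F\<close> and uses that |F| \<le> 2m.\<close>
  let ?U = "\<lambda>z w. ennreal (bdist z powr (a + 1 - r)) * indicator {m..} (bdist z) * ennreal (?L z w)"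
  let ?V = "\<lambda>z w. ennreal (bdist w powr - (s * r')) * indicator I (bdist w) * ennreal (?L z w)"
  let ?B = "\<lambda>z. ennreal (\<eta> powr - r') * ennreal (bdist z powr (a + 1)) * indicator F z"
  let ?IU = "\<integral>\<^sup>+w. \<integral>\<^sup>+z. ennreal (\<eta> powr r) * indicator E w * ?U z w \<partial>dA \<partial>dA"
  let ?IV = "\<integral>\<^sup>+w. \<integral>\<^sup>+z. ?B z * ?V z w \<partial>dA \<partial>dA"
  let ?cU = "\<eta> powr r * (K * (m powr (1 - r) / (r - 1)))" and ?cV = "\<eta> powr - r' * (K * (\<kappa> * e powr (1 - s * r')))"
  let ?p = "\<lambda>u. ennreal (u powr - (s * r')) * indicator I u"
  have pt: "ennreal (kern a (- s) (a + 2) z w) * indicator F z * (indicator E w * indicator I (bdist w))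
     \<le> ennreal (\<eta> powr r) * indicator E w * ?U z w + ?B z * ?V z w"
    if "z \<in> space dA" "w \<in> space dA" for z w
  proof (cases "z \<in> F \<and> w \<in> E \<and> bdist w \<in> I")
    case True
    have "ennreal (kern a (- s) (a + 2) z w) \<le> ennreal (\<eta> powr r * (bdist z powr (a + 1 - r) * ?L z w)
     + \<eta> powr - r' * (bdist z powr (a + 1) * (bdist w powr - (s * r') * ?L z w)))"
      by (intro ennreal_leI endpoint_pointwise) (use r that \<eta> in auto)
    also have "\<dots> = ennreal (\<eta> powr r) * (ennreal (bdist z powr (a + 1 - r)) * ennreal (?L z w))
       + ennreal (\<eta> powr - r') * (ennreal (bdist z powr (a + 1)) * (ennreal (bdist w powr - (s * r')) * ennreal (?L z w)))"
      by (simp add: ennreal_mult)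
    finally show ?thesis using True Fx by (simp add: mult.assoc)
  qed (auto simp: indicator_def)
  have "?lhs
     = (\<integral>\<^sup>+w. \<integral>\<^sup>+z. ennreal (kern a (- s) (a + 2) z w) * indicator F z * (indicator E w * indicator I (bdist w)) \<partial>dA \<partial>dA)"
    by (rule nn_integral_cong, rule nn_integral_multc[symmetric]) measurable
  also have "\<dots> \<le> (\<integral>\<^sup>+w. \<integral>\<^sup>+z. ennreal (\<eta> powr r) * indicator E w * ?U z w + ?B z * ?V z w \<partial>dA \<partial>dA)"
    by (rule nn_integral_mono, rule nn_integral_mono, rule pt) auto
  also have "\<dots> = (\<integral>\<^sup>+w. (\<integral>\<^sup>+z. ennreal (\<eta> powr r) * indicator E w * ?U z w \<partial>dA) + (\<integral>\<^sup>+z. ?B z * ?V z w \<partial>dA) \<partial>dA)"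
    by (rule nn_integral_cong, rule nn_integral_add) measurable
  also have "\<dots> = ?IU + ?IV"
    by (rule nn_integral_add) measurable
  also have "?IU \<le> ennreal (K / (r - 1) * e powr (1 - s))"
  proof -
    have "?IU
        = (\<integral>\<^sup>+w. ennreal (\<eta> powr r) * indicator E w * (\<integral>\<^sup>+z. ?U z w \<partial>dA) \<partial>dA)"
      by (rule nn_integral_cong, rule nn_integral_cmult) measurable
    also have "\<dots> \<le> (\<integral>\<^sup>+w. ennreal (?cU) * indicator E w \<partial>dA)"
    proof (rule nn_integral_mono)
      fix w assume "w \<in> space dA"
      then have w: "cmod w < 1" by simp
      have "(\<integral>\<^sup>+z. ?U z w \<partial>dA) \<le> ennreal K *
        (\<integral>\<^sup>+u. ennreal (u powr (a + 1 - r)) * indicator {m..} u * ennreal ((bdist w + u) powr (1 - (a + 2))) * indicator {0..1} u \<partial>lborel)"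
        using angular_kernel_integral_le[of w "a + 2" "\<lambda>u. ennreal (u powr (a + 1 - r)) * indicator {m..} u"] a w
        by (simp add: K_def cmod_one_minus_swap[of w])
      also have "(\<integral>\<^sup>+u. ennreal (u powr (a + 1 - r)) * indicator {m..} u * ennreal ((bdist w + u) powr (1 - (a + 2))) * indicator {0..1} u \<partial>lborel)
          \<le> (\<integral>\<^sup>+u. ennreal (u powr - r) * indicator {m..} u \<partial>lborel)"
      proof (rule nn_integral_mono)
        fix u :: real
        show "ennreal (u powr (a + 1 - r)) * indicator {m..} u * ennreal ((bdist w + u) powr (1 - (a + 2))) * indicator {0..1} u
          \<le> ennreal (u powr - r) * indicator {m..} u"
        proof (cases "m \<le> u \<and> u \<le> 1")
          case True
          then have u: "u > 0" using m by simp
          \<comment> \<open>Since a + 1 > 0, \<open>bdist w\<close> may be dropped; the remaining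
            power u^(-r) is integrable on [m, \<infinity>) because r > 1.\<close>
          have "u powr (a + 1 - r) * (bdist w + u) powr (1 - (a + 2)) \<le> u powr (a + 1 - r) * u powr (1 - (a + 2))"
            using a u bdist_pos[OF w] by (intro mult_left_mono powr_mono2') auto
          also have "\<dots> = u powr - r" by (simp add: powr_add[symmetric])
          finally show ?thesis using True u by (simp add: ennreal_mult[symmetric])
        qed auto
      qed
      also have "\<dots> = ennreal (m powr (1 - r) / (r - 1))"
        by (rule nn_integral_powr_atLeast') (use m r in auto)
      finally have "(\<integral>\<^sup>+z. ?U z w \<partial>dA) \<le> ennreal K * ennreal (m powr (1 - r) / (r - 1))"
        by (simp add: mult_left_mono)
      then have "ennreal (\<eta> powr r) * indicator E w * (\<integral>\<^sup>+z. ?U z w \<partial>dA)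
          \<le> ennreal (\<eta> powr r) * indicator E w * (ennreal K * ennreal (m powr (1 - r) / (r - 1)))"
        by (rule mult_left_mono) simp
      also have "\<dots> = ennreal (?cU) * indicator E w"
        using K r by (auto simp: ennreal_mult[symmetric] indicator_def)
      finally show "ennreal (\<eta> powr r) * indicator E w * (\<integral>\<^sup>+z. ?U z w \<partial>dA) \<le> \<dots>" .
    qed
    also have "\<dots> = ennreal (?cU) * ennreal e"
      by (subst nn_integral_cmult_indicator[OF E]) (simp only: Ee)
    also have "\<dots> = ennreal (K / (r - 1) * ((\<eta> powr r * m powr (1 - r)) * e powr 1))"
      using K r e by (simp add: ennreal_mult[symmetric] mult_ac)
    also have "(\<eta> powr r * m powr (1 - r)) * e powr 1 = e powr (1 - s)"
      unfolding \<eta>r by (simp only: powr_add[symmetric]) simp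
    finally show ?thesis .
  qed
  also have "?IV \<le> ennreal (2 * K * \<kappa> * e powr (1 - s))"
  proof -
    have "?IV = (\<integral>\<^sup>+z. \<integral>\<^sup>+w. ?B z * ?V z w \<partial>dA \<partial>dA)"
      by (rule dA_pair.Fubini') measurable
    also have "\<dots> = (\<integral>\<^sup>+z. ?B z * (\<integral>\<^sup>+w. ?V z w \<partial>dA) \<partial>dA)"
      by (rule nn_integral_cong, rule nn_integral_cmult) measurable
    also have "\<dots> \<le> (\<integral>\<^sup>+z. ennreal (?cV) * indicator F z \<partial>dA)"
    proof (rule nn_integral_mono)
      fix z assume "z \<in> space dA"
      then have z: "cmod z < 1" by simp
      let ?x = "bdist z"
      have x: "?x > 0" by (rule bdist_pos[OF z])
      have "(\<integral>\<^sup>+w. ?V z w \<partial>dA) \<le> ennreal K *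
        (\<integral>\<^sup>+u. ?p u * ennreal ((?x + u) powr (1 - (a + 2))) * indicator {0..1} u \<partial>lborel)"
        using angular_kernel_integral_le[of z "a + 2" "\<lambda>u. ?p u"] a z
        by (simp add: K_def)
      also have "(\<integral>\<^sup>+u. ?p u * ennreal ((?x + u) powr (1 - (a + 2))) * indicator {0..1} u \<partial>lborel)
         \<le> (\<integral>\<^sup>+u. (?p u * indicator {0..1} u) * ennreal (?x powr - (a + 1)) \<partial>lborel)"
      proof (rule nn_integral_mono)
        fix u :: real
        show "?p u * ennreal ((?x + u) powr (1 - (a + 2))) * indicator {0..1} u
           \<le> (?p u * indicator {0..1} u) * ennreal (?x powr - (a + 1))"
        proof (cases "u \<in> I \<and> 0 \<le> u \<and> u \<le> 1")
          case True
          \<comment> \<open>Here u is dropped instead; the power of \<open>?x\<close> that remains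
            is cancelled by the weight in \<open>?B\<close>.\<close>
          have "(?x + u) powr - (a + 1) \<le> ?x powr - (a + 1)"
            using a x True by (intro powr_mono2') auto
          moreover have "1 - (a + 2) = - (a + 1)" by simp
          ultimately have "(?x + u) powr (1 - (a + 2)) \<le> ?x powr - (a + 1)" by (simp only:)
          then show ?thesis using True by (simp add: ennreal_mult[symmetric] mult_left_mono)
        qed (auto simp: indicator_def)
      qed
      also have "\<dots> = (\<integral>\<^sup>+u. ?p u * indicator {0..1} u \<partial>lborel) * ennreal (?x powr - (a + 1))"
        by (rule nn_integral_multc) measurable
      also have "\<dots> \<le> ennreal (\<kappa> * e powr (1 - s * r')) * ennreal (?x powr - (a + 1))"
        by (intro mult_right_mono HI) simp
      finally have "(\<integral>\<^sup>+w. ?V z w \<partial>dA) \<le> ennreal K * (ennreal (\<kappa> * e powr (1 - s * r')) * ennreal (?x powr - (a + 1)))"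
        by (simp add: mult_left_mono)
      then have "?B z * (\<integral>\<^sup>+w. ?V z w \<partial>dA) \<le> ?B z * (ennreal K * (ennreal (\<kappa> * e powr (1 - s * r')) * ennreal (?x powr - (a + 1))))"
        by (rule mult_left_mono) simp
      also have "\<dots> = ennreal (?cV * (?x powr (a + 1) * ?x powr - (a + 1))) * indicator F z"
        using K \<kappa> by (auto simp: ennreal_mult[symmetric] indicator_def mult_ac)
      also have "?x powr (a + 1) * ?x powr - (a + 1) = 1"
        using x by (simp only: powr_add[symmetric]) simp
      finally show "?B z * (\<integral>\<^sup>+w. ?V z w \<partial>dA) \<le> ennreal (?cV) * indicator F z"
        by simp
    qed
    also have "\<dots> = ennreal (?cV) * emeasure dA F"
      by (rule nn_integral_cmult_indicator) (rule F)
    also have "\<dots> \<le> ennreal (?cV) * ennreal (2 * m)"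
      by (intro mult_left_mono Fm) simp
    also have "\<dots> = ennreal (2 * K * \<kappa> * ((\<eta> powr - r' * m) * e powr (1 - s * r')))"
      using K \<kappa> m by (simp add: ennreal_mult[symmetric] mult_ac del: ennreal_numeral)
    also have "(\<eta> powr - r' * m) * e powr (1 - s * r') = e powr (1 - s)"
      unfolding \<eta>r' by (simp only: powr_add[symmetric]) (simp add: algebra_simps)
    finally show ?thesis .
  qed
  finally have "?lhs
     \<le> ennreal (K / (r - 1) * e powr (1 - s)) + ennreal (2 * K * \<kappa> * e powr (1 - s))"
    by (simp add: add_mono)
  also have "\<dots> = ennreal (K * (1 / (r - 1) + 2 * \<kappa>) * e powr (1 - s))"
    using K r \<kappa> by (simp add: ennreal_plus[symmetric] algebra_simps del: ennreal_plus)
  finally show ?thesis unfolding K_def .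
qed

text \<open>The two pieces \<open>bdist w > |E|\<close> and \<open>bdist w \<le> |E|\<close> use exponents on either side of \<open>1 / (1 - s)\<close>.\<close>

lemma endpoint_indicator:
  assumes a: "a > -1" and s: "0 < s" "s < 1"
  obtains C where "C > 0"
    "\<And>E F m. E \<in> sets dA \<Longrightarrow> test_set m F \<Longrightarrow>
      (\<integral>\<^sup>+w. (\<integral>\<^sup>+z. ennreal (kern a (- s) (a + 2) z w) * indicator F z \<partial>dA) * indicator E w \<partial>dA)
        \<le> ennreal C * ennreal_powr (emeasure dA E) (1 - s)"
proof -
  \<comment> \<open>These give \<open>s * r1' = 2\<close> and \<open>s * r2' = (1 + s) / 2\<close>,
    so that y^(-s r') is integrable at infinity in the first case and at 0 in the second, while both
    exponents exceed 1. The constant \<open>\<kappa>\<close> below is 1 / (1 - s r2').\<close>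
  define r1' where "r1' = 2 / s"
  define r2' where "r2' = (1 + 1 / s) / 2"
  define r1 where "r1 = r1' / (r1' - 1)"
  define r2 where "r2 = r2' / (r2' - 1)"
  have s1: "1 / s > 1" using s by simp
  have r': "r1' > 1" "r2' > 1" using s1 s by (auto simp: r1'_def r2'_def)
  have r: "r1 > 1" "r2 > 1" "1/r1 + 1/r1' = 1" "1/r2 + 1/r2' = 1"
    using r' by (auto simp: r1_def r2_def field_simps)
  have sr: "s * r1' = 2" "s * r2' = (1 + s) / 2" using s by (auto simp: r1'_def r2'_def field_simps)
  define \<kappa> where "\<kappa> = 1 / (1 - (1 + s) / 2)"
  have \<kappa>: "\<kappa> \<ge> 0" using s by (simp add: \<kappa>_def)
  let ?K = "angular_const (a + 2)"
  have K: "?K > 0" using angular_const_pos[of "a + 2"] a by simp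
  define C where "C = ?K * (1 / (r1 - 1) + 2 * 1) + ?K * (1 / (r2 - 1) + 2 * \<kappa>)"
  have C12: "0 < ?K * (1 / (r1 - 1) + 2 * 1)" "0 < ?K * (1 / (r2 - 1) + 2 * \<kappa>)"
    using K r \<kappa> by (auto intro!: mult_pos_pos add_pos_nonneg)
  then have C: "C > 0" by (simp add: C_def)
  show ?thesis
  proof (rule that[OF C])
    fix E F m assume E [measurable]: "E \<in> sets dA" and "test_set m F"
    interpret test_set m F by fact
    let ?G = "\<lambda>w. \<integral>\<^sup>+z. ennreal (kern a (- s) (a + 2) z w) * indicator F z \<partial>dA"
    define e where "e = measure dA E"
    have Ee: "emeasure dA E = ennreal e" by (simp add: e_def dA.emeasure_eq_measure)
    show "(\<integral>\<^sup>+w. ?G w * indicator E w \<partial>dA) \<le> ennreal C * ennreal_powr (emeasure dA E) (1 - s)"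
    proof (cases "e = 0")
      case True
      then have "E \<in> null_sets dA" using Ee E by auto
      then show ?thesis by (simp add: nn_integral_null_set)
    next
      case False
      then have e: "e > 0" by (simp add: e_def zero_less_measure_iff)
      have 1: "(\<integral>\<^sup>+w. ?G w * (indicator E w * indicator {e<..} (bdist w)) \<partial>dA)
          \<le> ennreal (?K * (1 / (r1 - 1) + 2 * 1) * e powr (1 - s))"
      proof (rule endpoint_piece[OF a r(1) r'(1) r(3) _ _ e _ E Ee])
        have "(\<integral>\<^sup>+u. ennreal (u powr - (s * r1')) * indicator {e<..} u * indicator {0..1} u \<partial>lborel)
          \<le> (\<integral>\<^sup>+u. ennreal (u powr - (s * r1')) * indicator {e..} u \<partial>lborel)"
          by (intro nn_integral_mono) (auto simp: indicator_def)
        also have "\<dots> = ennreal (e powr (1 - s * r1') / (s * r1' - 1))"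
          by (rule nn_integral_powr_atLeast') (use e sr in auto)
        finally show "(\<integral>\<^sup>+u. ennreal (u powr - (s * r1')) * indicator {e<..} u * indicator {0..1} u \<partial>lborel)
           \<le> ennreal (1 * e powr (1 - s * r1'))" by (simp add: sr)
      qed auto
      have 2: "(\<integral>\<^sup>+w. ?G w * (indicator E w * indicator {..e} (bdist w)) \<partial>dA)
          \<le> ennreal (?K * (1 / (r2 - 1) + 2 * \<kappa>) * e powr (1 - s))"
      proof (rule endpoint_piece[OF a r(2) r'(2) r(4) _ \<kappa> e _ E Ee])
        have "(\<integral>\<^sup>+u. ennreal (u powr - (s * r2')) * indicator {..e} u * indicator {0..1} u \<partial>lborel)
          \<le> (\<integral>\<^sup>+u. ennreal (u powr - (s * r2')) * indicator {0..e} u \<partial>lborel)"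
          by (intro nn_integral_mono) (auto simp: indicator_def)
        also have "\<dots> = ennreal (e powr (- (s * r2') + 1) / (- (s * r2') + 1))"
          by (rule nn_integral_powr_Icc_0) (use e sr s in auto)
        also have "e powr (- (s * r2') + 1) / (- (s * r2') + 1) = \<kappa> * e powr (1 - s * r2')"
          by (simp add: sr \<kappa>_def)
        finally show "(\<integral>\<^sup>+u. ennreal (u powr - (s * r2')) * indicator {..e} u * indicator {0..1} u \<partial>lborel)
           \<le> ennreal (\<kappa> * e powr (1 - s * r2'))" .
      qed auto
      have "(\<integral>\<^sup>+w. ?G w * indicator E w \<partial>dA)
         = (\<integral>\<^sup>+w. ?G w * (indicator E w * indicator {e<..} (bdist w)) + ?G w * (indicator E w * indicator {..e} (bdist w)) \<partial>dA)"
        by (intro nn_integral_cong) (auto simp: indicator_def)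
      also have "\<dots> = (\<integral>\<^sup>+w. ?G w * (indicator E w * indicator {e<..} (bdist w)) \<partial>dA) + (\<integral>\<^sup>+w. ?G w * (indicator E w * indicator {..e} (bdist w)) \<partial>dA)"
        by (rule nn_integral_add) measurable
      also have "\<dots> \<le> ennreal (?K * (1 / (r1 - 1) + 2 * 1) * e powr (1 - s)) + ennreal (?K * (1 / (r2 - 1) + 2 * \<kappa>) * e powr (1 - s))"
        by (rule add_mono[OF 1 2])
      also have "\<dots> = ennreal (C * e powr (1 - s))"
        using C12 unfolding C_def by (subst ennreal_plus[symmetric]) (auto simp: distrib_right intro!: mult_nonneg_nonneg)
      also have "\<dots> = ennreal C * ennreal_powr (emeasure dA E) (1 - s)"
        using C e by (simp add: Ee ennreal_powr_ennreal ennreal_mult)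
      finally show ?thesis .
    qed
  qed
qed

text \<open>For a fixed test set the integral is additive in f, so the bound for indicators
  integrates over the level sets of f without any summation in the non-normable space weak L^1. The
  result is the Lorentz norm stripped of its prefactor 1 / (1 - s) \<ge> 1.\<close>

lemma restricted_weak_type_endpoint:
  assumes op: "disc_kernel_op a (- s) (a + 2) \<T>" and a: "a > -1" and s: "0 < s" "s < 1"
  shows "maps_boundedly \<T> (lorentz1_norm (ennreal (1 / (1 - s)))) (weak_norm 1)"
proof -
  obtain C where C: "C > 0" and CH: "\<And>E F m. E \<in> sets dA \<Longrightarrow> test_set m F \<Longrightarrow>
      (\<integral>\<^sup>+w. (\<integral>\<^sup>+z. ennreal (kern a (- s) (a + 2) z w) * indicator F z \<partial>dA) * indicator E w \<partial>dA)
        \<le> ennreal C * ennreal_powr (emeasure dA E) (1 - s)"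
    using endpoint_indicator[OF a s] by blast
  have "maps_boundedly \<T> (lorentz1_norm (ennreal (1 / (1 - s)))) (weak_norm (ennreal 1))"
  proof (rule maps_boundedlyI[OF op _ less_imp_le[OF C]])
    fix f :: "complex \<Rightarrow> complex" and m F assume f [measurable]: "f \<in> borel_measurable dA" and tF: "test_set m F"
    interpret test_set m F by fact
    let ?k = "\<lambda>z w. ennreal (kern a (- s) (a + 2) z w)"
    let ?G = "\<lambda>w. \<integral>\<^sup>+z. ?k z w * indicator F z \<partial>dA"
    let ?E = "\<lambda>t. {w \<in> space dA. t < cmod (f w)}"
    let ?h = "\<lambda>t. ennreal_powr (distribution f t) (1 - s)"
    let ?J = "\<lambda>t. \<integral>\<^sup>+w. ?G w * indicator (?E t) w \<partial>dA"
    have [measurable]: "?J \<in> borel_measurable lborel"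
      by (rule layer_cake_measurable) measurable
    have "(\<integral>\<^sup>+z\<in>F. pos_op a (- s) (a + 2) f z \<partial>dA)
      = (\<integral>\<^sup>+z. \<integral>\<^sup>+w. ?k z w * indicator F z * ennreal (cmod (f w)) \<partial>dA \<partial>dA)"
      unfolding pos_op_def by (rule nn_integral_cong, subst nn_integral_multc[symmetric]) (measurable, simp add: mult_ac)
    also have "\<dots> = (\<integral>\<^sup>+w. \<integral>\<^sup>+z. ?k z w * indicator F z * ennreal (cmod (f w)) \<partial>dA \<partial>dA)"
      by (rule dA_pair.Fubini') measurable
    also have "\<dots> = (\<integral>\<^sup>+w. ?G w * ennreal (cmod (f w)) \<partial>dA)"
      by (rule nn_integral_cong, rule nn_integral_multc) measurable
    also have "\<dots> = (\<integral>\<^sup>+t. ?J t * indicator {0<..} t \<partial>lborel)"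
      by (rule layer_cake) measurable
    \<comment> \<open>The constant is extracted on the side of \<open>?J\<close>, which is known to
      be measurable; monotonicity then passes to \<open>?h\<close>, whose measurability has not been
      established.\<close>
    also have "\<dots> = ennreal C * (\<integral>\<^sup>+t. ennreal (1 / C) * (?J t * indicator {0<..} t) \<partial>lborel)"
      using C by (subst nn_integral_cmult) (measurable, simp add: mult.assoc[symmetric] ennreal_mult[symmetric])
    also have "\<dots> \<le> ennreal C * (\<integral>\<^sup>+t. ?h t * indicator {0<..} t \<partial>lborel)"
    proof (intro mult_left_mono nn_integral_mono)
      fix t :: real
      have E: "?E t \<in> sets dA" by measurable
      have "?J t \<le> ennreal C * ?h t"
        unfolding distribution_def by (rule CH[OF E tF])
      then have "ennreal (1 / C) * ?J t \<le> ennreal (1 / C) * (ennreal C * ?h t)"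
        by (rule mult_left_mono) simp
      also have "\<dots> = ?h t" using C by (simp add: mult.assoc[symmetric] ennreal_mult[symmetric])
      finally show "ennreal (1 / C) * (?J t * indicator {0<..} t) \<le> ?h t * indicator {0<..} t"
        by (simp add: mult.assoc[symmetric] mult_right_mono)
    qed simp
    also have "\<dots> \<le> ennreal (C * m powr (1 - 1 / 1)) * lorentz1_norm (ennreal (1 / (1 - s))) f"
    proof -
      let ?q = "ennreal (1 / (1 - s))" and ?I = "\<integral>\<^sup>+t. ?h t * indicator {0<..} t \<partial>lborel"
      have "1 \<le> ?q" using s by (simp add: ennreal_1[symmetric] del: ennreal_1)
      then have "1 * ?I \<le> ?q * ?I" by (rule mult_right_mono) simp
      then show ?thesis
        using m s by (simp add: lorentz1_norm_def mult_left_mono)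
    qed
    finally show "(\<integral>\<^sup>+z\<in>F. pos_op a (- s) (a + 2) f z \<partial>dA)
       \<le> ennreal (C * m powr (1 - 1 / 1)) * lorentz1_norm (ennreal (1 / (1 - s))) f" .
  qed simp
  then show ?thesis by simp
qed

section \<open>Riesz products\<close>

text \<open>Equality of the image measures carries rotation invariance from nonnegative to
  complex-valued integrands.\<close>

lemma distr_dA_rotate:
  assumes u: "cmod u = 1"
  shows "distr dA borel ((*) u) = distr dA borel (\<lambda>z. z)"
proof (rule measure_eqI)
  have mu: "(*) u \<in> measurable dA borel" by (rule measurable_dA_I) measurable
  fix X assume "X \<in> sets (distr dA borel ((*) u))"
  then have X [measurable]: "X \<in> sets borel" by simp
  have "emeasure (distr dA borel ((*) u)) X = (\<integral>\<^sup>+z. indicator X z \<partial>distr dA borel ((*) u))"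
    by simp
  also have "\<dots> = (\<integral>\<^sup>+z. indicator X (u * z) \<partial>dA)"
    by (rule nn_integral_distr[OF mu]) simp
  also have "\<dots> = (\<integral>\<^sup>+z. indicator X z \<partial>dA)"
    by (rule nn_integral_dA_rotate[OF _ u]) measurable
  also have "\<dots> = (\<integral>\<^sup>+z. indicator X z \<partial>distr dA borel (\<lambda>z. z))"
    by (rule nn_integral_distr[OF id_measurable_dA, symmetric]) simp
  finally show "emeasure (distr dA borel ((*) u)) X = emeasure (distr dA borel (\<lambda>z. z)) X"
    by simp
qed simp

lemma integral_dA_rotate:
  fixes F :: "complex \<Rightarrow> complex"
  assumes [measurable]: "F \<in> borel_measurable borel" and u: "cmod u = 1"
  shows "(\<integral>z. F (u * z) \<partial>dA) = (\<integral>z. F z \<partial>dA)"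
proof -
  have mu: "(*) u \<in> measurable dA borel" by (rule measurable_dA_I) measurable
  have "(\<integral>z. F (u * z) \<partial>dA) = (\<integral>z. F z \<partial>distr dA borel ((*) u))"
    by (rule integral_distr[symmetric, OF mu]) simp
  also have "\<dots> = (\<integral>z. F z \<partial>distr dA borel (\<lambda>z. z))"
    unfolding distr_dA_rotate[OF u] ..
  also have "\<dots> = (\<integral>z. F z \<partial>dA)"
    by (rule integral_distr[OF id_measurable_dA]) simp
  finally show ?thesis .
qed

text \<open>A rotation preserves the integral and multiplies it by \<kappa> \<noteq> 1. This is the
  orthogonality of characters, with \<open>dA\<close> in place of arc length.\<close>

lemma integral_dA_zero:
  fixes F :: "complex \<Rightarrow> complex"
  assumes [measurable]: "F \<in> borel_measurable borel" and u: "cmod u = 1"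
    and F: "\<And>z. F (u * z) = \<kappa> * F z" and \<kappa>: "\<kappa> \<noteq> 1"
  shows "(\<integral>z. F z \<partial>dA) = 0"
proof -
  have "(\<integral>z. F z \<partial>dA) = (\<integral>z. F (u * z) \<partial>dA)"
    by (rule integral_dA_rotate[symmetric, OF _ u]) measurable
  also have "\<dots> = \<kappa> * (\<integral>z. F z \<partial>dA)" by (simp add: F)
  finally have "(\<kappa> - 1) * (\<integral>z. F z \<partial>dA) = 0" by (simp add: algebra_simps)
  then show ?thesis using \<kappa> by simp
qed

lemma sgn_measurable [measurable]: "sgn \<in> borel_measurable (borel :: complex measure)"
  unfolding sgn_div_norm by measurable

text \<open>The imaginary unit keeps the product bounded: each factor has squared modulus 1 +
  \<epsilon>^2 Re^2, so with \<epsilon> = 1 / sqrt N the squared modulus of N factors is at most e.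
  The coefficients at the frequencies 4^j nevertheless remain of first order in \<epsilon>.\<close>

definition riesz :: "real \<Rightarrow> nat \<Rightarrow> complex \<Rightarrow> complex" where
  "riesz \<epsilon> k \<zeta> = (\<Prod>j<k. 1 + \<i> * of_real (\<epsilon> * Re (\<zeta> ^ (4 ^ j))))"

lemma riesz_measurable [measurable]: "riesz \<epsilon> k \<in> borel_measurable borel"
  unfolding riesz_def by measurable

lemma norm_riesz_le:
  assumes "cmod \<zeta> \<le> 1" "N > 0"
  shows "cmod (riesz (1 / sqrt N) N \<zeta>) \<le> 2"
proof -
  have fac: "(cmod (1 + \<i> * of_real (1 / sqrt N * Re (\<zeta> ^ (4 ^ j)))))\<^sup>2 \<le> exp (1 / N)" for j
  proof -
    let ?x = "Re (\<zeta> ^ (4 ^ j))"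
    have "\<bar>?x\<bar> \<le> cmod (\<zeta> ^ (4 ^ j))" by (rule abs_Re_le_cmod)
    also have "\<dots> \<le> 1" using assms by (simp add: norm_power power_le_one)
    finally have x: "?x\<^sup>2 \<le> 1" by (simp add: abs_square_le_1)
    have "(cmod (1 + \<i> * of_real (1 / sqrt N * ?x)))\<^sup>2 = 1 + ?x\<^sup>2 / N"
      by (simp add: cmod_power2 power_divide)
    also have "\<dots> \<le> 1 + 1 / N" using x assms by (simp add: divide_right_mono)
    also have "\<dots> \<le> exp (1 / N)" by (rule exp_ge_add_one_self)
    finally show ?thesis .
  qed
  have "(cmod (riesz (1 / sqrt N) N \<zeta>))\<^sup>2 = (\<Prod>j<N. (cmod (1 + \<i> * of_real (1 / sqrt N * Re (\<zeta> ^ (4 ^ j)))))\<^sup>2)"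
    by (simp add: riesz_def prod_norm[symmetric] prod_power_distrib)
  also have "\<dots> \<le> (\<Prod>j<N. exp (1 / N))"
    by (intro prod_mono conjI fac) simp
  also have "\<dots> = exp 1" using assms by (simp add: exp_of_nat_mult[symmetric])
  also have "\<dots> \<le> 2\<^sup>2" using exp_le by simp
  finally show ?thesis by (rule power2_le_imp_le) simp
qed

text \<open>The radial factor of a function in polar form. \<open>W 0 = 0\<close> removes the
  origin, where \<open>sgn\<close> vanishes and the identities for unimodular numbers fail.\<close>

locale radial_weight =
  fixes W :: "complex \<Rightarrow> complex"
  assumes W_measurable [measurable]: "W \<in> borel_measurable borel"
    and W_radial: "\<And>u z. cmod u = 1 \<Longrightarrow> W (u * z) = W z"
    and W_0: "W 0 = 0"
    and W_integrable: "integrable dA W"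
begin

text \<open>Fourier coefficients of the Riesz product in the variable \<open>sgn z\<close>, averaged
  with the weight \<open>W\<close>. Integer exponents are needed because the recurrence shifts the
  frequency in both directions.\<close>

definition coef :: "real \<Rightarrow> nat \<Rightarrow> int \<Rightarrow> complex" where
  "coef \<epsilon> k n = (\<integral>z. W z * sgn z powi n * riesz \<epsilon> k (sgn z) \<partial>dA)"

lemma powi_measurable [measurable]: "(\<lambda>z::complex. z powi n) \<in> borel_measurable borel"
  unfolding power_int_def by measurable

lemma coef_0: "n \<noteq> 0 \<Longrightarrow> coef \<epsilon> 0 n = 0"
  unfolding coef_def
proof (rule integral_dA_zero)
  assume n: "n \<noteq> 0"
  \<comment> \<open>The rotation by this angle changes the sign of the n-th power.\<close>
  let ?u = "cis (pi / of_int n)"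
  show "cmod ?u = 1" by simp
  have u: "?u powi n = - 1"
    using n by (simp add: cis_power_int)
  fix z
  show "W (?u * z) * sgn (?u * z) powi n * riesz \<epsilon> 0 (sgn (?u * z)) = - 1 * (W z * sgn z powi n * riesz \<epsilon> 0 (sgn z))"
    by (simp add: W_radial sgn_mult power_int_mult_distrib u riesz_def)
qed simp_all

lemma coef_integrable: "integrable dA (\<lambda>z. W z * sgn z powi n * riesz \<epsilon> k (sgn z))" (is "integrable dA ?f")
proof (rule Bochner_Integration.integrable_bound)
  let ?B = "(1 + \<bar>\<epsilon>\<bar>) ^ k"
  show "integrable dA (\<lambda>z. of_real ?B * W z)" by (intro integrable_mult_right W_integrable)
  show "?f \<in> borel_measurable dA"
    by (rule measurable_dA_I) measurable
  have "cmod (?f z) \<le> cmod (of_real ?B * W z)" for z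
  proof (cases "z = 0")
    case False
    then have u: "cmod (sgn z) = 1" by (simp add: norm_sgn)
    have "cmod (riesz \<epsilon> k (sgn z)) \<le> (\<Prod>j<k. 1 + \<bar>\<epsilon>\<bar>)"
      unfolding riesz_def prod_norm[symmetric]
    proof (intro prod_mono conjI)
      fix j
      have "\<bar>Re (sgn z ^ (4 ^ j))\<bar> \<le> cmod (sgn z ^ (4 ^ j))" by (rule abs_Re_le_cmod)
      also have "\<dots> = 1" using u by (simp add: norm_power)
      finally have "\<bar>\<epsilon> * Re (sgn z ^ (4 ^ j))\<bar> \<le> \<bar>\<epsilon>\<bar>" by (simp add: abs_mult mult_left_le)
      then show "cmod (1 + \<i> * of_real (\<epsilon> * Re (sgn z ^ (4 ^ j)))) \<le> 1 + \<bar>\<epsilon>\<bar>"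
        using norm_triangle_ineq[of 1 "\<i> * of_real (\<epsilon> * Re (sgn z ^ (4 ^ j)))"]
        by (simp add: norm_mult del: of_real_mult)
    qed simp
    then have "cmod (?f z) \<le> cmod (W z) * ?B"
      using u by (simp add: norm_mult norm_power_int mult_left_mono)
    also have "\<dots> = cmod (of_real ?B * W z)"
      by (simp only: norm_mult norm_of_real) simp
    finally show ?thesis .
  qed (simp add: W_0)
  then show "AE z in dA. norm (?f z) \<le> norm (of_real ?B * W z)" by simp
qed

text \<open>On the circle the real part of v^(4^k) is the mean of v^(4^k) and its inverse, so a new
  factor adds two shifted copies. The recurrence spares expanding the product.\<close>

lemma coef_Suc: "coef \<epsilon> (Suc k) n = coef \<epsilon> k n + \<i> * of_real (\<epsilon> / 2) * (coef \<epsilon> k (n + 4 ^ k) + coef \<epsilon> k (n - 4 ^ k))"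
proof -
  let ?g = "\<lambda>n z. W z * sgn z powi n * riesz \<epsilon> k (sgn z)"
  have "W z * sgn z powi n * riesz \<epsilon> (Suc k) (sgn z)
      = ?g n z + \<i> * of_real (\<epsilon> / 2) * (?g (n + 4 ^ k) z + ?g (n - 4 ^ k) z)" for z
  proof (cases "z = 0")
    case False
    let ?v = "sgn z"
    have u: "cmod ?v = 1" "?v \<noteq> 0" using False by (auto simp: norm_sgn sgn_zero_iff)
    have inv: "inverse ?v = cnj ?v"
      using u by (intro inverse_unique) (simp add: complex_norm_square[symmetric])
    have "complex_of_real (Re (?v ^ (4 ^ k))) = (?v ^ (4 ^ k) + cnj (?v ^ (4 ^ k))) / 2"
      by (subst complex_add_cnj) simp
    also have "cnj (?v ^ (4 ^ k)) = inverse (?v ^ (4 ^ k))" by (simp add: inv[symmetric] power_inverse)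
    finally have Re: "complex_of_real (Re (?v ^ (4 ^ k))) = (?v ^ (4 ^ k) + inverse (?v ^ (4 ^ k))) / 2" .
    have p1: "?v powi (n + 4 ^ k) = ?v powi n * ?v ^ (4 ^ k)"
      using u power_int_add[of ?v n "4 ^ k"] power_int_of_nat[of ?v "4 ^ k"] by simp
    have p2: "?v powi (n - 4 ^ k) = ?v powi n * inverse (?v ^ (4 ^ k))"
      using u power_int_diff[of ?v n "4 ^ k"] power_int_of_nat[of ?v "4 ^ k"] by (simp add: divide_inverse)
    have "riesz \<epsilon> (Suc k) ?v = riesz \<epsilon> k ?v * (1 + \<i> * of_real \<epsilon> * of_real (Re (?v ^ (4 ^ k))))"
      by (simp add: riesz_def)
    then show ?thesis unfolding p1 p2 Re by (simp add: algebra_simps)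
  qed (simp add: W_0)
  then show ?thesis
    unfolding coef_def by (simp add: coef_integrable)
qed

text \<open>Frequencies occurring in k factors are sums of terms 0 or \<plusminus>4^j with j < k,
  hence at most (4^k - 1) / 3 in modulus.\<close>

lemma coef_eq_0: "4 ^ k \<le> 3 * \<bar>n\<bar> \<Longrightarrow> coef \<epsilon> k n = 0"
proof (induction k arbitrary: n)
  case 0
  then show ?case by (simp add: coef_0)
next
  case (Suc k)
  \<comment> \<open>With q = 4^k the hypothesis says |n| \<ge> 4q / 3, so that |n|, |n + q| and |n -
    q| are all at least q / 3.\<close>
  have "(q::int) \<le> 3 * \<bar>n\<bar> \<and> q \<le> 3 * \<bar>n + q\<bar> \<and> q \<le> 3 * \<bar>n - q\<bar>" if "4 * q \<le> 3 * \<bar>n\<bar>" "q > 0" for q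
    using that by (cases "n < 0") (auto simp: abs_if)
  from this[of "4 ^ k"] have "4 ^ k \<le> 3 * \<bar>n\<bar>" "4 ^ k \<le> 3 * \<bar>n + 4 ^ k\<bar>" "4 ^ k \<le> 3 * \<bar>n - 4 ^ k\<bar>"
    using Suc.prems by auto
  then show ?case by (simp add: coef_Suc Suc.IH)
qed

lemma coef_const: "coef \<epsilon> k 0 = (\<integral>z. W z \<partial>dA)"
proof (induction k)
  case 0
  then show ?case by (simp add: coef_def riesz_def)
next
  case (Suc k)
  then show ?case by (simp add: coef_Suc coef_eq_0)
qed

text \<open>The factor with index j produces the value out of the constant term. Each later factor
  refers to the frequencies 4^j \<plusminus> 4^k with k > j, which lie outside the spectrum of the
  first k factors because consecutive frequencies have ratio 4.\<close>

lemma coef_lacunary: "j < k \<Longrightarrow> coef \<epsilon> k (4 ^ j) = \<i> * of_real (\<epsilon> / 2) * (\<integral>z. W z \<partial>dA)"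
proof (induction k)
  case (Suc k)
  show ?case
  proof (cases "j = k")
    case True
    then show ?thesis by (simp add: coef_Suc coef_eq_0 coef_const)
  next
    case False
    then have jk: "j < k" using Suc.prems by simp
    have "(4::int) * 4 ^ j \<le> 4 ^ k"
      using power_increasing[of "Suc j" k "4::int"] jk by simp
    moreover have "(4::int) ^ j > 0" by simp
    moreover have "q \<le> 3 * \<bar>x + q\<bar> \<and> q \<le> 3 * \<bar>x - q\<bar>" if "4 * x \<le> q" "x > 0" for x q :: int
      using that by (auto simp: abs_if)
    ultimately have "(4::int) ^ k \<le> 3 * \<bar>4 ^ j + 4 ^ k\<bar>" "4 ^ k \<le> 3 * \<bar>4 ^ j - 4 ^ k :: int\<bar>"
      by blast+
    then show ?thesis by (simp add: coef_Suc coef_eq_0 Suc.IH[OF jk])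
  qed
qed simp

end

section \<open>Failure at the endpoints\<close>

lemma nn_integral_log_finite:
  assumes p: "p > 1"
  shows "(\<integral>\<^sup>+u. ennreal (1 / u * (1 - ln u) powr - p) * indicator {0..1} u \<partial>lborel) < \<infinity>"
proof -
  let ?f = "\<lambda>u::real. 1 / u * (1 - ln u) powr - p"
  define F where "F u = (1 - ln u) powr (1 - p) / (p - 1)" for u :: real
  have "set_integrable lborel (einterval (ereal 0) (ereal 1)) ?f"
  proof (rule interval_integral_FTC_nonneg(1)[where F = F and A = 0 and B = "1 / (p - 1)"])
    show "DERIV F u :> ?f u" if "ereal 0 < ereal u" "ereal u < ereal 1" for u
    proof -
      have u: "0 < u" "u < 1" "1 - ln u > 0" using that by (auto simp: ln_less_zero intro: less_trans[of _ 0])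
      have "((\<lambda>u. (1 - ln u) powr (1 - p)) has_real_derivative (1 - p) * (1 - ln u) powr (1 - p - 1) * (- (1 / u))) (at u)"
        by (rule DERIV_chain2[OF has_real_derivative_powr]) (use u in \<open>auto intro!: derivative_eq_intros simp: field_simps\<close>)
      then have "(F has_real_derivative ((1 - p) * (1 - ln u) powr (1 - p - 1) * (- (1 / u))) / (p - 1)) (at u)"
        unfolding F_def by (rule DERIV_cdivide)
      moreover have "((1 - p) * (1 - ln u) powr (1 - p - 1) * (- (1 / u))) / (p - 1) = ?f u"
        using p u by (simp add: field_simps)
      ultimately show ?thesis by simp
    qed
    show "isCont ?f u" if "ereal 0 < ereal u" "ereal u < ereal 1" for u
    proof -
      have u: "0 < u" "1 - ln u > 0" using that by (auto simp: ln_less_zero intro: less_trans[of _ 0])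
      then show ?thesis by (auto intro!: continuous_intros)
    qed
    show "AE x in lborel. ereal 0 < ereal x \<longrightarrow> ereal x < ereal 1 \<longrightarrow> 0 \<le> ?f x" by simp
    have "(F \<longlongrightarrow> 0) (at_right 0)" unfolding F_def using p by real_asymp
    then show "((F \<circ> real_of_ereal) \<longlongrightarrow> 0) (at_right (ereal 0))" by (simp add: ereal_tendsto_simps)
    have "(F \<longlongrightarrow> (1 - ln 1) powr (1 - p) / (p - 1)) (at_left 1)"
      unfolding F_def using p by (intro tendsto_intros) auto
    then show "((F \<circ> real_of_ereal) \<longlongrightarrow> 1 / (p - 1)) (at_left (ereal 1))" by (simp add: ereal_tendsto_simps)
  qed simp
  then have "(\<integral>\<^sup>+u. ennreal (norm (indicator {0<..<1} u *\<^sub>R ?f u)) \<partial>lborel) < \<infinity>"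
    by (simp add: set_integrable_def integrable_iff_bounded)
  also have "(\<integral>\<^sup>+u. ennreal (norm (indicator {0<..<1} u *\<^sub>R ?f u)) \<partial>lborel) = (\<integral>\<^sup>+u. ennreal (?f u) * indicator {0..1} u \<partial>lborel)"
  proof (rule nn_integral_cong_AE)
    \<comment> \<open>At \<open>u = 0\<close> both sides vanish because \<open>1 / 0 = 0\<close>;
      only the right end point has to be discarded.\<close>
    have "AE u in lborel. u \<noteq> (1::real)" by (rule AE_lborel_singleton)
    then show "AE u in lborel. ennreal (norm (indicator {0<..<1} u *\<^sub>R ?f u)) = ennreal (?f u) * indicator {0..1} u"
      by eventually_elim (auto simp: indicator_def)
  qed
  finally show ?thesis .
qed

lemma nn_integral_log_infinite:
  "(\<integral>\<^sup>+u. ennreal (1 / u * (1 - ln u) powr - 1) * indicator {0..1} u \<partial>lborel) = \<infinity>"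
proof -
  let ?f = "\<lambda>u::real. 1 / u * (1 - ln u) powr - 1"
  let ?J = "\<integral>\<^sup>+u. ennreal (?f u) * indicator {0..1} u \<partial>lborel"
  have "ennreal M \<le> ?J" if M: "M > 0" for M
  proof -
    \<comment> \<open>Solves ln (1 - ln d) = M, so that the integral from d to 1 is exactly
      M.\<close>
    define d where "d = exp (1 - exp M)"
    have d: "0 < d" "d < 1" using M by (auto simp: d_def)
    define F where "F u = - ln (1 - ln u)" for u :: real
    have "(\<integral>\<^sup>+u. ennreal (?f u) * indicator {d..1} u \<partial>lborel) = ennreal (F 1 - F d)"
    proof (rule nn_integral_FTC_Icc)
      show "DERIV F u :> ?f u" if "u \<in> {d..1}" for u
      proof -
        have "0 < u" "u \<le> 1" using d that by auto
        then have u: "0 < u" "1 - ln u > 0" by (auto intro: le_less_trans[of _ 0])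
        then show ?thesis
          unfolding F_def by (auto intro!: derivative_eq_intros simp: powr_minus_divide field_simps)
      qed
    qed (use d in auto)
    also have "F 1 - F d = M" by (simp add: F_def d_def)
    finally have "ennreal M = (\<integral>\<^sup>+u. ennreal (?f u) * indicator {d..1} u \<partial>lborel)" by simp
    also have "\<dots> \<le> ?J" using d by (intro nn_integral_mono) (auto simp: indicator_def)
    finally show ?thesis .
  qed
  note big = this
  show ?thesis
  proof (rule ccontr)
    assume "?J \<noteq> \<infinity>"
    then obtain r where r: "?J = ennreal r" "r \<ge> 0" by (cases ?J) auto
    show False using big[of "r + 1"] r by simp
  qed
qed

text \<open>The clause of \<open>maps_boundedly\<close> that fails is convergence, so the target
  \<open>Y\<close> is arbitrary. The power |f|^p is y^(-1) (1 - ln y)^(-p) and integrable since p >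
  1, while the weight y^(-s) turns |f| into y^(-1) (1 - ln y)^(-1), which is not.\<close>

lemma endpoint_unbounded:
  assumes op: "disc_kernel_op a (- s) (a + 2) \<T>" and a: "a > -1" and s: "0 < s" "s < 1"
  shows "\<not> maps_boundedly \<T> (Lp_norm (ennreal (1 / (1 - s)))) Y"
proof
  assume mb: "maps_boundedly \<T> (Lp_norm (ennreal (1 / (1 - s)))) Y"
  define p where "p = 1 / (1 - s)"
  have p: "p > 1" "1 / p = 1 - s" using s by (auto simp: p_def)
  define f :: "complex \<Rightarrow> complex" where
    "f w = of_real (bdist w powr - (1 - s) * (1 - ln (bdist w)) powr - 1)" for w
  have f [measurable]: "f \<in> borel_measurable dA" unfolding f_def by (rule measurable_dA_I) measurable
  let ?q = "\<lambda>w. ennreal (1 / bdist w * (1 - ln (bdist w)) powr - 1)" and ?P = "pos_op a (- s) (a + 2) f"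
  have norm_f: "cmod (f w) = bdist w powr - (1 - s) * (1 - ln (bdist w)) powr - 1" for w
    by (simp only: f_def norm_of_real) simp
  have "(\<integral>\<^sup>+w. ennreal (cmod (f w) powr p) \<partial>dA) = (\<integral>\<^sup>+w. ennreal (1 / bdist w * (1 - ln (bdist w)) powr - p) \<partial>dA)"
  proof (rule nn_integral_cong)
    fix w assume "w \<in> space dA"
    then have y: "bdist w > 0" using bdist_pos[of w] by simp
    have "cmod (f w) powr p = (bdist w powr - (1 - s)) powr p * ((1 - ln (bdist w)) powr - 1) powr p"
      unfolding norm_f by (rule powr_mult)
    also have "(bdist w powr - (1 - s)) powr p = bdist w powr - 1"
    proof -
      have "- (1 - s) * p = - 1" using s by (simp add: p_def field_simps)
      then show ?thesis by (simp only: powr_powr)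
    qed
    also have "\<dots> = 1 / bdist w" using y by (simp add: powr_minus_divide)
    also have "((1 - ln (bdist w)) powr - 1) powr p = (1 - ln (bdist w)) powr - p"
      using powr_powr[of "1 - ln (bdist w)" "- 1" p] by simp
    finally show "ennreal (cmod (f w) powr p) = ennreal (1 / bdist w * (1 - ln (bdist w)) powr - p)" by simp
  qed
  also have "\<dots> = (\<integral>\<^sup>+u. ennreal (1 / u * (1 - ln u) powr - p) * indicator {0..1} u \<partial>lborel)"
    by (rule nn_integral_dA_radial) measurable
  also have "\<dots> < \<infinity>" by (rule nn_integral_log_finite[OF p(1)])
  finally have "Lp_norm (ennreal p) f < \<infinity>" using p by (simp add: Lp_norm_def ennreal_powr_def)
  then have "converges_ae \<T> f"
    using mb f unfolding maps_boundedly_def p_def by blast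
  then have fin: "AE z in dA. ?P z < \<infinity>"
    by (simp add: converges_ae_iff[OF op f])
  have inf: "?P z = \<infinity>" if "z \<in> space dA" for z
  proof -
    have z: "cmod z < 1" using that by simp
    \<comment> \<open>A lower bound for the kernel apart from its weight in w, valid because |1 - z
      cnj w| \<le> 2 and a + 2 > 0.\<close>
    let ?k = "bdist z powr a * 2 powr - (a + 2)"
    have "?k > 0" using bdist_pos[OF z] by simp
    then have k: "ennreal ?k \<noteq> 0" by (simp only: ennreal_eq_0_iff not_le)
    have "\<infinity> = ennreal ?k * (\<integral>\<^sup>+u. ennreal (1 / u * (1 - ln u) powr - 1) * indicator {0..1} u \<partial>lborel)"
      using k unfolding nn_integral_log_infinite by (simp only: infinity_ennreal_def ennreal_mult_top if_False)
    also have "\<dots> = ennreal ?k * (\<integral>\<^sup>+w. ?q w \<partial>dA)"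
      using nn_integral_dA_radial[of "\<lambda>u. ennreal (1 / u * (1 - ln u) powr - 1)"] by simp
    also have "\<dots> = (\<integral>\<^sup>+w. ennreal ?k * ?q w \<partial>dA)"
      by (rule nn_integral_cmult[symmetric], rule measurable_dA_I) measurable
    also have "\<dots> \<le> ?P z"
      unfolding pos_op_def
    proof (rule nn_integral_mono)
      fix w assume "w \<in> space dA"
      then have w: "cmod w < 1" by simp
      have y: "bdist w > 0" by (rule bdist_pos[OF w])
      have "cmod (1 - z * cnj w) \<le> 1 + cmod z * cmod w"
        using norm_triangle_ineq4[of 1 "z * cnj w"] by (simp add: norm_mult)
      also have "cmod z * cmod w \<le> 1 * 1" by (rule mult_mono) (use z w in auto)
      finally have "2 powr - (a + 2) \<le> cmod (1 - z * cnj w) powr - (a + 2)"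
        using a one_minus_mult_cnj_nonzero[OF z w] by (intro powr_mono2') auto
      then have "(bdist z powr a * bdist w powr - s * cmod (f w)) * 2 powr - (a + 2)
          \<le> (bdist z powr a * bdist w powr - s * cmod (f w)) * cmod (1 - z * cnj w) powr - (a + 2)"
        by (rule mult_left_mono) simp
      then have "?k * (bdist w powr - s * cmod (f w)) \<le> kern a (- s) (a + 2) z w * cmod (f w)"
        unfolding kern_def by (simp only: mult_ac)
      moreover have "bdist w powr - s * cmod (f w) = (bdist w powr - s * bdist w powr - (1 - s)) * (1 - ln (bdist w)) powr - 1"
        unfolding norm_f by simp
      moreover have "bdist w powr - s * bdist w powr - (1 - s) = 1 / bdist w"
        using y by (simp only: powr_add[symmetric]) (simp add: powr_minus_divide)
      ultimately have "?k * (1 / bdist w * (1 - ln (bdist w)) powr - 1) \<le> kern a (- s) (a + 2) z w * cmod (f w)"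
        by simp
      then show "ennreal ?k * ?q w \<le> ennreal (kern a (- s) (a + 2) z w) * ennreal (cmod (f w))"
        by (simp add: ennreal_mult'[symmetric] ennreal_leI)
    qed
    finally show ?thesis by (simp add: top_unique)
  qed
  have "AE z in dA. False"
    using fin AE_space by eventually_elim (use inf in auto)
  then show False using dA.AE_False by blast
qed

section \<open>Means of weak-type functions and duality with indicators\<close>

lemma measure_bdist_Ioo:
  assumes "0 \<le> \<alpha>" "\<alpha> \<le> \<beta>" "\<beta> \<le> 1"
  shows "measure dA {z \<in> space dA. \<alpha> < bdist z \<and> bdist z < \<beta>} = \<beta> - \<alpha>"
proof -
  let ?R = "{z \<in> space dA. \<alpha> < bdist z \<and> bdist z < \<beta>}"
  have "emeasure dA ?R = (\<integral>\<^sup>+z. indicator ?R z \<partial>dA)"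
    by (rule nn_integral_indicator[symmetric]) measurable
  also have "\<dots> = (\<integral>\<^sup>+z. indicator {\<alpha><..<\<beta>} (bdist z) \<partial>dA)"
    by (rule nn_integral_cong) (auto simp: indicator_def)
  also have "\<dots> = (\<integral>\<^sup>+u. indicator {\<alpha><..<\<beta>} u * indicator {0..1} u \<partial>lborel)"
    by (rule nn_integral_dA_radial) measurable
  also have "\<dots> = (\<integral>\<^sup>+u. indicator {\<alpha><..<\<beta>} u \<partial>lborel)"
    using assms by (intro nn_integral_cong) (auto simp: indicator_def)
  also have "\<dots> = ennreal (\<beta> - \<alpha>)" using assms by simp
  finally show ?thesis using assms by (simp add: measure_def)
qed

text \<open>Kolmogorov's inequality: within A a level set has measure at most the minimum of \<mu>
  and (C / t)^(1/s), which is integrable in t because 1 / s > 1.\<close>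

lemma weak_norm_integral_le:
  assumes h [measurable]: "h \<in> borel_measurable dA" and s: "0 < s" "s < 1" and C: "C > 0"
    and wn: "weak_norm (ennreal (1 / s)) h \<le> ennreal C"
    and A [measurable]: "A \<in> sets dA" and \<mu>: "emeasure dA A = ennreal \<mu>" "\<mu> > 0"
  shows "(\<integral>\<^sup>+z. ennreal (cmod (h z)) * indicator A z \<partial>dA) \<le> ennreal (C / (1 - s) * \<mu> powr (1 - s))"
proof -
  let ?E = "\<lambda>t. {z \<in> space dA. t < cmod (h z)}"
  have dist: "emeasure dA (?E t) \<le> ennreal ((C / t) powr (1 / s))" if t: "t > 0" for t
  proof -
    have "ennreal t * ennreal_powr (distribution h t) s \<le> weak_norm (ennreal (1 / s)) h"
      unfolding weak_norm_def using s t by (auto intro!: SUP_upper2[of t])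
    also note wn
    finally have "ennreal t * ennreal_powr (distribution h t) s \<le> ennreal C" .
    moreover have d: "distribution h t = ennreal (measure dA (?E t))"
      by (simp add: distribution_def dA.emeasure_eq_measure)
    ultimately have "t * measure dA (?E t) powr s \<le> C"
      using t C by (simp add: ennreal_powr_ennreal ennreal_mult[symmetric])
    then have "measure dA (?E t) powr s \<le> C / t" using t by (simp add: field_simps)
    then have "(measure dA (?E t) powr s) powr (1 / s) \<le> (C / t) powr (1 / s)"
      using s by (intro powr_mono2) auto
    then show ?thesis using s by (simp add: powr_powr dA.emeasure_eq_measure)
  qed
  \<comment> \<open>The level at which the two bounds \<mu> and (C / t)^(1/s) coincide.\<close>
  define t0 where "t0 = C * \<mu> powr - s"
  have t0: "t0 > 0" using C \<mu> by (simp add: t0_def)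
  let ?b = "\<lambda>t. ennreal \<mu> * indicator {0..t0} t + ennreal (C powr (1 / s)) * (ennreal (t powr - (1 / s)) * indicator {t0..} t)"
  have "(\<integral>\<^sup>+z. ennreal (cmod (h z)) * indicator A z \<partial>dA)
     = (\<integral>\<^sup>+t. (\<integral>\<^sup>+z. indicator A z * indicator (?E t) z \<partial>dA) * indicator {0<..} t \<partial>lborel)"
    using layer_cake[OF h, of "indicator A"] by (simp add: mult.commute)
  also have "\<dots> \<le> (\<integral>\<^sup>+t. ?b t \<partial>lborel)"
  proof (rule nn_integral_mono)
    fix t :: real
    have E: "?E t \<in> sets dA" by measurable
    have eq: "(\<integral>\<^sup>+z. indicator A z * indicator (?E t) z \<partial>dA) = emeasure dA (A \<inter> ?E t)"
      by (simp only: indicator_inter_arith[symmetric] nn_integral_indicator[OF sets.Int[OF A E]])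
    show "(\<integral>\<^sup>+z. indicator A z * indicator (?E t) z \<partial>dA) * indicator {0<..} t
      \<le> ?b t"
    proof (cases "t > 0")
      case t: True
      have "emeasure dA (A \<inter> ?E t) \<le> ?b t"
      proof (cases "t \<le> t0")
        case True
        have "emeasure dA (A \<inter> ?E t) \<le> emeasure dA A" by (rule emeasure_mono) auto
        then show ?thesis using \<mu> t True by (simp add: add_increasing2)
      next
        case False
        have "emeasure dA (A \<inter> ?E t) \<le> emeasure dA (?E t)" by (rule emeasure_mono) (use E in auto)
        also have "\<dots> \<le> ennreal ((C / t) powr (1 / s))" by (rule dist[OF t])
        also have "(C / t) powr (1 / s) = C powr (1 / s) * t powr - (1 / s)"
          by (simp add: powr_divide powr_minus_divide)
        finally show ?thesis using False t by (simp add: ennreal_mult)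
      qed
      then show ?thesis unfolding eq using t by simp
    qed simp
  qed
  also have "\<dots> = (\<integral>\<^sup>+t. ennreal \<mu> * indicator {0..t0} t \<partial>lborel) + (\<integral>\<^sup>+t. ennreal (C powr (1 / s)) * (ennreal (t powr - (1 / s)) * indicator {t0..} t) \<partial>lborel)"
    by (rule nn_integral_add) auto
  also have "(\<integral>\<^sup>+t. ennreal \<mu> * indicator {0..t0} t \<partial>lborel) = ennreal (\<mu> * t0)"
    using \<mu> t0 by (simp add: nn_integral_cmult ennreal_mult)
  also have "(\<integral>\<^sup>+t. ennreal (C powr (1 / s)) * (ennreal (t powr - (1 / s)) * indicator {t0..} t) \<partial>lborel)
     = ennreal (C powr (1 / s)) * ennreal (t0 powr (1 - 1 / s) / (1 / s - 1))"
    using t0 s by (simp add: nn_integral_cmult nn_integral_powr_atLeast')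
  also have "\<dots> = ennreal (C powr (1 / s) * (t0 powr (1 - 1 / s) / (1 / s - 1)))"
    using s by (subst ennreal_mult[symmetric]) (auto simp: field_simps)
  also have "C powr (1 / s) * (t0 powr (1 - 1 / s) / (1 / s - 1)) = (C powr (1 / s) * t0 powr (1 - 1 / s)) / (1 / s - 1)"
    by simp
  also have "C powr (1 / s) * t0 powr (1 - 1 / s) = C * \<mu> powr (1 - s)"
  proof -
    have "t0 powr (1 - 1 / s) = C powr (1 - 1 / s) * (\<mu> powr - s) powr (1 - 1 / s)"
      unfolding t0_def by (rule powr_mult)
    also have "(\<mu> powr - s) powr (1 - 1 / s) = \<mu> powr (- s * (1 - 1 / s))" by (rule powr_powr)
    also have "- s * (1 - 1 / s) = 1 - s" using s by (simp add: algebra_simps)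
    finally have "C powr (1 / s) * t0 powr (1 - 1 / s) = (C powr (1 / s) * C powr (1 - 1 / s)) * \<mu> powr (1 - s)" by simp
    also have "C powr (1 / s) * C powr (1 - 1 / s) = C" using C by (simp add: powr_add[symmetric])
    finally show ?thesis .
  qed
  also have "\<mu> * t0 = C * (\<mu> powr 1 * \<mu> powr - s)" using \<mu> by (simp add: t0_def)
  also have "\<mu> powr 1 * \<mu> powr - s = \<mu> powr (1 - s)" by (simp only: powr_add[symmetric]) simp
  also have "ennreal (C * \<mu> powr (1 - s)) + ennreal (C * \<mu> powr (1 - s) / (1 / s - 1)) = ennreal (C / (1 - s) * \<mu> powr (1 - s))"
  proof -
    have "C * \<mu> powr (1 - s) + C * \<mu> powr (1 - s) / (1 / s - 1) = C / (1 - s) * \<mu> powr (1 - s)"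
      using s by (simp add: field_simps)
    then show ?thesis using C s by (subst ennreal_plus[symmetric]) auto
  qed
  finally show ?thesis .
qed

text \<open>Integrals over sets control the positive and negative parts of Re h and Im h, four
  pieces in all. In this way an estimate for indicators alone becomes an L^1 bound for the
  transposed operator, which can afterwards be paired with any bounded function.\<close>

lemma integral_norm_le_4:
  fixes h :: "complex \<Rightarrow> complex"
  assumes h: "integrable M h"
    and H: "\<And>E. E \<in> sets M \<Longrightarrow> cmod (\<integral>w. h w * indicator E w \<partial>M) \<le> B"
  shows "(\<integral>w. cmod (h w) \<partial>M) \<le> 4 * B"
proof -
  have [measurable]: "h \<in> borel_measurable M" using h by auto
  have real_case: "(\<integral>w. \<bar>g w\<bar> \<partial>M) \<le> 2 * B"
    if g: "integrable M g" and gE: "\<And>E. E \<in> sets M \<Longrightarrow> \<bar>\<integral>w. g w * indicator E w \<partial>M\<bar> \<le> B" for g :: "complex \<Rightarrow> real"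
  proof -
    have [measurable]: "g \<in> borel_measurable M" using g by auto
    let ?P = "{w \<in> space M. g w > 0}" and ?N = "{w \<in> space M. g w \<le> 0}"
    have P: "?P \<in> sets M" and N: "?N \<in> sets M" by measurable
    have int: "integrable M (\<lambda>w. g w * indicator ?P w)" "integrable M (\<lambda>w. g w * indicator ?N w)"
      using integrable_real_mult_indicator[OF P g] integrable_real_mult_indicator[OF N g] by auto
    have "(\<integral>w. \<bar>g w\<bar> \<partial>M) = (\<integral>w. g w * indicator ?P w - g w * indicator ?N w \<partial>M)"
      by (intro Bochner_Integration.integral_cong) (auto simp: indicator_def)
    also have "\<dots> = (\<integral>w. g w * indicator ?P w \<partial>M) - (\<integral>w. g w * indicator ?N w \<partial>M)"
      by (rule Bochner_Integration.integral_diff) (use int in auto)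
    also have "\<dots> \<le> B + B" using gE[OF P] gE[OF N] by linarith
    finally show ?thesis by simp
  qed
  have hE: "integrable M (\<lambda>w. h w * indicator E w)" if "E \<in> sets M" for E
    using integrable_mult_indicator[OF that h] by (simp add: indicator_scaleR_eq_if mult.commute of_real_def[symmetric] scaleR_conv_of_real of_real_indicator)
  have "(\<integral>w. \<bar>Re (h w)\<bar> \<partial>M) \<le> 2 * B"
  proof (rule real_case)
    show "integrable M (\<lambda>w. Re (h w))" using h by (rule integrable_Re)
    fix E assume E: "E \<in> sets M"
    have "(\<integral>w. Re (h w) * indicator E w \<partial>M) = (\<integral>w. Re (h w * indicator E w) \<partial>M)"
      by (intro Bochner_Integration.integral_cong) (auto simp: indicator_def)
    also have "\<dots> = Re (\<integral>w. h w * indicator E w \<partial>M)" by (rule integral_Re[OF hE[OF E]])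
    finally show "\<bar>\<integral>w. Re (h w) * indicator E w \<partial>M\<bar> \<le> B" using H[OF E] abs_Re_le_cmod order_trans by metis
  qed
  moreover have "(\<integral>w. \<bar>Im (h w)\<bar> \<partial>M) \<le> 2 * B"
  proof (rule real_case)
    show "integrable M (\<lambda>w. Im (h w))" using h by (rule integrable_Im)
    fix E assume E: "E \<in> sets M"
    have "(\<integral>w. Im (h w) * indicator E w \<partial>M) = (\<integral>w. Im (h w * indicator E w) \<partial>M)"
      by (intro Bochner_Integration.integral_cong) (auto simp: indicator_def)
    also have "\<dots> = Im (\<integral>w. h w * indicator E w \<partial>M)" by (rule integral_Im[OF hE[OF E]])
    finally show "\<bar>\<integral>w. Im (h w) * indicator E w \<partial>M\<bar> \<le> B" using H[OF E] abs_Im_le_cmod order_trans by metis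
  qed
  moreover have "(\<integral>w. cmod (h w) \<partial>M) \<le> (\<integral>w. \<bar>Re (h w)\<bar> + \<bar>Im (h w)\<bar> \<partial>M)"
    by (intro integral_mono integrable_norm h Bochner_Integration.integrable_add integrable_abs integrable_Re integrable_Im cmod_le)
  moreover have "\<dots> = (\<integral>w. \<bar>Re (h w)\<bar> \<partial>M) + (\<integral>w. \<bar>Im (h w)\<bar> \<partial>M)"
    by (intro Bochner_Integration.integral_add integrable_abs integrable_Re integrable_Im h)
  ultimately show ?thesis by simp
qed

section \<open>Taylor coefficients of \<open>1 / (1 - v) powr c\<close> and the action of
  \<open>T\<close> on annular phases\<close>

definition binom_coeff :: "real \<Rightarrow> nat \<Rightarrow> real" where
  "binom_coeff c n = pochhammer c n / fact n"

lemma binom_coeff_nonneg: "c > 0 \<Longrightarrow> binom_coeff c n \<ge> 0"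
  by (simp add: binom_coeff_def pochhammer_nonneg)

lemma binom_coeff_sums:
  assumes "cmod v < 1"
  shows "(\<lambda>n. of_real (binom_coeff c n) * v ^ n) sums (1 / (1 - v) powr of_real c)"
proof -
  have "(\<lambda>n. (- of_real c gchoose n) * (- v) ^ n) sums (1 + - v) powr (- of_real c)"
    by (rule gen_binomial_complex) (use assms in simp)
  moreover have "(- of_real c gchoose n) * (- v) ^ n = of_real (binom_coeff c n) * v ^ n" for n
  proof -
    have "(- of_real c gchoose n) * (- v) ^ n = ((- 1) ^ n * (- v) ^ n) * of_real (binom_coeff c n)"
      by (simp add: gbinomial_pochhammer binom_coeff_def pochhammer_of_real)
    also have "(- 1) ^ n * (- v) ^ n = v ^ n" by (simp add: power_mult_distrib[symmetric])
    finally show ?thesis by simp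
  qed
  ultimately show ?thesis by (simp add: powr_minus_divide)
qed

lemma binom_coeff_summable:
  assumes "0 \<le> r" "r < 1"
  shows "summable (\<lambda>n. binom_coeff c n * r ^ n)"
proof -
  have "summable (\<lambda>n. of_real (binom_coeff c n) * (of_real r) ^ n :: complex)"
    using binom_coeff_sums[of "of_real r" c] assms by (auto simp: sums_iff)
  then have "summable (\<lambda>n. complex_of_real (binom_coeff c n * r ^ n))" by simp
  then show ?thesis by (simp only: summable_complex_of_real)
qed

text \<open>Up to the factor n / (c + n), Euler's product sequence for Gamma is n^(c - 1) divided by
  the coefficient. As a convergent sequence it is bounded, and c + n \<le> (c + 1) n for n \<ge>
  1.\<close>

lemma binom_coeff_lower:
  assumes c: "c > 0"
  obtains \<kappa> where "\<kappa> > 0" "\<And>n. n \<ge> 1 \<Longrightarrow> \<kappa> * real n powr (c - 1) \<le> binom_coeff c n"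
proof -
  have "Bseq (Gamma_series c)" using Gamma_series_LIMSEQ[of c] convergent_imp_Bseq convergent_def by blast
  then obtain M where M: "M > 0" "\<And>n. norm (Gamma_series c n) \<le> M" unfolding Bseq_def by auto
  show ?thesis
  proof (rule that[of "1 / ((c + 1) * M)"])
    show "1 / ((c + 1) * M) > 0" using c M by simp
    fix n :: nat assume n: "n \<ge> 1"
    have P: "pochhammer c n > 0" using c by (rule pochhammer_pos)
    have "Gamma_series c n = fact n * real n powr c / (pochhammer c n * (c + real n))"
      using n by (simp add: Gamma_series_def powr_def pochhammer_Suc)
    then have "fact n * real n powr c / (pochhammer c n * (c + real n)) \<le> M"
      using M(2)[of n] abs_le_D1 by (metis real_norm_def)
    then have "real n powr c \<le> M * (c + real n) * binom_coeff c n"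
      using P c n by (simp add: binom_coeff_def field_simps add_pos_pos)
    also have "\<dots> \<le> M * ((c + 1) * real n) * binom_coeff c n"
      using M n c binom_coeff_nonneg[OF c] by (intro mult_right_mono mult_left_mono) (auto simp: algebra_simps)
    finally have "real n powr c / real n \<le> M * (c + 1) * binom_coeff c n"
      using n by (simp add: field_simps)
    moreover have "real n powr c / real n = real n powr (c - 1)" using n by (simp add: powr_diff)
    ultimately have "real n powr (c - 1) \<le> binom_coeff c n * ((c + 1) * M)" by (simp add: mult_ac)
    moreover have "(c + 1) * M > 0" using c M by simp
    ultimately have "real n powr (c - 1) / ((c + 1) * M) \<le> binom_coeff c n" by (simp only: pos_divide_le_eq)
    then show "1 / ((c + 1) * M) * real n powr (c - 1) \<le> binom_coeff c n" by simp
  qed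
qed

definition annulus :: "real \<Rightarrow> real \<Rightarrow> complex set" where
  "annulus \<alpha> \<beta> = {w. \<alpha> < bdist w \<and> bdist w < \<beta>}"

lemma annulus_measurable [measurable]: "annulus \<alpha> \<beta> \<in> sets borel"
  unfolding annulus_def by measurable

lemma bdist_rotate: "cmod u = 1 \<Longrightarrow> bdist (u * z) = bdist z"
  by (simp add: norm_mult)

lemma indicator_annulus_rotate: "cmod u = 1 \<Longrightarrow> indicator (annulus \<alpha> \<beta>) (u * z) = indicator (annulus \<alpha> \<beta>) z"
  by (simp add: annulus_def indicator_def norm_mult)

lemma integrable_bounded_dA:
  fixes f :: "complex \<Rightarrow> 'b::{banach, second_countable_topology}"
  assumes "f \<in> borel_measurable dA" "\<And>z. z \<in> space dA \<Longrightarrow> norm (f z) \<le> B"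
  shows "integrable dA f"
  by (rule dA.integrable_const_bound[where B = B, OF _ assms(1)]) (rule AE_I2, rule assms(2))

lemma integral_annulus_ge:
  fixes f :: "complex \<Rightarrow> real"
  assumes "0 \<le> \<alpha>" "\<alpha> \<le> \<beta>" "\<beta> \<le> 1"
    and int: "integrable dA (\<lambda>z. indicator (annulus \<alpha> \<beta>) z * f z)"
    and ge: "\<And>z. z \<in> space dA \<Longrightarrow> \<alpha> < bdist z \<Longrightarrow> bdist z < \<beta> \<Longrightarrow> v \<le> f z"
  shows "v * (\<beta> - \<alpha>) \<le> (\<integral>z. indicator (annulus \<alpha> \<beta>) z * f z \<partial>dA)"
proof -
  let ?R = "{z \<in> space dA. \<alpha> < bdist z \<and> bdist z < \<beta>}"
  have R [measurable]: "?R \<in> sets dA" by measurable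
  have eq: "?R \<inter> space dA = ?R" by auto
  have "v * (\<beta> - \<alpha>) = (\<integral>z. v * indicator ?R z \<partial>dA)"
    by (simp only: integral_mult_right_zero Bochner_Integration.integral_indicator eq measure_bdist_Ioo[OF assms(1-3)])
  also have "\<dots> \<le> (\<integral>z. indicator (annulus \<alpha> \<beta>) z * f z \<partial>dA)"
  proof (rule integral_mono)
    show "integrable dA (\<lambda>z. v * indicator ?R z)"
      by (rule integrable_bounded_dA[where B = "\<bar>v\<bar>"]) (measurable, auto simp: indicator_def)
    show "integrable dA (\<lambda>z. indicator (annulus \<alpha> \<beta>) z * f z)" by (rule int)
    show "v * indicator ?R z \<le> indicator (annulus \<alpha> \<beta>) z * f z" if "z \<in> space dA" for z
      using ge[OF that] that by (auto simp: indicator_def annulus_def)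
  qed
  finally show ?thesis .
qed

lemma bdist_powr_le:
  assumes "0 < \<alpha>" "\<alpha> \<le> bdist w"
  shows "bdist w powr b \<le> \<alpha> powr - \<bar>b\<bar>"
proof (cases "b \<ge> 0")
  case True
  have "bdist w powr b \<le> 1 powr b" using assms True by (intro powr_mono2) auto
  also have "\<dots> \<le> \<alpha> powr - b"
  proof -
    have "\<alpha> \<le> 1" using assms bdist_le_1[of w] by linarith
    then have "\<alpha> powr b \<le> 1" using assms True by (intro powr_le1) auto
    then show ?thesis using assms by (simp add: powr_minus field_simps)
  qed
  finally show ?thesis using True by simp
next
  case False
  then show ?thesis using assms by (auto intro!: powr_mono2')
qed

lemma integrable_annulus_weight:
  assumes "0 < \<alpha>"
  shows "integrable dA (\<lambda>w. indicator (annulus \<alpha> \<beta>) w * (bdist w powr b * cmod w ^ n))"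
proof (rule integrable_bounded_dA)
  show "(\<lambda>w. indicator (annulus \<alpha> \<beta>) w * (bdist w powr b * cmod w ^ n)) \<in> borel_measurable dA"
    by (rule measurable_dA_I) measurable
  fix w assume w: "w \<in> space dA"
  show "norm (indicator (annulus \<alpha> \<beta>) w * (bdist w powr b * cmod w ^ n)) \<le> \<alpha> powr - \<bar>b\<bar>"
  proof (cases "w \<in> annulus \<alpha> \<beta>")
    case True
    have "bdist w powr b \<le> \<alpha> powr - \<bar>b\<bar>"
      by (rule bdist_powr_le) (use True assms in \<open>auto simp: annulus_def\<close>)
    moreover have "cmod w ^ n \<le> 1" by (intro power_le_one) (use w in auto)
    ultimately have "bdist w powr b * cmod w ^ n \<le> \<alpha> powr - \<bar>b\<bar> * 1"
      by (intro mult_mono) auto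
    then show ?thesis using True by simp
  qed simp
qed

text \<open>The kernel is expanded in powers of z cnj w and integrated term by term; the phase
  \<open>sgn w ^ n\<close> matches only the term of degree n. Thus \<open>T\<close> sends such a
  function to a multiple of z^n times its outer weight. The annulus keeps the weight in w bounded,
  whatever the sign of b.\<close>

lemma T_kernel_annulus:
  assumes c: "c > 0" and z: "cmod z < 1" and R: "0 < \<alpha>"
  shows "(\<integral>w. of_real (bdist w powr b) / (1 - z * cnj w) powr of_real c * (indicator (annulus \<alpha> \<beta>) w * sgn w ^ n) \<partial>dA)
    = of_real (binom_coeff c n) * z ^ n * of_real (\<integral>w. indicator (annulus \<alpha> \<beta>) w * (bdist w powr b * cmod w ^ n) \<partial>dA)"
proof -
  let ?M = "\<integral>w. indicator (annulus \<alpha> \<beta>) w * (bdist w powr b * cmod w ^ n) \<partial>dA"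
  let ?V = "of_real (binom_coeff c n) * z ^ n * of_real ?M :: complex"
  let ?k = "\<lambda>w. of_real (bdist w powr b) / (1 - z * cnj w) powr of_real c * (indicator (annulus \<alpha> \<beta>) w * sgn w ^ n)"
  define Q where "Q w = of_real (bdist w powr b) * (indicator (annulus \<alpha> \<beta>) w * sgn w ^ n)" for w :: complex
  have [measurable]: "Q \<in> borel_measurable borel" unfolding Q_def by measurable
  define B where "B = \<alpha> powr - \<bar>b\<bar>"
  have Q: "cmod (Q w) \<le> B" for w
  proof (cases "w \<in> annulus \<alpha> \<beta>")
    case True
    then have "bdist w powr b \<le> B" unfolding B_def using R by (intro bdist_powr_le) (auto simp: annulus_def)
    moreover have "cmod (sgn w) ^ n \<le> 1" by (intro power_le_one) (auto simp: norm_sgn)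
    moreover have "cmod (Q w) = bdist w powr b * cmod (sgn w) ^ n"
      using True unfolding Q_def norm_mult norm_of_real norm_power by simp
    ultimately show ?thesis using mult_mono[of "bdist w powr b" B "cmod (sgn w) ^ n" 1] by (simp add: B_def)
  qed (simp add: Q_def B_def)
  define f where "f m w = of_real (binom_coeff c m) * (z * cnj w) ^ m * Q w" for m w
  have [measurable]: "f m \<in> borel_measurable borel" for m unfolding f_def by measurable
  have fb: "cmod (f m w) \<le> binom_coeff c m * cmod z ^ m * B" if "w \<in> space dA" for m w
  proof -
    have "cmod w ^ m \<le> 1" using that by (intro power_le_one) auto
    then have "cmod (f m w) \<le> binom_coeff c m * (cmod z ^ m * 1) * B"
      unfolding f_def norm_mult norm_power power_mult_distrib complex_mod_cnj
      using Q[of w] binom_coeff_nonneg[OF c] by (intro mult_mono) auto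
    then show ?thesis by simp
  qed
  have sm: "summable (\<lambda>m. binom_coeff c m * cmod z ^ m * B)"
    by (rule summable_mult2, rule binom_coeff_summable) (use z in auto)
  have fint: "integrable dA (f m)" for m
    by (rule integrable_bounded_dA[OF _ fb], rule measurable_dA_I) measurable
  have "(\<lambda>m. \<integral>w. f m w \<partial>dA) sums (\<integral>w. (\<Sum>m. f m w) \<partial>dA)"
  proof (rule sums_integral[OF fint])
    show "AE w in dA. summable (\<lambda>m. norm (f m w))"
      using AE_space by eventually_elim (rule summable_comparison_test'[OF sm, of 0], use fb in auto)
    have "(\<integral>w. norm (f m w) \<partial>dA) \<le> (\<integral>w. binom_coeff c m * cmod z ^ m * B \<partial>dA)" for m
      by (rule integral_mono) (use fint fb in auto)
    then show "summable (\<lambda>m. \<integral>w. norm (f m w) \<partial>dA)"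
      by (intro summable_comparison_test'[OF sm, of 0]) (simp add: dA.prob_space[unfolded space_dA])
  qed
  moreover have "(\<integral>w. (\<Sum>m. f m w) \<partial>dA) = (\<integral>w. ?k w \<partial>dA)"
  proof (rule Bochner_Integration.integral_cong[OF refl])
    fix w assume w: "w \<in> space dA"
    have "cmod (z * cnj w) < 1"
      using mult_strict_mono'[of "cmod z" 1 "cmod w" 1] z w by (simp add: norm_mult)
    from sums_mult2[OF binom_coeff_sums[OF this, of c], of "Q w"]
    have "(\<lambda>m. f m w) sums (1 / (1 - z * cnj w) powr of_real c * Q w)" by (simp add: f_def)
    then show "(\<Sum>m. f m w) = ?k w"
      by (simp add: sums_iff Q_def)
  qed
  moreover have "(\<integral>w. f m w \<partial>dA) = (if m = n then ?V else 0)" for m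
  proof (cases "m = n")
    case True
    have "f n w = of_real (binom_coeff c n) * z ^ n * of_real (indicator (annulus \<alpha> \<beta>) w * (bdist w powr b * cmod w ^ n))" for w
    proof -
      have "cnj w * sgn w = of_real (cmod w)"
      proof (cases "w = 0")
        case False
        have "cnj w * sgn w = (w * cnj w) / of_real (cmod w)" by (simp add: sgn_eq)
        also have "\<dots> = of_real (cmod w)" using False by (simp add: complex_norm_square[symmetric] power2_eq_square)
        finally show ?thesis .
      qed simp
      then have "cnj w ^ n * sgn w ^ n = of_real (cmod w) ^ n" by (simp add: power_mult_distrib[symmetric])
      moreover have "f n w = of_real (binom_coeff c n) * z ^ n * ((cnj w ^ n * sgn w ^ n) * (of_real (bdist w powr b) * indicator (annulus \<alpha> \<beta>) w))"
        unfolding f_def Q_def power_mult_distrib by (simp only: mult_ac)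
      moreover have "indicator (annulus \<alpha> \<beta>) w = (of_real (indicator (annulus \<alpha> \<beta>) w) :: complex)"
        by (simp add: indicator_def)
      ultimately show ?thesis by (simp only: of_real_mult of_real_power mult_ac)
    qed
    then have "(\<integral>w. f n w \<partial>dA) = of_real (binom_coeff c n) * z ^ n * (\<integral>w. of_real (indicator (annulus \<alpha> \<beta>) w * (bdist w powr b * cmod w ^ n)) \<partial>dA)"
      by (simp only: integral_mult_right_zero)
    then show ?thesis unfolding True by (simp only: integral_complex_of_real if_True simp_thms)
  next
    case False
    \<comment> \<open>Rotation by this angle changes the sign of the mismatched term; the
      denominator is nonzero because m \<noteq> n.\<close>
    let ?t = "pi / (real n - real m)"
    have "(\<integral>w. f m w \<partial>dA) = 0"
    proof (rule integral_dA_zero)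
      show "cmod (cis ?t) = 1" by simp
      have k: "cnj (cis ?t) ^ m * cis ?t ^ n = - 1"
      proof -
        have "cnj (cis ?t) ^ m * cis ?t ^ n = cis (real m * - ?t) * cis (real n * ?t)"
          by (simp only: cis_cnj Complex.DeMoivre)
        also have "\<dots> = cis (real m * - ?t + real n * ?t)" by (rule cis_mult)
        also have "real m * - ?t + real n * ?t = (real n - real m) * ?t" by (simp only: left_diff_distrib mult_minus_right)
        also have "\<dots> = pi" using False by simp
        finally show ?thesis by simp
      qed
      fix w
      have "f m (cis ?t * w) = (cnj (cis ?t) ^ m * cis ?t ^ n) * f m w"
        unfolding f_def Q_def sgn_mult
        by (simp only: bdist_rotate[OF norm_cis] indicator_annulus_rotate[OF norm_cis] power_mult_distrib complex_cnj_mult sgn_cis)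
           (simp only: mult_ac)
      then show "f m (cis ?t * w) = - 1 * f m w" unfolding k .
    qed simp_all
    then show ?thesis using False by simp
  qed
  ultimately have *: "(\<lambda>m. if m = n then ?V else 0)
     sums (\<integral>w. ?k w \<partial>dA)"
    by simp
  show ?thesis
    by (rule sums_unique2[OF *]) (rule sums_single)
qed

text \<open>The function \<open>h\<close> is the transpose of the operator applied to
  \<open>g\<close>. Because \<open>g\<close> lives on an annulus with
  \<open>bdist z > \<alpha>\<close>, the kernel has no singularity there, and the integrand is
  dominated by a multiple of \<open>bdist w powr b\<close>, integrable since b > -1.\<close>

lemma T_Fubini:
  fixes g \<phi> :: "complex \<Rightarrow> complex"
  assumes op: "disc_kernel_op a b c \<T>" and b: "b > -1" and c: "c > 0" and \<alpha>: "0 < \<alpha>"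
    and g [measurable]: "g \<in> borel_measurable borel" and gb: "\<And>z. cmod (g z) \<le> 2 * indicator (annulus \<alpha> \<beta>) z"
    and \<phi> [measurable]: "\<phi> \<in> borel_measurable dA" and \<phi>b: "\<And>w. cmod (\<phi> w) \<le> 1"
  defines "h \<equiv> \<lambda>w. \<integral>z. g z * of_real (bdist z powr a) * snd \<T> z w \<partial>dA"
  shows "(\<integral>z. g z * apply_op \<T> \<phi> z \<partial>dA) = (\<integral>w. h w * \<phi> w \<partial>dA)" and "integrable dA (\<lambda>w. h w * \<phi> w)"
proof -
  note [measurable] = op_measurable[OF op]
  let ?f = "\<lambda>z w. g z * of_real (bdist z powr a) * snd \<T> z w * \<phi> w"
  \<comment> \<open>The factors bound \<open>g\<close>, the outer weight for either sign of a, and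
    the kernel, where |1 - z cnj w| \<ge> 1 - |z| \<ge> \<alpha> / 2.\<close>
  define K where "K = 2 * \<alpha> powr - \<bar>a\<bar> * (\<alpha> / 2) powr - c"
  have K: "K \<ge> 0" by (simp add: K_def)
  have le: "cmod (?f z w) \<le> K * bdist w powr b" if z: "z \<in> space dA" and w: "w \<in> space dA" for z w
  proof (cases "z \<in> annulus \<alpha> \<beta>")
    case True
    have x: "\<alpha> \<le> bdist z" using True by (simp add: annulus_def)
    have 1: "bdist z powr a \<le> \<alpha> powr - \<bar>a\<bar>" by (rule bdist_powr_le[OF \<alpha> x])
    have "\<alpha> / 2 \<le> cmod (1 - z * cnj w)"
    proof -
      have "cmod z * cmod w \<le> cmod z * 1" by (rule mult_left_mono) (use w in auto)
      then have "1 - cmod z \<le> 1 - cmod (z * cnj w)" by (simp add: norm_mult)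
      also have "\<dots> \<le> cmod (1 - z * cnj w)" using norm_triangle_ineq2[of 1 "z * cnj w"] by simp
      finally have "1 - cmod z \<le> cmod (1 - z * cnj w)" .
      moreover have "bdist z \<le> 2 * (1 - cmod z)"
        using zero_le_power2[of "1 - cmod z"] by (simp add: power2_eq_square algebra_simps)
      ultimately show ?thesis using x by simp
    qed
    then have 2: "cmod (1 - z * cnj w) powr - c \<le> (\<alpha> / 2) powr - c"
      using \<alpha> c by (intro powr_mono2') auto
    have "cmod (?f z w) = cmod (g z) * bdist z powr a * (bdist w powr b * cmod (1 - z * cnj w) powr - c) * cmod (\<phi> w)"
    proof -
      have "cmod (snd \<T> z w) = bdist w powr b * cmod (1 - z * cnj w) powr - c"
        by (rule op[unfolded disc_kernel_op_def, THEN conjunct2, THEN conjunct2, rule_format]) (use z w in auto)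
      then show ?thesis by (simp only: norm_mult norm_of_real abs_of_nonneg[OF powr_ge_zero])
    qed
    also have "\<dots> \<le> 2 * \<alpha> powr - \<bar>a\<bar> * (bdist w powr b * (\<alpha> / 2) powr - c) * 1"
      using gb[of z] 1 2 \<phi>b[of w] True by (intro mult_mono) auto
    also have "\<dots> = K * bdist w powr b" by (simp add: K_def)
    finally show ?thesis .
  next
    case False
    then have "g z = 0" using gb[of z] by simp
    then show ?thesis using K by simp
  qed
  have [measurable]: "g \<in> borel_measurable dA" by (rule measurable_dA_I) measurable
  have meas [measurable]: "(\<lambda>p. case p of (z, w) \<Rightarrow> ?f z w) \<in> borel_measurable (dA \<Otimes>\<^sub>M dA)"
    unfolding split_beta' by measurable
  have "(\<integral>\<^sup>+p. ennreal (norm (case p of (z, w) \<Rightarrow> ?f z w)) \<partial>(dA \<Otimes>\<^sub>M dA)) = (\<integral>\<^sup>+z. \<integral>\<^sup>+w. ennreal (cmod (?f z w)) \<partial>dA \<partial>dA)"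
    using dA.nn_integral_fst[of "\<lambda>p. ennreal (norm (case p of (z, w) \<Rightarrow> ?f z w))" dA] meas by simp
  also have "\<dots> \<le> (\<integral>\<^sup>+z. \<integral>\<^sup>+w. ennreal K * ennreal (bdist w powr b) \<partial>dA \<partial>dA)"
  proof (rule nn_integral_mono, rule nn_integral_mono)
    fix z w assume "z \<in> space dA" "w \<in> space dA"
    then have "ennreal (cmod (?f z w)) \<le> ennreal (K * bdist w powr b)" by (intro ennreal_leI le)
    also have "\<dots> = ennreal K * ennreal (bdist w powr b)" using K by (rule ennreal_mult) simp
    finally show "ennreal (cmod (?f z w)) \<le> ennreal K * ennreal (bdist w powr b)" .
  qed
  also have "\<dots> = (\<integral>\<^sup>+w. ennreal K * ennreal (bdist w powr b) \<partial>dA)"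
    using dA.emeasure_space_1 by simp
  also have "\<dots> = ennreal K * (\<integral>\<^sup>+w. ennreal (bdist w powr b) \<partial>dA)"
    by (rule nn_integral_cmult) measurable
  also have "(\<integral>\<^sup>+w. ennreal (bdist w powr b) \<partial>dA) = ennreal (1 / (b + 1))"
    using nn_integral_dA_radial[of "\<lambda>u. ennreal (u powr b)"] nn_integral_powr_Icc_0[OF b, of 1] by simp
  finally have "(\<integral>\<^sup>+p. ennreal (norm (case p of (z, w) \<Rightarrow> ?f z w)) \<partial>(dA \<Otimes>\<^sub>M dA)) < \<infinity>"
    by (rule le_less_trans) (simp add: ennreal_mult_less_top)
  then have int: "integrable (dA \<Otimes>\<^sub>M dA) (case_prod ?f)"
    by (intro integrableI_bounded) measurable
  have fst: "fst \<T> = (\<lambda>z. bdist z powr a)"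
    by (rule op[unfolded disc_kernel_op_def, THEN conjunct1])
  have "(\<integral>w. h w * \<phi> w \<partial>dA) = (\<integral>w. \<integral>z. ?f z w \<partial>dA \<partial>dA)"
    unfolding h_def by (simp only: integral_mult_left_zero)
  also have "\<dots> = (\<integral>z. \<integral>w. ?f z w \<partial>dA \<partial>dA)"
    by (rule dA_pair.Fubini_integral[OF int])
  also have "\<dots> = (\<integral>z. g z * apply_op \<T> \<phi> z \<partial>dA)"
    unfolding apply_op_def fst mult.assoc by (simp only: integral_mult_right_zero)
  finally show "(\<integral>z. g z * apply_op \<T> \<phi> z \<partial>dA) = (\<integral>w. h w * \<phi> w \<partial>dA)" by simp
  have "integrable dA (\<lambda>w. \<integral>z. ?f z w \<partial>dA)"
    by (rule dA_pair.integrable_snd[OF int])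
  then show "integrable dA (\<lambda>w. h w * \<phi> w)"
    unfolding h_def by (simp only: integral_mult_left_zero)
qed

section \<open>The lower bound from lacunary frequencies\<close>

lemma sum_le_1_disjoint:
  fixes f :: "nat \<Rightarrow> real"
  assumes "\<And>k. f k \<le> 1" "\<And>j k. j < k \<Longrightarrow> f j \<noteq> 0 \<Longrightarrow> f k = 0"
  shows "(\<Sum>k<N. f k) \<le> 1"
proof (cases "\<exists>j<N. f j \<noteq> 0")
  case True
  then obtain j where j: "j < N" "f j \<noteq> 0" by blast
  have "f k = 0" if "k \<noteq> j" for k
    using assms(2)[of j k] assms(2)[of k j] j that by (metis nat_neq_iff)
  then have "(\<Sum>k<N. f k) = (\<Sum>k<N. if k = j then f j else 0)"
    by (intro sum.cong) auto
  then show ?thesis using j assms(1)[of j] by simp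
next
  case False
  then have "(\<Sum>k<N. f k) = (\<Sum>k<N. 0)" by (intro sum.cong) auto
  then show ?thesis by simp
qed

text \<open>Bernoulli's inequality applied to t^2, followed by t^(2n) \<le> t^n. It expresses that
  the n-th power has not yet decayed at boundary distances of order 1 / n.\<close>

lemma power_ge_half:
  assumes "0 \<le> t" "t < 1" "real n * (1 - t\<^sup>2) \<le> 1 / 2"
  shows "t ^ n \<ge> 1 / 2"
proof -
  have sq: "t\<^sup>2 \<le> 1" using assms by (simp add: abs_square_le_1)
  have "1 / 2 \<le> 1 + real n * (t\<^sup>2 - 1)" using assms by (simp add: algebra_simps)
  also have "\<dots> \<le> (1 + (t\<^sup>2 - 1)) ^ n"
    by (rule Bernoulli_inequality) simp
  also have "\<dots> = t ^ n * t ^ n" by (simp add: power2_eq_square power_mult_distrib)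
  also have "\<dots> \<le> t ^ n * 1" using assms by (intro mult_left_mono power_le_one) auto
  finally show ?thesis by simp
qed

text \<open>Testing against a Riesz product detects \<open>N\<close> lacunary frequencies simultaneously, each with
  coefficient of size \<open>1 / sqrt N\<close>; their total contribution grows like \<open>sqrt N\<close>.\<close>

lemma T_restricted_lower:
  fixes N :: nat
  assumes b: "b > -1" and s: "0 < s" "s < 1" and C: "C > 0"
    and wn: "\<And>E. E \<in> sets dA \<Longrightarrow> weak_norm (ennreal (1 / s)) (apply_op (T_op (- s) b (b + 2)) (indicator E)) \<le> ennreal C"
    and \<kappa>: "\<kappa> > 0" "\<And>n. n \<ge> 1 \<Longrightarrow> \<kappa> * real n powr (b + 1) \<le> binom_coeff (b + 2) n"
    and N: "N \<ge> 1"
  shows "sqrt N * (\<kappa> * 4 powr - \<bar>b\<bar> * 2 powr - s / 32) \<le> 8 * C / (1 - s)"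
proof -
  let ?\<T> = "T_op (- s) b (b + 2)"
  have op: "disc_kernel_op (- s) b (b + 2) ?\<T>" by (rule disc_kernel_op_T)
  \<comment> \<open>So close to the boundary that 4^k times 2\<delta> is at most 1/2 for every k <
    N; all the monomials z^(4^k) in question are then at least 1/2 in modulus on
    \<open>?A\<close>.\<close>
  define \<delta> :: real where "\<delta> = 1 / 4 ^ N"
  have \<delta>: "\<delta> > 0" by (simp add: \<delta>_def)
  have d2: "2 * \<delta> \<le> 1 / 2"
    using power_increasing[of 1 N "4::real"] N by (simp add: \<delta>_def field_simps)
  let ?A = "annulus \<delta> (2 * \<delta>)"
  let ?\<epsilon> = "1 / sqrt N"
  define g :: "complex \<Rightarrow> complex" where "g z = indicator ?A z * riesz ?\<epsilon> N (sgn z)" for z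
  have g [measurable]: "g \<in> borel_measurable borel" unfolding g_def by measurable
  have gb: "cmod (g z) \<le> 2 * indicator ?A z" for z
  proof -
    have "cmod (riesz ?\<epsilon> N (sgn z)) \<le> 2" by (rule norm_riesz_le) (use N in \<open>auto simp: norm_sgn\<close>)
    then show ?thesis by (auto simp: g_def indicator_def)
  qed
  define h where "h w = (\<integral>z. g z * of_real (bdist z powr - s) * snd ?\<T> z w \<partial>dA)" for w
  have F: "(\<integral>z. g z * apply_op ?\<T> \<phi> z \<partial>dA) = (\<integral>w. h w * \<phi> w \<partial>dA)" "integrable dA (\<lambda>w. h w * \<phi> w)"
    if "\<phi> \<in> borel_measurable dA" "\<And>w. cmod (\<phi> w) \<le> 1" for \<phi>
    using T_Fubini[OF op b _ \<delta> g gb that] b unfolding h_def by simp_all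
  have hint: "integrable dA h"
    using F(2)[of "\<lambda>_. 1"] by simp
  have A [measurable]: "{z \<in> space dA. \<delta> < bdist z \<and> bdist z < 2 * \<delta>} \<in> sets dA" (is "?A' \<in> _") by measurable
  have \<mu>: "emeasure dA ?A' = ennreal \<delta>"
    using measure_bdist_Ioo[of \<delta> "2 * \<delta>"] \<delta> d2 by (simp only: dA.emeasure_eq_measure) simp
  \<comment> \<open>The 4 counts the pieces of \<open>h\<close>, the 2 bounds the Riesz product, and
    the rest is Kolmogorov's inequality on the annulus of measure \<delta>.\<close>
  have up: "(\<integral>w. cmod (h w) \<partial>dA) \<le> 4 * (2 * (C / (1 - s) * \<delta> powr (1 - s)))"
  proof (rule integral_norm_le_4[OF hint])
    fix E assume E: "E \<in> sets dA"
    let ?\<phi> = "indicator E :: complex \<Rightarrow> complex"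
    have \<phi>: "?\<phi> \<in> borel_measurable dA" using E by measurable
    let ?f = "apply_op ?\<T> ?\<phi>"
    have fm [measurable]: "?f \<in> borel_measurable dA" by (rule apply_op_measurable[OF op \<phi>])
    have "ennreal (cmod (\<integral>z. g z * ?f z \<partial>dA)) \<le> (\<integral>\<^sup>+z. ennreal (cmod (g z * ?f z)) \<partial>dA)"
    proof (cases "integrable dA (\<lambda>z. g z * ?f z)")
      case True
      then show ?thesis by (rule integral_norm_bound_ennreal)
    qed (simp add: not_integrable_integral_eq)
    also have "\<dots> \<le> (\<integral>\<^sup>+z. 2 * (ennreal (cmod (?f z)) * indicator ?A' z) \<partial>dA)"
    proof (rule nn_integral_mono)
      fix z assume z: "z \<in> space dA"
      have "cmod (g z * ?f z) \<le> 2 * indicator ?A z * cmod (?f z)"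
        unfolding norm_mult by (rule mult_right_mono[OF gb]) simp
      also have "\<dots> = 2 * (cmod (?f z) * indicator ?A' z)"
        using z by (auto simp: annulus_def indicator_def)
      finally have "ennreal (cmod (g z * ?f z)) \<le> ennreal (2 * (cmod (?f z) * indicator ?A' z))"
        by (rule ennreal_leI)
      also have "\<dots> = 2 * (ennreal (cmod (?f z)) * indicator ?A' z)"
        by (auto simp: indicator_def ennreal_mult)
      finally show "ennreal (cmod (g z * ?f z)) \<le> 2 * (ennreal (cmod (?f z)) * indicator ?A' z)" .
    qed
    also have "\<dots> = 2 * (\<integral>\<^sup>+z. ennreal (cmod (?f z)) * indicator ?A' z \<partial>dA)"
      by (rule nn_integral_cmult) measurable
    also have "\<dots> \<le> 2 * ennreal (C / (1 - s) * \<delta> powr (1 - s))"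
      by (rule mult_left_mono[OF weak_norm_integral_le[OF fm s C wn[OF E] A \<mu> \<delta>]]) simp
    also have "\<dots> = ennreal (2 * (C / (1 - s) * \<delta> powr (1 - s)))"
      using C s by (subst ennreal_mult) auto
    finally have "cmod (\<integral>z. g z * ?f z \<partial>dA) \<le> 2 * (C / (1 - s) * \<delta> powr (1 - s))"
      using C s by simp
    moreover have "(\<integral>z. g z * ?f z \<partial>dA) = (\<integral>w. h w * indicator E w \<partial>dA)"
      by (rule F(1)[OF \<phi>]) (simp add: indicator_def)
    ultimately show "cmod (\<integral>w. h w * indicator E w \<partial>dA) \<le> 2 * (C / (1 - s) * \<delta> powr (1 - s))" by simp
  qed
  \<comment> \<open>Boundary distance between 4^(-k) / 4 and 4^(-k) / 2: the annuli are disjoint for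
    different k, and |w|^(4^k) \<ge> 1/2 on the k-th one.\<close>
  define R where "R k = annulus (1 / 4 ^ k / 4) (1 / 4 ^ k / 2)" for k :: nat
  have R [measurable]: "R k \<in> sets borel" for k unfolding R_def by measurable
  define \<phi> :: "nat \<Rightarrow> complex \<Rightarrow> complex" where "\<phi> k w = indicator (R k) w * sgn w ^ (4 ^ k)" for k w
  have \<phi>m [measurable]: "\<phi> k \<in> borel_measurable dA" for k
    unfolding \<phi>_def by (rule measurable_dA_I) measurable
  have \<phi>b: "cmod (\<phi> k w) \<le> indicator (R k) w" for k w
  proof -
    have "cmod (sgn w) ^ (4 ^ k) \<le> 1" by (intro power_le_one) (auto simp: norm_sgn)
    then show ?thesis by (auto simp: \<phi>_def norm_mult norm_power indicator_def)
  qed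
  have \<phi>1: "cmod (\<phi> k w) \<le> 1" for k w
    using \<phi>b[of k w] by (cases "w \<in> R k") auto
  let ?i = "\<lambda>k. \<integral>w. h w * \<phi> k w \<partial>dA"
  let ?low = "\<kappa> * 4 powr - \<bar>b\<bar> * 2 powr - s / 32 * \<delta> powr (1 - s) * ?\<epsilon>"
  \<comment> \<open>The bound is uniform in k: with n = 4^k, the growth n^(b + 1) of the Taylor
    coefficient compensates the integral over \<open>R k\<close>, of order n^(-(b + 1)). The number
    32 collects 1/8 from \<open>I\<close>, 1/2 from \<epsilon> / 2 and 1/2 from the integral of
    \<open>W\<close>.\<close>
  have low: "?low \<le> cmod (?i k)" if k: "k < N" for k
  proof -
    let ?n = "4 ^ k :: nat"
    define v :: real where "v = 1 / 4 ^ k"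
    have v: "v > 0" "v \<le> 1" "real ?n * v = 1" by (simp_all add: v_def)
    define I where "I = (\<integral>w. indicator (R k) w * (bdist w powr b * cmod w ^ ?n) \<partial>dA)"
    have I_ge: "1 / 2 * (4 powr - \<bar>b\<bar> * v powr b) * (v / 4) \<le> I"
    proof -
      have "1 / 2 * (4 powr - \<bar>b\<bar> * v powr b) * (v / 2 - v / 4) \<le> (\<integral>w. indicator (annulus (v / 4) (v / 2)) w * (bdist w powr b * cmod w ^ ?n) \<partial>dA)"
      proof (rule integral_annulus_ge)
        show "integrable dA (\<lambda>w. indicator (annulus (v / 4) (v / 2)) w * (bdist w powr b * cmod w ^ ?n))"
          using v by (intro integrable_annulus_weight) simp
        fix w assume w: "w \<in> space dA" and y: "v / 4 < bdist w" "bdist w < v / 2"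
        have "real ?n * bdist w \<le> real ?n * (v / 2)" using y by (intro mult_left_mono) auto
        also have "\<dots> = (real ?n * v) / 2" by simp
        finally have "real ?n * bdist w \<le> 1 / 2" unfolding v(3) .
        then have c: "1 / 2 \<le> cmod w ^ ?n" by (rule power_ge_half[rotated 2]) (use w in auto)
        have y0: "bdist w > 0" using y v by linarith
        have "4 powr - \<bar>b\<bar> \<le> (bdist w / v) powr b"
        proof (cases "b \<ge> 0")
          case True
          have "(1 / 4) powr b \<le> (bdist w / v) powr b" using True y v by (intro powr_mono2) (auto simp: field_simps)
          then show ?thesis using True by (simp add: powr_divide powr_minus_divide)
        next
          case False
          have "4 powr b \<le> 1" using False powr_mono[of b 0 "4::real"] by simp
          also have "1 = 1 powr b" by simp
          also have "1 powr b \<le> (bdist w / v) powr b" using False y y0 v by (intro powr_mono2') (auto simp: field_simps)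
          finally show ?thesis using False by simp
        qed
        then have "4 powr - \<bar>b\<bar> * v powr b \<le> (bdist w / v) powr b * v powr b" by (rule mult_right_mono) simp
        also have "\<dots> = bdist w powr b" using v by (simp only: powr_mult[symmetric]) simp
        finally have "(4 powr - \<bar>b\<bar> * v powr b) * (1 / 2) \<le> bdist w powr b * cmod w ^ ?n"
          using c by (intro mult_mono) auto
        then show "1 / 2 * (4 powr - \<bar>b\<bar> * v powr b) \<le> bdist w powr b * cmod w ^ ?n" by simp
      qed (use v in auto)
      then show ?thesis by (simp add: I_def R_def v_def)
    qed
    \<comment> \<open>The radial factors left in the product of \<open>g\<close> and the image of
      \<open>\<phi> k\<close>; the angular factors form the integrand of a lacunary coefficient of
      the Riesz product.\<close>
    define W :: "complex \<Rightarrow> real" where "W z = indicator ?A z * (bdist z powr - s * cmod z ^ ?n)" for z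
    let ?W = "\<integral>z. W z \<partial>dA" and ?r = "1 / 2 * (2 * \<delta>) powr - s * \<delta>"
    let ?p = "\<kappa> * real ?n powr (b + 1) * (1 / 2 * (4 powr - \<bar>b\<bar> * v powr b) * (v / 4))"
    have Wm [measurable]: "W \<in> borel_measurable borel" unfolding W_def by measurable
    have Wint: "integrable dA W"
      unfolding W_def using \<delta> by (rule integrable_annulus_weight)
    have W_ge: "1 / 2 * (2 * \<delta>) powr - s * \<delta> \<le> ?W"
    proof -
      have "1 / 2 * (2 * \<delta>) powr - s * (2 * \<delta> - \<delta>) \<le> (\<integral>z. indicator ?A z * (bdist z powr - s * cmod z ^ ?n) \<partial>dA)"
      proof (rule integral_annulus_ge)
        show "integrable dA (\<lambda>z. indicator ?A z * (bdist z powr - s * cmod z ^ ?n))"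
          using Wint by (simp only: W_def[abs_def])
        fix z assume z: "z \<in> space dA" and x: "\<delta> < bdist z" "bdist z < 2 * \<delta>"
        have "4 * real ?n \<le> 4 ^ N" using power_increasing[of "Suc k" N "4::real"] k by simp
        then have "real ?n * \<delta> \<le> 1 / 4" by (simp add: \<delta>_def field_simps)
        moreover have "real ?n * bdist z \<le> real ?n * (2 * \<delta>)" using x by (intro mult_left_mono) auto
        ultimately have "real ?n * bdist z \<le> 1 / 2" by linarith
        then have c: "1 / 2 \<le> cmod z ^ ?n" by (rule power_ge_half[rotated 2]) (use z in auto)
        have "(2 * \<delta>) powr - s \<le> bdist z powr - s" using x \<delta> s by (intro powr_mono2') auto
        then have "(2 * \<delta>) powr - s * (1 / 2) \<le> bdist z powr - s * cmod z ^ ?n" using c by (intro mult_mono) auto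
        then show "1 / 2 * (2 * \<delta>) powr - s \<le> bdist z powr - s * cmod z ^ ?n" by simp
      qed (use \<delta> d2 in auto)
      then show ?thesis by (simp add: W_def)
    qed
    interpret radial_weight "\<lambda>z. complex_of_real (W z)"
    proof
      show "(\<lambda>z. complex_of_real (W z)) \<in> borel_measurable borel" by measurable
      show "complex_of_real (W (u * z)) = complex_of_real (W z)" if "cmod u = 1" for u z
        using that by (simp add: W_def indicator_annulus_rotate norm_mult)
      show "complex_of_real (W 0) = 0" using d2 by (simp add: W_def annulus_def)
      show "integrable dA (\<lambda>z. complex_of_real (W z))" using Wint by simp
    qed
    define \<gamma> where "\<gamma> = binom_coeff (b + 2) ?n"
    have "?i k = (\<integral>z. g z * apply_op ?\<T> (\<phi> k) z \<partial>dA)"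
      by (rule F(1)[symmetric, OF \<phi>m \<phi>1])
    also have "\<dots> = (\<integral>z. of_real (\<gamma> * I) * (of_real (W z) * sgn z powi (4 ^ k) * riesz ?\<epsilon> N (sgn z)) \<partial>dA)"
    proof (rule Bochner_Integration.integral_cong[OF refl])
      fix z assume "z \<in> space dA"
      then have z: "cmod z < 1" by simp
      have "apply_op ?\<T> (\<phi> k) z = of_real (bdist z powr - s) *
          (\<integral>w. of_real (bdist w powr b) / (1 - z * cnj w) powr of_real (b + 2) * \<phi> k w \<partial>dA)"
        by (simp only: apply_op_def T_op_def fst_conv snd_conv)
      also have "(\<integral>w. of_real (bdist w powr b) / (1 - z * cnj w) powr of_real (b + 2) * \<phi> k w \<partial>dA) = of_real \<gamma> * z ^ ?n * of_real I"
        unfolding \<phi>_def \<gamma>_def I_def R_def by (rule T_kernel_annulus) (use b z in auto)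
      finally have ap: "apply_op ?\<T> (\<phi> k) z = of_real (bdist z powr - s) * (of_real \<gamma> * z ^ ?n * of_real I)" .
      have p: "sgn z powi (4 ^ k) = sgn z ^ ?n" using power_int_of_nat[of "sgn z" ?n] by simp
      have zn: "z ^ ?n = of_real (cmod z ^ ?n) * sgn z ^ ?n"
        by (cases "z = 0") (auto simp: power_mult_distrib[symmetric] sgn_eq)
      have ind: "indicator ?A z = (of_real (indicator ?A z) :: complex)" by (simp add: indicator_def)
      show "g z * apply_op ?\<T> (\<phi> k) z = of_real (\<gamma> * I) * (of_real (W z) * sgn z powi (4 ^ k) * riesz ?\<epsilon> N (sgn z))"
        unfolding ap g_def W_def p zn ind of_real_mult by (simp only: mult_ac)
    qed
    also have "\<dots> = of_real (\<gamma> * I) * coef ?\<epsilon> N (4 ^ k)"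
      unfolding coef_def by (rule integral_mult_right_zero)
    also have "\<dots> = of_real (\<gamma> * I) * (\<i> * of_real (?\<epsilon> / 2) * of_real ?W)"
      by (subst coef_lacunary[OF k]) (simp only: integral_complex_of_real)
    finally have "cmod (?i k) = \<bar>\<gamma> * I\<bar> * (?\<epsilon> / 2 * \<bar>?W\<bar>)"
      by (simp only: norm_mult norm_of_real norm_ii) simp
    moreover have "?p * (?\<epsilon> / 2 * ?r)
       \<le> \<bar>\<gamma> * I\<bar> * (?\<epsilon> / 2 * \<bar>?W\<bar>)"
    proof (intro mult_mono)
      have "\<kappa> * real ?n powr (b + 1) \<le> \<gamma>" unfolding \<gamma>_def by (rule \<kappa>(2)) simp
      then have "?p \<le> \<gamma> * I"
        using I_ge \<kappa> v binom_coeff_nonneg[of "b + 2" ?n] b by (intro mult_mono) (auto simp: \<gamma>_def)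
      then show "?p \<le> \<bar>\<gamma> * I\<bar>" by linarith
      show "1 / 2 * (2 * \<delta>) powr - s * \<delta> \<le> \<bar>?W\<bar>" using W_ge by linarith
    qed (use \<delta> in auto)
    moreover have "?p * (?\<epsilon> / 2 * ?r) = ?low"
    proof -
      have 1: "real ?n powr (b + 1) * (v powr b * v) = 1"
      proof -
        have "v powr b * v = v powr (b + 1)" using v by (simp add: powr_add)
        then have "real ?n powr (b + 1) * (v powr b * v) = (real ?n * v) powr (b + 1)" by (simp only: powr_mult)
        then show ?thesis using v by simp
      qed
      have 2: "(2 * \<delta>) powr - s * \<delta> = 2 powr - s * \<delta> powr (1 - s)"
      proof -
        have "(2 * \<delta>) powr - s * \<delta> = 2 powr - s * (\<delta> powr - s * \<delta> powr 1)" using \<delta> by (simp add: powr_mult)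
        also have "\<delta> powr - s * \<delta> powr 1 = \<delta> powr (1 - s)" by (simp only: powr_add[symmetric]) simp
        finally show ?thesis .
      qed
      have "?p * (?\<epsilon> / 2 * ?r)
          = \<kappa> * 4 powr - \<bar>b\<bar> / 32 * (real ?n powr (b + 1) * (v powr b * v)) * ((2 * \<delta>) powr - s * \<delta>) * ?\<epsilon>"
        by (simp add: field_simps)
      then show ?thesis unfolding 1 2 by simp
    qed
    ultimately show ?thesis by linarith
  qed
  \<comment> \<open>The functions \<open>\<phi> k\<close> have disjoint supports and modulus at most
    1, so the N pairings with \<open>h\<close> are together bounded by a single L^1 norm of
    \<open>h\<close>.\<close>
  have "real N * ?low = (\<Sum>k<N. ?low)" by simp
  also have "\<dots> \<le> (\<Sum>k<N. cmod (?i k))" by (intro sum_mono low) simp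
  also have "\<dots> \<le> (\<Sum>k<N. \<integral>w. cmod (h w * \<phi> k w) \<partial>dA)"
    by (intro sum_mono integral_norm_bound)
  also have "\<dots> = (\<integral>w. (\<Sum>k<N. cmod (h w * \<phi> k w)) \<partial>dA)"
    by (rule Bochner_Integration.integral_sum[symmetric]) (rule integrable_norm[OF F(2)[OF \<phi>m \<phi>1]])
  also have "\<dots> \<le> (\<integral>w. cmod (h w) \<partial>dA)"
  proof (rule integral_mono)
    show "integrable dA (\<lambda>w. \<Sum>k<N. cmod (h w * \<phi> k w))"
      by (rule Bochner_Integration.integrable_sum) (rule integrable_norm[OF F(2)[OF \<phi>m \<phi>1]])
    show "integrable dA (\<lambda>w. cmod (h w))" by (rule integrable_norm[OF hint])
    fix w
    have "(\<Sum>k<N. cmod (\<phi> k w)) \<le> 1"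
    proof (rule sum_le_1_disjoint[OF \<phi>1])
      fix j k :: nat assume jk: "j < k" and "cmod (\<phi> j w) \<noteq> 0"
      then have "w \<in> R j" by (auto simp: \<phi>_def indicator_def split: if_splits)
      then have j: "1 / 4 ^ j / 4 < bdist w" by (simp add: R_def annulus_def)
      have "(4::real) ^ Suc j \<le> 4 ^ k" using jk by (intro power_increasing) auto
      then have le: "(1::real) / 4 ^ k \<le> 1 / 4 ^ Suc j" by (intro divide_left_mono) auto
      have half: "x / 2 \<le> x" if "x \<ge> 0" for x :: real using that by simp
      have "(1::real) / 4 ^ k / 2 \<le> 1 / 4 ^ k" by (rule half) simp
      also note le
      also have "(1::real) / 4 ^ Suc j = 1 / 4 ^ j / 4" by simp
      finally have "(1::real) / 4 ^ k / 2 \<le> 1 / 4 ^ j / 4" .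
      then have "w \<notin> R k" using j by (auto simp: R_def annulus_def)
      then show "cmod (\<phi> k w) = 0" by (simp add: \<phi>_def)
    qed
    then have "cmod (h w) * (\<Sum>k<N. cmod (\<phi> k w)) \<le> cmod (h w) * 1" by (rule mult_left_mono) simp
    then show "(\<Sum>k<N. cmod (h w * \<phi> k w)) \<le> cmod (h w)" by (simp add: norm_mult sum_distrib_left)
  qed
  also note up
  finally have "real N * ?low \<le> 4 * (2 * (C / (1 - s) * \<delta> powr (1 - s)))" .
  moreover have "real N * ?\<epsilon> = sqrt N" by (simp add: real_div_sqrt)
  moreover have "real N * (K * D * e) = (real N * e) * K * D" for K D e :: real
    by (simp only: mult_ac)
  ultimately have "sqrt N * (\<kappa> * 4 powr - \<bar>b\<bar> * 2 powr - s / 32) * \<delta> powr (1 - s) \<le> 4 * (2 * (C / (1 - s) * \<delta> powr (1 - s)))"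
    by (simp only:)
  also have "\<dots> = (8 * C / (1 - s)) * \<delta> powr (1 - s)" by simp
  \<comment> \<open>The factor \<open>\<delta> powr (1 - s)\<close> stands on both sides; after
    cancellation N enters only through sqrt N.\<close>
  finally show ?thesis by (rule mult_right_le_imp_le) (use \<delta> in simp)
qed

lemma T_restricted_fails:
  assumes b: "b > -1" and s: "0 < s" "s < 1"
    and wn: "\<And>E. E \<in> sets dA \<Longrightarrow> weak_norm (ennreal (1 / s)) (apply_op (T_op (- s) b (b + 2)) (indicator E)) \<le> ennreal C"
  shows False
proof -
  obtain \<kappa> where \<kappa>: "\<kappa> > 0" "\<And>n. n \<ge> 1 \<Longrightarrow> \<kappa> * real n powr (b + 2 - 1) \<le> binom_coeff (b + 2) n"
    using binom_coeff_lower[of "b + 2"] b by auto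
  have \<kappa>': "\<kappa> * real n powr (b + 1) \<le> binom_coeff (b + 2) n" if "n \<ge> 1" for n
    using \<kappa>(2)[OF that] by (simp add: add.commute)
  define Q where "Q = \<kappa> * 4 powr - \<bar>b\<bar> * 2 powr - s / 32"
  have Q: "Q > 0" using \<kappa> by (simp add: Q_def)
  \<comment> \<open>The lower bound requires a positive constant, whereas \<open>C\<close> is an
    arbitrary real number.\<close>
  let ?B = "8 * max C 1 / (1 - s)"
  have le: "sqrt N * Q \<le> ?B" if "N \<ge> 1" for N :: nat
    unfolding Q_def
  proof (rule T_restricted_lower[OF b s _ _ \<kappa>(1) \<kappa>' that])
    fix E assume "E \<in> sets dA"
    from wn[OF this] show "weak_norm (ennreal (1 / s)) (apply_op (T_op (- s) b (b + 2)) (indicator E)) \<le> ennreal (max C 1)"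
      by (rule order_trans) (auto intro!: ennreal_leI)
  qed auto
  have B: "?B / Q \<ge> 0" using s Q by simp
  obtain n :: nat where n: "?B / Q + 1 < real n" using reals_Archimedean2 by blast
  then have n1: "n \<ge> 1" using B by linarith
  \<comment> \<open>Perfect squares make the root exact; by the choice of n the bound is
    exceeded.\<close>
  have "sqrt (real (n\<^sup>2)) * Q \<le> ?B" by (rule le) (use n1 in simp)
  then have "real n * Q \<le> ?B" by simp
  then have "real n \<le> ?B / Q" by (simp only: pos_le_divide_eq[OF Q])
  then show False using n by linarith
qed


section \<open>Transfer of the failure from \<open>T\<close> to \<open>S\<close>, and from
  indicators to bounded functions\<close>

lemma weak_norm_mono:
  assumes "g \<in> borel_measurable dA" "q > 0" "\<And>z. z \<in> space dA \<Longrightarrow> cmod (f z) \<le> cmod (g z)"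
  shows "weak_norm (ennreal q) f \<le> weak_norm (ennreal q) g"
proof -
  have "distribution f t \<le> distribution g t" for t
    unfolding distribution_def
  proof (rule emeasure_mono)
    show "{z \<in> space dA. t < cmod (f z)} \<subseteq> {z \<in> space dA. t < cmod (g z)}"
      using assms(3) by (auto intro: less_le_trans)
    show "{z \<in> space dA. t < cmod (g z)} \<in> sets dA" using assms(1) by measurable
  qed
  then show ?thesis
    unfolding weak_norm_def using assms(2)
    by (auto intro!: SUP_mono' mult_left_mono ennreal_powr_mono)
qed

text \<open>The kernel of \<open>S\<close> is the modulus of that of \<open>T\<close>, so this is
  the triangle inequality for integrals. Where the integral for \<open>T\<close> is undefined, the
  left side is 0 by the library convention and the comparison still holds.\<close>

lemma T_le_S_indicator:
  assumes "z \<in> space dA"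
  shows "cmod (apply_op (T_op a b c) (indicator E) z) \<le> cmod (apply_op (S_op a b c) (indicator E) z)"
proof -
  let ?T = "T_op a b c" and ?S = "S_op a b c"
  have "(\<integral>w. cmod (snd ?T z w * indicator E w) \<partial>dA) = cmod (\<integral>w. snd ?S z w * indicator E w \<partial>dA)"
  proof -
    have "snd ?S z w * indicator E w = of_real (cmod (snd ?T z w * indicator E w))" if w: "w \<in> space dA" for w
    proof -
      have "cmod z < 1" "cmod w < 1" using w assms by auto
      then have eq: "cmod (snd ?T z w) = cmod (snd ?S z w)"
        using disc_kernel_op_T[of a b c] disc_kernel_op_S[of a b c] unfolding disc_kernel_op_def by metis
      have "cmod (snd ?S z w) = bdist w powr b / cmod (1 - z * cnj w) powr c"
        unfolding S_op_def snd_conv norm_of_real by simp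
      then have "snd ?S z w = of_real (cmod (snd ?T z w))" unfolding eq by (simp only: S_op_def snd_conv)
      then show ?thesis by (auto simp: indicator_def)
    qed
    then have "(\<integral>w. snd ?S z w * indicator E w \<partial>dA) = (\<integral>w. of_real (cmod (snd ?T z w * indicator E w)) \<partial>dA)"
      by (intro Bochner_Integration.integral_cong refl)
    also have "\<dots> = of_real (\<integral>w. cmod (snd ?T z w * indicator E w) \<partial>dA)"
      by (rule integral_complex_of_real)
    finally show ?thesis by simp
  qed
  then have "cmod (\<integral>w. snd ?T z w * indicator E w \<partial>dA) \<le> cmod (\<integral>w. snd ?S z w * indicator E w \<partial>dA)"
    using integral_norm_bound[of dA "\<lambda>w. snd ?T z w * indicator E w"] by simp
  moreover have "fst ?T z = fst ?S z" by (simp add: T_op_def S_op_def)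
  ultimately show ?thesis unfolding apply_op_def by (simp add: norm_mult mult_left_mono)
qed

lemma restricted_weak_type_fails:
  assumes b: "b > -1" and s: "0 < s" "s < 1" and \<T>: "\<T> \<in> {T_op (- s) b (b + 2), S_op (- s) b (b + 2)}"
  shows "\<not> restricted_weak_type \<T> \<infinity> (ennreal (1 / s))"
proof
  assume "restricted_weak_type \<T> \<infinity> (ennreal (1 / s))"
  then obtain C where C: "\<And>E. E \<in> sets dA \<Longrightarrow> weak_norm (ennreal (1 / s)) (apply_op \<T> (indicator E)) \<le> ennreal C"
    unfolding restricted_weak_type_def by auto
  let ?t = "\<lambda>E. apply_op (T_op (- s) b (b + 2)) (indicator E)"
  show False
  proof (rule T_restricted_fails[OF b s])
    fix E assume E: "E \<in> sets dA"
    have "weak_norm (ennreal (1 / s)) (?t E) \<le> weak_norm (ennreal (1 / s)) (apply_op \<T> (indicator E))"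
    proof (cases "\<T> = T_op (- s) b (b + 2)")
      case False
      then have [simp]: "\<T> = S_op (- s) b (b + 2)" using \<T> by simp
      show ?thesis
      proof (rule weak_norm_mono)
        show "apply_op \<T> (indicator E) \<in> borel_measurable dA"
          using apply_op_measurable[OF disc_kernel_op_S[of "- s" b "b + 2"], of "indicator E"] E by simp
      qed (use s T_le_S_indicator in auto)
    qed simp
    also have "\<dots> \<le> ennreal C" by (rule C[OF E])
    finally show "weak_norm (ennreal (1 / s)) (?t E) \<le> ennreal C" .
  qed
qed

text \<open>Indicators have norm at most 1 in L^\<infinity>. Failure of the restricted estimate is
  therefore the stronger negative statement and settles unboundedness on L^\<infinity> as
  well.\<close>

lemma maps_boundedly_imp_restricted:
  assumes "maps_boundedly \<T> (Lp_norm \<infinity>) (weak_norm q)"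
  shows "restricted_weak_type \<T> \<infinity> q"
proof -
  obtain C where C: "\<And>f. f \<in> borel_measurable dA \<Longrightarrow> Lp_norm \<infinity> f < \<infinity> \<Longrightarrow>
      converges_ae \<T> f \<and> apply_op \<T> f \<in> borel_measurable dA \<and> weak_norm q (apply_op \<T> f) \<le> ennreal C * Lp_norm \<infinity> f"
    using assms unfolding maps_boundedly_def by blast
  have "converges_ae \<T> (indicator E) \<and> apply_op \<T> (indicator E) \<in> borel_measurable dA \<and>
      weak_norm q (apply_op \<T> (indicator E)) \<le> ennreal C" if E: "E \<in> sets dA" for E
  proof -
    let ?f = "indicator E :: complex \<Rightarrow> complex"
    have f [measurable]: "?f \<in> borel_measurable dA" using E by measurable
    have le: "Lp_norm \<infinity> ?f \<le> 1"
    proof -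
      have "esssup dA (\<lambda>z. ennreal (cmod (?f z))) \<le> 1"
      proof (rule esssup_I)
        show "(\<lambda>z. ennreal (cmod (?f z))) \<in> borel_measurable dA" by measurable
        show "AE z in dA. ennreal (cmod (?f z)) \<le> 1" by (simp add: indicator_def)
      qed
      then show ?thesis by (simp add: Lp_norm_def)
    qed
    then have "Lp_norm \<infinity> ?f < \<infinity>" by (rule le_less_trans) simp
    from C[OF f this] have *: "converges_ae \<T> ?f" "apply_op \<T> ?f \<in> borel_measurable dA"
      "weak_norm q (apply_op \<T> ?f) \<le> ennreal C * Lp_norm \<infinity> ?f" by auto
    note *(3)
    also have "ennreal C * Lp_norm \<infinity> ?f \<le> ennreal C * 1" by (rule mult_left_mono[OF le]) simp
    finally show ?thesis using * by simp
  qed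
  then show ?thesis unfolding restricted_weak_type_def by auto
qed

text \<open>Since s > 0, the relation between p and q excludes q = \<infinity>, and with q \<ge> 1
  it forces p > 1. Moreover 1/p = 1/q - s \<le> 1 - s \<le> b + 1, with equality throughout only for
  q = 1 and b = - s; hence the condition of the Schur test fails at no other finite p.\<close>

lemma weak_type_range:
  fixes p q :: ennreal
  assumes op: "disc_kernel_op a b (a + b + 2 + s) \<T>" and b: "b > -1"
    and s: "0 < s" "s < 1" "a + s \<ge> 0" "b + s \<ge> 0"
    and pq: "1 \<le> p" "1 \<le> q" "1 / q = 1 / p + ennreal s"
    and p: "p = \<infinity> \<Longrightarrow> a \<noteq> - s" and q: "q = 1 \<Longrightarrow> b \<noteq> - s"
  shows "maps_boundedly \<T> (Lp_norm p) (weak_norm q)"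
proof -
  have inv: "1 / ennreal r = ennreal (1 / r)" if "r > 0" for r
    using divide_ennreal[of 1 r] that by simp
  have "q \<noteq> \<infinity>"
  proof
    assume "q = \<infinity>"
    then have "1 / p + ennreal s = 0" using pq(3) by simp
    then show False using s by simp
  qed
  then obtain q' where q': "q = ennreal q'" "q' \<ge> 0" by (cases q) auto
  have q1: "q' \<ge> 1" using pq(2) q' by (simp add: ennreal_1[symmetric] del: ennreal_1)
  have invq: "1 / q = ennreal (1 / q')" using inv[of q'] q1 q' by simp
  show ?thesis
  proof (cases "p = \<infinity>")
    case True
    then have "ennreal (1 / q') = ennreal s" using pq(3) invq by simp
    then have "1 / q' = s" using q1 s by simp
    then have "q' = 1 / s" using s q1 by (auto simp: field_simps)
    moreover have "a + s > 0" using p[OF True] s by linarith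
    ultimately show ?thesis
      using weak_type_infinite[OF op s(1) _ b] True q' by simp
  next
    case False
    then obtain p' where p': "p = ennreal p'" "p' \<ge> 0" by (cases p) auto
    have p1: "p' \<ge> 1" using pq(1) p' by (simp add: ennreal_1[symmetric] del: ennreal_1)
    have "ennreal (1 / q') = ennreal (1 / p') + ennreal s"
      using pq(3) invq inv[of p'] p1 p' by simp
    also have "\<dots> = ennreal (1 / p' + s)" using p1 s by simp
    finally have eq: "1 / q' = 1 / p' + s"
      using p1 q1 s by (subst (asm) ennreal_inj) auto
    have q'le: "1 / q' \<le> 1" using q1 by simp
    have "1 / p' < 1" using eq q'le s by linarith
    then have "p' > 1" using p1 by (simp add: field_simps)
    moreover have "1 / p' < b + 1"
    proof (cases "q' = 1")
      case True
      then have "b \<noteq> - s" using q q' by simp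
      then show ?thesis using eq True s by simp
    next
      case False
      then have "1 / q' < 1" using q1 by simp
      then show ?thesis using eq s by linarith
    qed
    ultimately show ?thesis
      unfolding p'(1) q'(1) using s q1 eq by (intro weak_type_finite[OF op]) auto
  qed
qed

theorem theorem10p2:
  fixes a b c :: real
  assumes "a > -1" and "b > -1"
    and "0 < c - a - b - 2" and "c - a - b - 2 < 1"
    and "c \<ge> max (a + 2) (b + 2)"
  shows
    "(b + 1 \<noteq> 3 + a + b - c \<and> - a \<noteq> c - a - b - 2 \<longrightarrow>
        (\<forall>\<T> \<in> {T_op a b c, S_op a b c}.
           \<forall>p q :: ennreal. 1 \<le> p \<and> 1 \<le> q \<and> 1 / q = 1 / p + ennreal (c - a - b - 2) \<longrightarrow>
             maps_boundedly \<T> (Lp_norm p) (weak_norm q)))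
     \<and>
     (- a = c - a - b - 2 \<and> b + 1 \<noteq> 3 + a + b - c \<longrightarrow>
        (\<forall>\<T> \<in> {T_op a b c, S_op a b c}.
           (\<forall>p q :: ennreal. 1 \<le> p \<and> 1 \<le> q \<and> 1 / q = 1 / p + ennreal (c - a - b - 2) \<and> p \<noteq> \<infinity> \<longrightarrow>
             maps_boundedly \<T> (Lp_norm p) (weak_norm q)) \<and>
           \<not> maps_boundedly \<T> (Lp_norm \<infinity>) (weak_norm (ennreal (1 / (c - a - b - 2)))) \<and>
           \<not> restricted_weak_type \<T> \<infinity> (ennreal (1 / (c - a - b - 2)))))
     \<and>
     (b + 1 = 3 + a + b - c \<and> - a \<noteq> c - a - b - 2 \<longrightarrow>
        (\<forall>\<T> \<in> {T_op a b c, S_op a b c}.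
           (\<forall>p q :: ennreal. 1 \<le> p \<and> 1 \<le> q \<and> 1 / q = 1 / p + ennreal (c - a - b - 2) \<and> q \<noteq> 1 \<longrightarrow>
             maps_boundedly \<T> (Lp_norm p) (weak_norm q)) \<and>
           \<not> maps_boundedly \<T> (Lp_norm (ennreal (1 / (3 + a + b - c)))) (weak_norm 1) \<and>
           maps_boundedly \<T> (lorentz1_norm (ennreal (1 / (3 + a + b - c)))) (weak_norm 1)))
     \<and>
     (b + 1 = 3 + a + b - c \<and> - a = c - a - b - 2 \<longrightarrow>
        (\<forall>\<T> \<in> {T_op a b c, S_op a b c}.
           (\<forall>p q :: ennreal. 1 \<le> p \<and> 1 \<le> q \<and> 1 / q = 1 / p + ennreal (c - a - b - 2) \<and>
               p \<noteq> \<infinity> \<and> q \<noteq> 1 \<longrightarrow>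
             maps_boundedly \<T> (Lp_norm p) (weak_norm q)) \<and>
           \<not> weak_type \<T> \<infinity> (ennreal (1 / (c - a - b - 2))) \<and>
           \<not> weak_type \<T> (ennreal (1 / (3 + a + b - c))) 1 \<and>
           maps_boundedly \<T> (lorentz1_norm (ennreal (1 / (3 + a + b - c)))) (weak_norm 1) \<and>
           \<not> restricted_weak_type \<T> \<infinity> (ennreal (1 / (c - a - b - 2)))))"
proof -
  define s where "s = c - a - b - 2"
  have s: "0 < s" "s < 1" "a + s \<ge> 0" "b + s \<ge> 0" and c: "c = a + b + 2 + s"
    using assms by (auto simp: s_def)
  have e: "c - a - b - 2 = s" "3 + a + b - c = 1 - s" by (auto simp: s_def)
  have op: "disc_kernel_op a b (a + b + 2 + s) \<T>" if "\<T> \<in> {T_op a b c, S_op a b c}" for \<T>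
    using that disc_kernel_op_T[of a b c] disc_kernel_op_S[of a b c] by (auto simp: c)
  have pos: "maps_boundedly \<T> (Lp_norm p) (weak_norm q)"
    if "\<T> \<in> {T_op a b c, S_op a b c}" "1 \<le> p" "1 \<le> q" "1 / q = 1 / p + ennreal s"
      "p = \<infinity> \<Longrightarrow> a \<noteq> - s" "q = 1 \<Longrightarrow> b \<noteq> - s" for \<T> and p q :: ennreal
    by (rule weak_type_range[OF op[OF that(1)] assms(2) s that(2-6)])
  have neg_inf: "\<not> restricted_weak_type \<T> \<infinity> (ennreal (1 / s))"
    if "\<T> \<in> {T_op a b c, S_op a b c}" "- a = s" for \<T>
    using restricted_weak_type_fails[OF assms(2) s(1,2), of \<T>] that by (auto simp: c)
  have neg_inf': "\<not> maps_boundedly \<T> (Lp_norm \<infinity>) (weak_norm (ennreal (1 / s)))"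
    if "\<T> \<in> {T_op a b c, S_op a b c}" "- a = s" for \<T>
    using neg_inf[OF that] maps_boundedly_imp_restricted by blast
  \<comment> \<open>With b = - s the kernel exponent a + b + 2 + s collapses to a + 2, the form used
    in the endpoint lemmas.\<close>
  have endp: "disc_kernel_op a (- s) (a + 2) \<T>"
    if "\<T> \<in> {T_op a b c, S_op a b c}" "b = - s" for \<T>
    using op[OF that(1)] that(2) by simp
  have neg_1: "\<not> maps_boundedly \<T> (Lp_norm (ennreal (1 / (1 - s)))) (weak_norm 1)"
    if "\<T> \<in> {T_op a b c, S_op a b c}" "b = - s" for \<T>
    by (rule endpoint_unbounded[OF endp[OF that] assms(1) s(1,2)])
  have pos_1: "maps_boundedly \<T> (lorentz1_norm (ennreal (1 / (1 - s)))) (weak_norm 1)"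
    if "\<T> \<in> {T_op a b c, S_op a b c}" "b = - s" for \<T>
    by (rule restricted_weak_type_endpoint[OF endp[OF that] assms(1) s(1,2)])
  have b: "b + 1 = 1 - s \<longleftrightarrow> b = - s" by auto
  show ?thesis
    unfolding e b weak_type_def
    by (intro conjI impI ballI allI; (rule pos neg_inf neg_inf' neg_1 pos_1)?; (elim conjE)?; (assumption | simp | auto)?)
qed

end
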